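(* Let $\alpha,\beta\in\mathbb{C}$. For a partition $\lambda=0^{m_0(\lambda)}1^{m_1(\lambda)}2^{m_2(\lambda)}\cdots$ put $$A_\lambda=\Big(\prod_{i\ge0}H_{m_{2i}(\lambda)}(\alpha\beta;t)\prod_{i\ge0}H_{m_{2i+1}(\lambda)}(\beta/\alpha;t)\Big)(-\alpha)^{\#\text{ of odd parts of }\lambda},$$ $$B_\lambda=\Big(\prod_{i\ge0}H_{m_{2i+1}(\lambda)}(\alpha\beta;t)\prod_{i\ge0}H_{m_{2i}(\lambda)}(\beta/\alpha;t)\Big)(-\alpha)^{\#\text{ of even parts of }\lambda}.$$ (i) If $n\ge1$ and $\lambda$ has $2n$ parts (zeros included), then $$\frac1Z\int_T P_\lambda(x_1^{\pm1},\dots,x_n^{\pm1};t)\,\tilde\Delta_K^{(n)}(x;1,-1,\sqrt t,-\sqrt t;t)\prod_{i=1}^n(1-\alpha x_i^{\pm1})(1-\beta x_i^{\pm1})\,dT=\frac{\phi_{2n}(t)}{v_\lambda(t)(1-t)^{2n}}\,[A_\lambda+B_\lambda],$$ where $Z=\int_T\tilde\Delta_K^{(n)}(x;1,-1,\sqrt t,-\sqrt t;t)\,dT$. (ii) If $n\ge1$ and $\lambda$ has $2n$ parts (zeros included), then $$\frac{(1-\alpha^2)(1-\beta^2)}{Z}\int_T P_\lambda(x_1^{\pm1},\dots,x_{n-1}^{\pm1},1,-1;t)\,\tilde\Delta_K^{(n-1)}(x;t,-t,\sqrt t,-\sqrt t;t)\prod_{i=1}^{n-1}(1-\alpha x_i^{\pm1})(1-\beta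 x_i^{\pm1})\,dT=\frac{\phi_{2n}(t)}{v_\lambda(t)(1-t)^{2n}}\,[A_\lambda-B_\lambda],$$ where $Z=\int_T\tilde\Delta_K^{(n-1)}(x;t,-t,\sqrt t,-\sqrt t;t)\,dT$. (iii) If $n\ge0$ and $\lambda$ has $2n+1$ parts (zeros included), then $$\frac{(1-\alpha)(1-\beta)}{Z}\int_T P_\lambda(x_1^{\pm1},\dots,x_n^{\pm1},1;t)\,\tilde\Delta_K^{(n)}(x;t,-1,\sqrt t,-\sqrt t;t)\prod_{i=1}^n(1-\alpha x_i^{\pm1})(1-\beta x_i^{\pm1})\,dT=\frac{\phi_{2n+1}(t)}{v_\lambda(t)(1-t)^{2n+1}}\,[A_\lambda+B_\lambda],$$ where $Z=\int_T\tilde\Delta_K^{(n)}(x;t,-1,\sqrt t,-\sqrt t;t)\,dT$. (iv) If $n\ge0$ and $\lambda$ has $2n+1$ parts (zeros included), then $$\frac{(1+\alpha)(1+\beta)}{Z}\int_T P_\lambda(x_1^{\pm1},\dots,x_n^{\pm1},-1;t)\,\tilde\Delta_K^{(n)}(x;1,-t,\sqrt t,-\sqrt t;t)\prod_{i=1}^n(1-\alpha x_i^{\pm1})(1-\beta x_i^{\pm1})\,dT=\frac{\phi_{2n+1}(t)}{v_\lambda(t)(1-t)^{2n+1}}\,[A_\lambda-B_\lambda],$$ where $Z=\int_T\tilde\Delta_K^{(n)}(x;1,-t,\sqrt t,-\sqrt t;t)\,dT$.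
   Context: Let $t\in\mathbb{C}$ with $|t|<1$ and fix a square root $\sqrt t$. $T=\{(x_1,\dots,x_k):|x_1|=\dots=|x_k|=1\}$ is the torus in the variables of integration, $dT=\prod_j \frac{dx_j}{2\pi\sqrt{-1}\,x_j}$ (when there are no variables, the integral is evaluation). $[i]=(1-t^i)/(1-t)$, $[m]!=[m][m-1]\cdots[1]$, $[0]!=1$; $\phi_r(t)=(1-t)(1-t^2)\cdots(1-t^r)$. The Rogers--Szeg\H{o} polynomial is $H_m(z;t)=\sum_{i=0}^m z^i\frac{[m]!}{[m-i]!\,[i]!}$. For a partition $\lambda$ with $N$ parts (zeros included), $m_i(\lambda)$ is the number of $j\in\{1,\dots,N\}$ with $\lambda_j=i$ (so $m_0$ counts zero parts), and $v_\lambda(t)=\prod_{i\ge0}[m_i(\lambda)]!$. Zero parts count as even parts. The Hall--Littlewood polynomial in $N$ variables is $P_\lambda(z_1,\dots,z_N;t)=\frac{1}{v_\lambda(t)}\sum_{w\in S_N}w\Big(z^\lambda\prod_{1\le i<j\le N}\frac{z_i-tz_j}{z_i-z_j}\Big)$, with $w$ permuting the subscripts of the variables. An argument list $x_1^{\pm1},\dots,x_k^{\pm1}$ means $x_1,x_1^{-1},\dots,x_k,x_k^{-1}$. The symmetric Koornwinder density is $$\tilde\Delta_K^{(k)}(x;a,b,c,d;t)=\frac{1}{2^kk!}\prod_{1\le i\le k}\frac{1-x_i^{\pm2}}{(1-ax_i^{\pm1})(1-bx_i^{\pm1})(1-cx_i^{\pm1})(1-dx_i^{\pm1})}\prod_{1\le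 i<j\le k}\frac{1-x_i^{\pm1}x_j^{\pm1}}{1-tx_i^{\pm1}x_j^{\pm1}},$$ where an expression with $\pm$ signs denotes the product over all choices of signs, e.g. $1-x_i^{\pm2}$ means $(1-x_i^2)(1-x_i^{-2})$, $1-\alpha x_i^{\pm1}$ means $(1-\alpha x_i)(1-\alpha x_i^{-1})$, and $1-x_i^{\pm1}x_j^{\pm1}$ is a product of four factors. Common factors (when parameters equal $\pm1$) are cancelled. $A_\lambda$ and $B_\lambda$ are polynomials in $\alpha,\beta$ (because $H_m$ has degree $m$) and are read as such when $\alpha=0$. *)

theory Defs
  imports "HOL-Probability.Probability" "HOL-Library.Groups_Big_Fun"
begin

section \<open>t-numbers and Rogers--Szego polynomials\<close>

definition qnum :: "complex \<Rightarrow> nat \<Rightarrow> complex" where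
  "qnum t i = (1 - t ^ i) / (1 - t)"

definition qfact :: "complex \<Rightarrow> nat \<Rightarrow> complex" where
  "qfact t m = (\<Prod>i=1..m. qnum t i)"

definition phi_poly :: "nat \<Rightarrow> complex \<Rightarrow> complex" where
  "phi_poly r t = (\<Prod>i=1..r. 1 - t ^ i)"

definition rs_poly :: "nat \<Rightarrow> complex \<Rightarrow> complex \<Rightarrow> complex" where
  "rs_poly m z t = (\<Sum>i\<le>m. z ^ i * (qfact t m / (qfact t (m - i) * qfact t i)))"


section \<open>Partitions and Hall--Littlewood polynomials\<close>

text \<open>
  A partition with \<open>N\<close> parts, zeros included, is a weakly decreasing list of naturals of length
  \<open>N\<close>; the multiplicity \<open>m\<^sub>i\<close> is \<^term>\<open>count_list lam i\<close>.
  The products over all \<open>i \<ge> 0\<close> are rendered by \<^const>\<open>Prod_any\<close>; almost all of their factors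
  are 1, as \<open>[0]! = 1\<close> and \<open>H\<^sub>0 = 1\<close>.
\<close>

definition is_partition :: "nat list \<Rightarrow> bool" where
  "is_partition lam \<longleftrightarrow> sorted_wrt (\<ge>) lam"

definition v_lam :: "nat list \<Rightarrow> complex \<Rightarrow> complex" where
  "v_lam lam t = Prod_any (\<lambda>i. qfact t (count_list lam i))"

text \<open>
  The value of \<open>P\<^sub>\<lambda>\<close> at the point \<open>zs\<close> with \<open>N = length lam\<close> coordinates, the first variable
  being \<open>zs ! 0\<close>. The symmetrised sum of fractions is a polynomial, and the expression below is the
  value of this polynomial whenever the entries of \<open>zs\<close> are pairwise distinct (with a repeated
  entry, the convention \<open>x / 0 = 0\<close> interferes). At the arguments
  \<open>x\<^sub>1, 1/x\<^sub>1, \<dots>, x\<^sub>k, 1/x\<^sub>k\<close>, possibly followed by 1 and/or -1, repetitions occur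
  only on a null set of the torus, and for \<open>k = 0\<close> they do not occur at all, so that they are
  irrelevant for the integrals in which this function is used.
\<close>

definition hl_poly :: "nat list \<Rightarrow> complex list \<Rightarrow> complex \<Rightarrow> complex" where
  "hl_poly lam zs t =
     1 / v_lam lam t *
     (\<Sum>w | w permutes {..<length lam}.
        (\<Prod>i<length lam. (zs ! w i) ^ (lam ! i)) *
        (\<Prod>i<length lam. \<Prod>j\<in>{i<..<length lam}.
            (zs ! w i - t * zs ! w j) / (zs ! w i - zs ! w j)))"

text \<open>The argument list \<open>x\<^sub>1, 1/x\<^sub>1, \<dots>, x\<^sub>k, 1/x\<^sub>k\<close>, with variables indexed from 0.\<close>

definition pm_args :: "nat \<Rightarrow> (nat \<Rightarrow> complex) \<Rightarrow> complex list" where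
  "pm_args k x = concat (map (\<lambda>i. [x i, inverse (x i)]) [0..<k])"


section \<open>The torus and the Koornwinder density\<close>

text \<open>
  Under \<open>x = exp (\<i> \<theta>)\<close> with \<open>0 \<le> \<theta> \<le> 2\<pi>\<close>, the form \<open>dx / (2 \<pi> \<i> x)\<close> is
  \<open>d\<theta> / (2\<pi>)\<close>. For \<open>k = 0\<close> the product measure is the point mass on the empty family, hence
  integration is evaluation.
\<close>

definition circle_measure :: "complex measure" where
  "circle_measure = distr (uniform_measure lborel {0..2 * pi}) borel cis"

definition torus_measure :: "nat \<Rightarrow> (nat \<Rightarrow> complex) measure" where
  "torus_measure k = PiM {..<k} (\<lambda>_. circle_measure)"

text \<open>\<open>1 - c u\<^sup>\<plusminus>\<^sup>1\<close>, understood as the product over both signs\<close>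

definition pm_fac :: "complex \<Rightarrow> complex \<Rightarrow> complex" where
  "pm_fac c u = (1 - c * u) * (1 - c * inverse u)"

text \<open>
  The four-fold product \<open>1 - c x\<^sub>i\<^sup>\<plusminus>\<^sup>1 x\<^sub>j\<^sup>\<plusminus>\<^sup>1\<close> is
  \<^term>\<open>pm_fac c (x i * x j) * pm_fac c (x i * inverse (x j))\<close>.
  If a parameter equals \<open>\<plusminus>1\<close>, its factor in the denominator divides \<open>1 - x\<^sub>i\<^sup>\<plusminus>\<^sup>2\<close>;
  the quotient agrees with the one in which the common factor has been cancelled except where some
  \<open>x\<^sub>i = \<plusminus>1\<close>, a null set of the torus.
\<close>

definition koornwinder_density ::
  "nat \<Rightarrow> (nat \<Rightarrow> complex) \<Rightarrow> complex \<Rightarrow> complex \<Rightarrow> complex \<Rightarrow> complex \<Rightarrow> complex \<Rightarrow> complex" where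
  "koornwinder_density k x a b c d t =
     1 / (2 ^ k * fact k) *
     (\<Prod>i<k. pm_fac 1 ((x i)\<^sup>2) /
        (pm_fac a (x i) * pm_fac b (x i) * pm_fac c (x i) * pm_fac d (x i))) *
     (\<Prod>i<k. \<Prod>j\<in>{i<..<k}.
        (pm_fac 1 (x i * x j) * pm_fac 1 (x i * inverse (x j))) /
        (pm_fac t (x i * x j) * pm_fac t (x i * inverse (x j))))"

definition koornwinder_Z ::
  "nat \<Rightarrow> complex \<Rightarrow> complex \<Rightarrow> complex \<Rightarrow> complex \<Rightarrow> complex \<Rightarrow> complex" where
  "koornwinder_Z k a b c d t = (LINT x|torus_measure k. koornwinder_density k x a b c d t)"

text \<open>
  \<open>extra\<close> is the list of variables of \<open>P\<^sub>\<lambda>\<close> that are specialised to \<open>\<plusminus>1\<close>.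
\<close>

definition hl_integral ::
  "nat \<Rightarrow> nat list \<Rightarrow> complex list \<Rightarrow> complex \<Rightarrow> complex \<Rightarrow> complex \<Rightarrow> complex \<Rightarrow>
   complex \<Rightarrow> complex \<Rightarrow> complex \<Rightarrow> complex" where
  "hl_integral k lam extra a b c d \<alpha> \<beta> t =
     (LINT x|torus_measure k.
        hl_poly lam (pm_args k x @ extra) t * koornwinder_density k x a b c d t *
        (\<Prod>i<k. pm_fac \<alpha> (x i) * pm_fac \<beta> (x i)))"


section \<open>The right-hand sides\<close>

definition A_raw :: "nat list \<Rightarrow> complex \<Rightarrow> complex \<Rightarrow> complex \<Rightarrow> complex" where
  "A_raw lam \<alpha> \<beta> t =
     (Prod_any (\<lambda>i. rs_poly (count_list lam (2 * i)) (\<alpha> * \<beta>) t) *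
      Prod_any (\<lambda>i. rs_poly (count_list lam (2 * i + 1)) (\<beta> / \<alpha>) t)) *
     (- \<alpha>) ^ length (filter odd lam)"

definition B_raw :: "nat list \<Rightarrow> complex \<Rightarrow> complex \<Rightarrow> complex \<Rightarrow> complex" where
  "B_raw lam \<alpha> \<beta> t =
     (Prod_any (\<lambda>i. rs_poly (count_list lam (2 * i + 1)) (\<alpha> * \<beta>) t) *
      Prod_any (\<lambda>i. rs_poly (count_list lam (2 * i)) (\<beta> / \<alpha>) t)) *
     (- \<alpha>) ^ length (filter even lam)"

text \<open>
  \<open>A\<^sub>\<lambda>\<close> and \<open>B\<^sub>\<lambda>\<close> are polynomials in \<open>\<alpha>\<close> and \<open>\<beta>\<close>; their values at \<open>\<alpha> = 0\<close> are the limits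
  of the expressions above, which are undefined there. The lemmas \<open>A_lam_polynomial\<close> and
  \<open>B_lam_polynomial\<close> below exhibit the polynomials.
\<close>

definition A_lam :: "nat list \<Rightarrow> complex \<Rightarrow> complex \<Rightarrow> complex \<Rightarrow> complex" where
  "A_lam lam \<alpha> \<beta> t =
     (if \<alpha> = 0 then Lim (at 0) (\<lambda>a. A_raw lam a \<beta> t) else A_raw lam \<alpha> \<beta> t)"

definition B_lam :: "nat list \<Rightarrow> complex \<Rightarrow> complex \<Rightarrow> complex \<Rightarrow> complex" where
  "B_lam lam \<alpha> \<beta> t =
     (if \<alpha> = 0 then Lim (at 0) (\<lambda>a. B_raw lam a \<beta> t) else B_raw lam \<alpha> \<beta> t)"

definition rs_hom :: "nat \<Rightarrow> complex \<Rightarrow> complex \<Rightarrow> complex \<Rightarrow> complex" where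
  "rs_hom m a b t =
     (\<Sum>i\<le>m. (- a) ^ (m - i) * (- b) ^ i * (qfact t m / (qfact t (m - i) * qfact t i)))"

lemma rs_hom_eq:
  assumes "a \<noteq> 0"
  shows "rs_poly m (b / a) t * (- a) ^ m = rs_hom m a b t"
  unfolding rs_poly_def rs_hom_def sum_distrib_right
proof (rule sum.cong[OF refl])
  fix i assume "i \<in> {..m}"
  then have m: "(- a) ^ m = (- a) ^ (m - i) * (- a) ^ i"
    by (simp flip: power_add)
  have b: "(b / a) ^ i * (- a) ^ i = (- b) ^ i"
    using assms by (simp flip: power_mult_distrib)
  let ?c = "qfact t m / (qfact t (m - i) * qfact t i)"
  have "(b / a) ^ i * ?c * (- a) ^ m = (- a) ^ (m - i) * ((b / a) ^ i * (- a) ^ i) * ?c"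
    unfolding m by (simp only: ac_simps)
  then show "(b / a) ^ i * ?c * (- a) ^ m = (- a) ^ (m - i) * (- b) ^ i * ?c"
    unfolding b .
qed

lemma rs_hom_0 [simp]: "rs_hom 0 a b t = 1"
  and rs_poly_0 [simp]: "rs_poly 0 z t = 1"
  by (simp_all add: rs_hom_def rs_poly_def qfact_def)

lemma Prod_any_count:
  fixes f :: "nat \<Rightarrow> complex" and p :: "nat \<Rightarrow> nat"
  assumes "f 0 = 1" "\<And>i. i \<le> p i"
  shows "Prod_any (\<lambda>i. f (count_list lam (p i))) = (\<Prod>i\<le>sum_list lam. f (count_list lam (p i)))"
proof (rule Prod_any.expand_superset)
  show "{i. f (count_list lam (p i)) \<noteq> 1} \<subseteq> {..sum_list lam}"
  proof clarsimp
    fix i assume "f (count_list lam (p i)) \<noteq> 1"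
    then have "count_list lam (p i) \<noteq> 0" using assms(1) by metis
    then have "p i \<in> set lam" by (meson count_list_0_iff)
    then have "p i \<le> sum_list lam" by (rule member_le_sum_list) simp
    then show "i \<le> sum_list lam" using assms(2)[of i] by linarith
  qed
qed simp

lemma sum_count_filter:
  assumes "inj p" "range p = Collect P" "\<And>i::nat. i \<le> p i"
    "sum_list lam \<le> M"
  shows "(\<Sum>i\<le>M. count_list lam (p i)) = length (filter P lam)"
  using assms(4)
proof (induction lam)
  case (Cons a lam)
  have "(\<Sum>i\<le>M. if a = p i then 1 else 0) = (if P a then 1 else (0::nat))"
  proof (cases "P a")
    case True
    then obtain k where k: "a = p k" using assms(2) by blast
    with Cons.prems assms(3)[of k] have "k \<le> M" by simp
    then show ?thesis using True k assms(1) by (simp add: inj_eq)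
  next
    case False
    then have "a \<noteq> p i" for i using assms(2) by blast
    then show ?thesis using False by simp
  qed
  moreover have "(\<Sum>i\<le>M. count_list (a # lam) (p i)) =
      (\<Sum>i\<le>M. count_list lam (p i)) + (\<Sum>i\<le>M. if a = p i then 1 else 0)"
    by (subst sum.distrib[symmetric], rule sum.cong) auto
  ultimately show ?case using Cons by simp
qed simp

lemma hom_product:
  assumes "inj p" "range p = Collect P" "\<And>i::nat. i \<le> p i" "a \<noteq> 0"
  shows "Prod_any (\<lambda>i. rs_poly (count_list lam (p i)) (b / a) t) * (- a) ^ length (filter P lam) =
    Prod_any (\<lambda>i. rs_hom (count_list lam (p i)) a b t)"
proof -
  let ?I = "{..sum_list lam}"
  have "length (filter P lam) = (\<Sum>i\<in>?I. count_list lam (p i))"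
    by (rule sum_count_filter[OF assms(1-3) order_refl, symmetric])
  then have "(\<Prod>i\<in>?I. rs_poly (count_list lam (p i)) (b / a) t) * (- a) ^ length (filter P lam) =
      (\<Prod>i\<in>?I. rs_poly (count_list lam (p i)) (b / a) t * (- a) ^ count_list lam (p i))"
    by (simp only: power_sum prod.distrib)
  also have "\<dots> = (\<Prod>i\<in>?I. rs_hom (count_list lam (p i)) a b t)"
    by (simp only: rs_hom_eq[OF assms(4)])
  finally show ?thesis
    unfolding Prod_any_count[of "\<lambda>m. rs_poly m (b / a) t", OF rs_poly_0 assms(3)]
      Prod_any_count[of "\<lambda>m. rs_hom m a b t", OF rs_hom_0 assms(3)] .
qed

lemma tendsto_Prod_any_rs_poly:
  assumes "\<And>i::nat. i \<le> p i"
  shows "((\<lambda>a. Prod_any (\<lambda>i. rs_poly (count_list lam (p i)) (a * b) t)) \<longlongrightarrow>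
     Prod_any (\<lambda>i. rs_poly (count_list lam (p i)) (a0 * b) t)) (at a0)"
  unfolding Prod_any_count[of "\<lambda>m. rs_poly m z t" for z, OF rs_poly_0 assms]
  unfolding rs_poly_def by (intro tendsto_intros)

lemma tendsto_Prod_any_rs_hom:
  assumes "\<And>i::nat. i \<le> p i"
  shows "((\<lambda>a. Prod_any (\<lambda>i. rs_hom (count_list lam (p i)) a b t)) \<longlongrightarrow>
     Prod_any (\<lambda>i. rs_hom (count_list lam (p i)) a0 b t)) (at a0)"
  unfolding Prod_any_count[of "\<lambda>m. rs_hom m a b t" for a, OF rs_hom_0 assms]
  unfolding rs_hom_def by (intro tendsto_intros)

lemma range_even: "range (\<lambda>i::nat. 2 * i) = Collect even"
  by (auto simp: dvd_def)

lemma range_odd: "range (\<lambda>i::nat. 2 * i + 1) = Collect odd"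
proof -
  have "x \<in> range (\<lambda>i::nat. 2 * i + 1) \<longleftrightarrow> odd x" for x
    by (auto simp: image_iff elim!: oddE)
  then show ?thesis by auto
qed

lemma A_raw_polynomial:
  assumes "\<alpha> \<noteq> 0"
  shows "A_raw lam \<alpha> \<beta> t =
    Prod_any (\<lambda>i. rs_poly (count_list lam (2 * i)) (\<alpha> * \<beta>) t) *
    Prod_any (\<lambda>i. rs_hom (count_list lam (2 * i + 1)) \<alpha> \<beta> t)"
  unfolding A_raw_def mult.assoc
  by (subst hom_product[OF _ range_odd]) (use assms in \<open>auto simp: inj_def\<close>)

lemma B_raw_polynomial:
  assumes "\<alpha> \<noteq> 0"
  shows "B_raw lam \<alpha> \<beta> t =
    Prod_any (\<lambda>i. rs_poly (count_list lam (2 * i + 1)) (\<alpha> * \<beta>) t) *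
    Prod_any (\<lambda>i. rs_hom (count_list lam (2 * i)) \<alpha> \<beta> t)"
  unfolding B_raw_def mult.assoc
  by (subst hom_product[OF _ range_even]) (use assms in \<open>auto simp: inj_def\<close>)

lemma A_lam_polynomial:
  "A_lam lam \<alpha> \<beta> t =
    Prod_any (\<lambda>i. rs_poly (count_list lam (2 * i)) (\<alpha> * \<beta>) t) *
    Prod_any (\<lambda>i. rs_hom (count_list lam (2 * i + 1)) \<alpha> \<beta> t)" (is "_ = ?p \<alpha>")
proof (cases "\<alpha> = 0")
  case True
  have "(?p \<longlongrightarrow> ?p 0) (at 0)"
    by (intro tendsto_mult tendsto_Prod_any_rs_poly tendsto_Prod_any_rs_hom) auto
  moreover have "\<forall>\<^sub>F a in at 0. ?p a = A_raw lam a \<beta> t"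
    by (auto simp: eventually_at_filter A_raw_polynomial)
  ultimately have "((\<lambda>a. A_raw lam a \<beta> t) \<longlongrightarrow> ?p 0) (at 0)"
    by (rule Lim_transform_eventually)
  then have "Lim (at 0) (\<lambda>a. A_raw lam a \<beta> t) = ?p 0"
    by (intro tendsto_Lim) auto
  then show ?thesis using True by (simp add: A_lam_def)
qed (simp add: A_lam_def A_raw_polynomial)

lemma B_lam_polynomial:
  "B_lam lam \<alpha> \<beta> t =
    Prod_any (\<lambda>i. rs_poly (count_list lam (2 * i + 1)) (\<alpha> * \<beta>) t) *
    Prod_any (\<lambda>i. rs_hom (count_list lam (2 * i)) \<alpha> \<beta> t)" (is "_ = ?p \<alpha>")
proof (cases "\<alpha> = 0")
  case True
  have "(?p \<longlongrightarrow> ?p 0) (at 0)"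
    by (intro tendsto_mult tendsto_Prod_any_rs_poly tendsto_Prod_any_rs_hom) auto
  moreover have "\<forall>\<^sub>F a in at 0. ?p a = B_raw lam a \<beta> t"
    by (auto simp: eventually_at_filter B_raw_polynomial)
  ultimately have "((\<lambda>a. B_raw lam a \<beta> t) \<longlongrightarrow> ?p 0) (at 0)"
    by (rule Lim_transform_eventually)
  then have "Lim (at 0) (\<lambda>a. B_raw lam a \<beta> t) = ?p 0"
    by (intro tendsto_Lim) auto
  then show ?thesis using True by (simp add: B_lam_def)
qed (simp add: B_lam_def B_raw_polynomial)

end

theory Submission
imports Defs "HOL-Combinatorics.Multiset_Permutations" "HOL-Complex_Analysis.Complex_Analysis"
begin

text \<open>
  Write \<open>R\<^sub>\<lambda> = v\<^sub>\<lambda> P\<^sub>\<lambda>\<close> for the symmetrised sum over all assignments of the exponents to the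
  arguments. The proof treats the four integrals together: the arguments are \<open>x\<^sub>i\<^sup>\<plusminus>\<^sup>1\<close> and the elements
  of a set \<open>E \<subseteq> {1, - 1}\<close>, and the parameters of the density are \<open>t e\<close> for \<open>e \<in> E\<close> and \<open>e\<close> for
  \<open>e = \<plusminus>1\<close> outside \<open>E\<close>.

  Without the factors in \<open>\<alpha>\<close> and \<open>\<beta>\<close>, split \<open>R\<^sub>\<lambda>\<close> according to the argument that carries the largest
  exponent. If this is an element of \<open>E\<close>, its factors cancel against the density and the integral with
  this element removed from \<open>E\<close> is left. If it is \<open>x\<^sub>i\<close> or \<open>1/x\<^sub>i\<close>, half of the density cancels, and
  the integrand in \<open>x\<^sub>i\<close> is holomorphic in the unit disc: since \<open>R\<close> is a polynomial in each of its
  arguments, of degree at most the largest exponent, the negative powers of \<open>x\<^sub>i\<close> are compensated.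
  The only poles are at \<open>x\<^sub>i = \<plusminus>1\<close>, on the contour, and up to a constant the residue at \<open>e\<close> is the integral with one
  variable less and \<open>e\<close> added to \<open>E\<close> (\<open>integral_var_term\<close>, \<open>hl_int_recursion\<close>). The recursion shows that
  the integral vanishes unless all parts have the same parity, and gives its value in that case
  (\<open>hl_int_value\<close>). The partition 0 gives the normalisation, which is therefore nonzero.

  To have the recursion as an identity between convergent integrals, the terms of \<open>x\<^sub>i\<close> and \<open>1/x\<^sub>i\<close> are
  combined before integrating; Lagrange interpolation supplies the uniform bounds that Fubini's
  theorem requires (\<open>hl_sum_bounded\<close>, \<open>var_term_bounded\<close>).

  The factors \<open>1 - \<alpha> z\<close> over all arguments \<open>z\<close> expand into sums over the ways of raising some parts by 1.
  The rule \<open>R(\<dots>, a, a + 1, \<dots>) = t R(\<dots>, a + 1, a, \<dots>)\<close> (\<open>hl_sum_swap\<close>) sorts the raised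
  sequences and turns the sum over a block of \<open>m\<close> equal parts into a sum with Gaussian binomial
  coefficients (\<open>raise_block\<close>). Starting from the parity indicators, the factors with \<open>\<alpha>\<close> give
  powers of \<open>- \<alpha>\<close>, and then those with \<open>\<beta>\<close> give Rogers--Szego polynomials (\<open>hl_int_arg_prods\<close>).
\<close>

section \<open>Symmetrised Hall--Littlewood sums\<close>

text \<open>
  The symmetrised sum \<open>v\<^sub>\<lambda> P\<^sub>\<lambda>\<close>, organised by the variable that receives the first exponent.
  The variables are a family \<open>z\<close> over a finite index set \<open>K\<close>: a set carries no order, so symmetry in
  the variables is built in, and removing one variable is removing one index.
\<close>

fun hl_sum :: "complex \<Rightarrow> nat list \<Rightarrow> ('k \<Rightarrow> complex) \<Rightarrow> 'k set \<Rightarrow> complex" where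
  "hl_sum t [] z K = 1"
| "hl_sum t (m # ms) z K =
    (\<Sum>a\<in>K. z a ^ m * (\<Prod>b\<in>K - {a}. (z a - t * z b) / (z a - z b)) * hl_sum t ms z (K - {a}))"

lemma hl_sum_reindex:
  assumes "inj_on h K" "\<And>k. k \<in> K \<Longrightarrow> z' (h k) = z k"
  shows "hl_sum t ms z' (h ` K) = hl_sum t ms z K"
  using assms
proof (induction ms arbitrary: K)
  case (Cons m ms)
  have *: "h ` K - {h a} = h ` (K - {a})" if "a \<in> K" for a
    using that Cons.prems(1) by (auto simp: inj_on_def)
  have inj: "inj_on h (K - {a})" for a
    using Cons.prems(1) by (rule inj_on_subset) auto
  have "hl_sum t (m # ms) z' (h ` K) =
    (\<Sum>a\<in>K. z' (h a) ^ m * (\<Prod>b\<in>h ` K - {h a}. (z' (h a) - t * z' b) / (z' (h a) - z' b)) *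
       hl_sum t ms z' (h ` K - {h a}))"
    using Cons.prems(1) by (simp add: sum.reindex)
  also have "\<dots> = hl_sum t (m # ms) z K"
    unfolding hl_sum.simps
  proof (rule sum.cong[OF refl])
    fix a assume a: "a \<in> K"
    show "z' (h a) ^ m * (\<Prod>b\<in>h ` K - {h a}. (z' (h a) - t * z' b) / (z' (h a) - z' b)) *
       hl_sum t ms z' (h ` K - {h a}) =
      z a ^ m * (\<Prod>b\<in>K - {a}. (z a - t * z b) / (z a - z b)) * hl_sum t ms z (K - {a})"
      unfolding *[OF a]
      using a Cons.prems(2) Cons.IH[OF inj, of a] by (simp add: prod.reindex[OF inj])
  qed
  finally show ?case .
qed simp

lemma hl_sum_cong:
  assumes "\<And>k. k \<in> K \<Longrightarrow> z' k = z k"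
  shows "hl_sum t ms z' K = hl_sum t ms z K"
  using hl_sum_reindex[of "\<lambda>k. k" K z' z t ms] assms by simp

fun hl_weight :: "complex \<Rightarrow> nat list \<Rightarrow> ('k \<Rightarrow> complex) \<Rightarrow> 'k list \<Rightarrow> complex" where
  "hl_weight t (m # ms) z (k # ks) =
     z k ^ m * (\<Prod>l\<leftarrow>ks. (z k - t * z l) / (z k - z l)) * hl_weight t ms z ks"
| "hl_weight t ms z ks = 1"

lemma hl_sum_eq_sum_weight:
  assumes "finite K" "card K = length ms"
  shows "hl_sum t ms z K = (\<Sum>ks\<in>permutations_of_set K. hl_weight t ms z ks)"
  using assms
proof (induction ms arbitrary: K)
  case (Cons m ms)
  then have ne: "K \<noteq> {}" by auto
  have inj: "inj_on (Cons a) S" for a :: 'a and S by simp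
  have "(\<Sum>ks\<in>permutations_of_set K. hl_weight t (m # ms) z ks) =
     (\<Sum>a\<in>K. \<Sum>ks\<in>Cons a ` permutations_of_set (K - {a}). hl_weight t (m # ms) z ks)"
    unfolding permutations_of_set_nonempty[OF ne]
    by (rule sum.UNION_disjoint) (use Cons.prems in \<open>auto\<close>)
  also have "\<dots> = (\<Sum>a\<in>K. \<Sum>ks\<in>permutations_of_set (K - {a}).
       z a ^ m * (\<Prod>b\<in>K - {a}. (z a - t * z b) / (z a - z b)) * hl_weight t ms z ks)"
  proof (rule sum.cong[OF refl])
    fix a assume "a \<in> K"
    show "(\<Sum>ks\<in>Cons a ` permutations_of_set (K - {a}). hl_weight t (m # ms) z ks) =
      (\<Sum>ks\<in>permutations_of_set (K - {a}).
       z a ^ m * (\<Prod>b\<in>K - {a}. (z a - t * z b) / (z a - z b)) * hl_weight t ms z ks)"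
      unfolding sum.reindex[OF inj] o_def
    proof (rule sum.cong[OF refl])
      fix ks assume "ks \<in> permutations_of_set (K - {a})"
      then have "distinct ks" "set ks = K - {a}"
        by (auto simp: permutations_of_set_def)
      then have "(\<Prod>b\<in>K - {a}. (z a - t * z b) / (z a - z b)) =
          (\<Prod>l\<leftarrow>ks. (z a - t * z l) / (z a - z l))"
        by (metis prod.distinct_set_conv_list)
      then show "hl_weight t (m # ms) z (a # ks) =
        z a ^ m * (\<Prod>b\<in>K - {a}. (z a - t * z b) / (z a - z b)) * hl_weight t ms z ks"
        by simp
    qed
  qed
  also have "\<dots> = hl_sum t (m # ms) z K"
    using Cons by (simp add: sum_distrib_left)
  finally show ?case ..
qed simp

lemma hl_weight_eq_prod:
  assumes "length ks = length ms"
  shows "hl_weight t ms z ks =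
    (\<Prod>i<length ms. z (ks ! i) ^ (ms ! i)) *
    (\<Prod>i<length ms. \<Prod>j\<in>{i<..<length ms}. (z (ks ! i) - t * z (ks ! j)) / (z (ks ! i) - z (ks ! j)))"
  using assms
proof (induction ms arbitrary: ks)
  case (Cons m ms)
  then obtain k ks' where ks: "ks = k # ks'" "length ks' = length ms"
    by (cases ks) auto
  have S: "{Suc i<..<Suc n} = Suc ` {i<..<n}" for i n
    by (intro set_eqI, rename_tac x, case_tac x) auto
  have S0: "{0<..<Suc n} = Suc ` {..<n}" for n
    by (intro set_eqI, rename_tac x, case_tac x) auto
  have *: "(\<Prod>l\<leftarrow>ks'. (z k - t * z l) / (z k - z l)) =
     (\<Prod>j<length ms. (z k - t * z (ks' ! j)) / (z k - z (ks' ! j)))"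
    using ks(2) by (simp add: prod.list_conv_set_nth atLeast0LessThan)
  show ?case
    unfolding ks using Cons.IH[OF ks(2)]
    by (simp add: prod.lessThan_Suc_shift S S0 prod.reindex * del: prod.lessThan_Suc)
qed simp

lemma hl_poly_eq_hl_sum:
  assumes "length zs = length lam"
  shows "hl_poly lam zs t = 1 / v_lam lam t * hl_sum t lam ((!) zs) {..<length lam}"
proof -
  let ?N = "length lam"
  let ?f = "\<lambda>w. map w [0..<?N]"
  have inj: "inj_on ?f {w. w permutes {..<?N}}"
  proof (rule inj_onI)
    fix w w' assume w: "w \<in> {w. w permutes {..<?N}}" "w' \<in> {w. w permutes {..<?N}}" "?f w = ?f w'"
    show "w = w'"
    proof
      fix i show "w i = w' i"
      proof (cases "i < ?N")
        case True
        then show ?thesis using w(3) by (auto simp: map_eq_conv)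
      next
        case False
        then show ?thesis using w(1,2) by (simp add: permutes_def)
      qed
    qed
  qed
  have sub: "?f ` {w. w permutes {..<?N}} \<subseteq> permutations_of_set {..<?N}"
  proof clarsimp
    fix w assume w: "w permutes {..<?N}"
    have "w ` {0..<?N} = {..<?N}"
      using permutes_image[OF w] by (simp add: atLeast0LessThan)
    moreover have "inj_on w {0..<?N}"
      using permutes_inj[OF w] inj_on_subset by blast
    ultimately show "?f w \<in> permutations_of_set {..<?N}"
      by (auto simp: permutations_of_set_def distinct_map)
  qed
  have img: "?f ` {w. w permutes {..<?N}} = permutations_of_set {..<?N}"
  proof (rule card_subset_eq[OF _ sub])
    show "card (?f ` {w. w permutes {..<?N}}) = card (permutations_of_set {..<?N})"
      by (simp add: card_image[OF inj] card_permutations)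
  qed simp
  have "hl_sum t lam ((!) zs) {..<?N} =
     (\<Sum>w | w permutes {..<?N}. hl_weight t lam ((!) zs) (?f w))"
    by (simp add: hl_sum_eq_sum_weight img[symmetric] sum.reindex[OF inj] o_def)
  also have "\<dots> = (\<Sum>w | w permutes {..<?N}.
        (\<Prod>i<?N. (zs ! w i) ^ (lam ! i)) *
        (\<Prod>i<?N. \<Prod>j\<in>{i<..<?N}. (zs ! w i - t * zs ! w j) / (zs ! w i - zs ! w j)))"
    by (rule sum.cong[OF refl]) (simp add: hl_weight_eq_prod)
  finally show ?thesis by (simp add: hl_poly_def)
qed

lemma sum_antisymmetric:
  fixes h :: "'k \<Rightarrow> 'k \<Rightarrow> complex"
  assumes "finite K" "\<And>k l. k \<in> K \<Longrightarrow> l \<in> K \<Longrightarrow> k \<noteq> l \<Longrightarrow> h k l = - h l k"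
  shows "(\<Sum>k\<in>K. \<Sum>l\<in>K - {k}. h k l) = 0"
proof -
  let ?h = "\<lambda>k l. if k = l then 0 else h k l"
  have *: "(\<Sum>l\<in>K - {k}. h k l) = (\<Sum>l\<in>K. ?h k l)" if "k \<in> K" for k
    using assms(1) that by (intro sum.mono_neutral_cong_left) auto
  have anti: "?h k l = - ?h l k" if "k \<in> K" "l \<in> K" for k l
    using assms(2)[OF that] by (cases "k = l") simp_all
  have "(\<Sum>k\<in>K. \<Sum>l\<in>K. ?h k l) = (\<Sum>l\<in>K. \<Sum>k\<in>K. ?h k l)"
    by (rule sum.swap)
  also have "\<dots> = (\<Sum>l\<in>K. \<Sum>k\<in>K. - ?h l k)"
    by (intro sum.cong refl) (rule anti)
  also have "\<dots> = - (\<Sum>k\<in>K. \<Sum>l\<in>K. ?h k l)"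
    by (simp add: sum_negf)
  finally have "(\<Sum>k\<in>K. \<Sum>l\<in>K. ?h k l) = 0" by simp
  then show ?thesis by (simp add: *)
qed

lemma swap_sign: "(y - t * x) * ((x - t * y) / (x - y)) = - ((x - t * y) * ((y - t * x) / (y - x)))"
  for x y t :: complex
  using divide_minus_right[of "(y - t * x) * (x - t * y)" "x - y"] by (simp add: mult.commute)

text \<open>
  The straightening rule for adjacent exponents. Symmetrising over the two variables \<open>x, y\<close> that
  carry the two exponents, the difference of the two sides has the factor
  \<open>(y - t x) (x - t y) / (x - y)\<close>, which is antisymmetric.
\<close>

lemma hl_sum_swap:
  assumes "finite K" "inj_on z K"
  shows "hl_sum t (p @ [a, Suc a] @ q) z K = t * hl_sum t (p @ [Suc a, a] @ q) z K"
  using assms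
proof (induction p arbitrary: K)
  case (Cons m p)
  have "hl_sum t (p @ [a, Suc a] @ q) z (K - {k}) = t * hl_sum t (p @ [Suc a, a] @ q) z (K - {k})" for k
    by (rule Cons.IH) (use Cons.prems in \<open>auto simp: inj_on_def\<close>)
  then show ?case
    unfolding append.simps hl_sum.simps sum_distrib_left
    by (intro sum.cong refl) (simp only: mult.left_commute)
next
  case Nil
  let ?F = "\<lambda>k l. (z k - t * z l) / (z k - z l)"
  define S where "S k l = (z k * z l) ^ a * (\<Prod>b\<in>K - {k, l}. ?F k b) * (\<Prod>b\<in>K - {k, l}. ?F l b) *
    hl_sum t q z (K - {k, l})" for k l
  have S: "S k l = S l k" for k l
    unfolding S_def insert_commute[of l k] mult.commute[of "z l" "z k"]
    by (simp only: mult.assoc mult.left_commute)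
  have expand: "hl_sum t ([c, d] @ q) z K =
     (\<Sum>k\<in>K. \<Sum>l\<in>K - {k}. z k ^ c * z l ^ d * ?F k l * ((\<Prod>b\<in>K - {k, l}. ?F k b) *
       (\<Prod>b\<in>K - {k, l}. ?F l b) * hl_sum t q z (K - {k, l})))" for c d
    unfolding append.simps hl_sum.simps sum_distrib_left
  proof (intro sum.cong refl)
    fix k l assume kl: "k \<in> K" "l \<in> K - {k}"
    have e: "K - {k} - {l} = K - {k, l}" by auto
    have "(\<Prod>b\<in>K - {k}. ?F k b) = ?F k l * (\<Prod>b\<in>K - {k, l}. ?F k b)"
      using kl Nil(1) by (subst prod.remove[of _ l]) (auto simp: e)
    then show "z k ^ c * (\<Prod>b\<in>K - {k}. ?F k b) * (z l ^ d * (\<Prod>b\<in>K - {k} - {l}. ?F l b) *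
      hl_sum t q z (K - {k} - {l})) =
      z k ^ c * z l ^ d * ?F k l * ((\<Prod>b\<in>K - {k, l}. ?F k b) *
       (\<Prod>b\<in>K - {k, l}. ?F l b) * hl_sum t q z (K - {k, l}))"
      unfolding e by (simp only: ac_simps)
  qed
  have factor: "x ^ a * y ^ Suc a * f * (P1 * P2 * h) - t * (x ^ Suc a * y ^ a * f * (P1 * P2 * h)) =
    (y - t * x) * f * ((x * y) ^ a * P1 * P2 * h)" for x y f P1 P2 h
    by (simp add: power_mult_distrib algebra_simps)
  have "hl_sum t ([a, Suc a] @ q) z K - t * hl_sum t ([Suc a, a] @ q) z K =
    (\<Sum>k\<in>K. \<Sum>l\<in>K - {k}. (z l - t * z k) * ?F k l * S k l)"
    unfolding expand sum_distrib_left sum_subtractf[symmetric]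
    unfolding S_def by (intro sum.cong refl) (rule factor)
  also have "\<dots> = 0"
  proof (rule sum_antisymmetric[where h = "\<lambda>k l. (z l - t * z k) * ?F k l * S k l", OF Nil(1)])
    fix k l assume "k \<in> K" "l \<in> K" "k \<noteq> l"
    show "(z l - t * z k) * ?F k l * S k l = - ((z k - t * z l) * ?F l k * S l k)"
      unfolding S[of k l]
      using arg_cong[where f = "\<lambda>x. x * S l k", OF swap_sign[of "z l" t "z k"]]
      by (simp only: mult_minus_left)
  qed
  finally show ?case by (simp only: append_Nil right_minus_eq)
qed

section \<open>Polynomiality in each variable and boundedness\<close>

lemma prod_linear_factors_dvd:
  fixes z :: "'k \<Rightarrow> complex" and q :: "complex poly"
  assumes "finite A" "inj_on z A" "\<And>a. a \<in> A \<Longrightarrow> poly q (z a) = 0"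
  shows "(\<Prod>a\<in>A. [:- z a, 1:]) dvd q"
  using assms
proof (induction A rule: finite_induct)
  case (insert a A)
  then obtain r where r: "q = (\<Prod>a\<in>A. [:- z a, 1:]) * r"
    by (auto simp: inj_on_insert elim!: dvdE)
  have "poly (\<Prod>a\<in>A. [:- z a, 1:]) (z a) \<noteq> 0"
    using insert by (auto simp: poly_prod inj_on_def)
  moreover have "poly q (z a) = 0" using insert by simp
  ultimately have "poly r (z a) = 0" by (simp add: r)
  then have "[:- z a, 1:] dvd r" by (simp add: poly_eq_0_iff_dvd)
  then show ?case
    unfolding r prod.insert[OF insert.hyps] by (subst mult.commute) (rule mult_dvd_mono[OF dvd_refl])
qed simp

lemma prod_linear_factors:
  fixes z :: "'k \<Rightarrow> complex"
  shows "degree (\<Prod>a\<in>A. [:- z a, 1:]) = card A" "(\<Prod>a\<in>A. [:- z a, 1:]) \<noteq> 0"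
  by (cases "finite A"; simp add: degree_prod_eq_sum_degree)+

text \<open>
  As a function of one variable \<open>u\<close> the symmetrised sum is rational with at most simple poles at the
  values of the other variables. At \<open>u = z a\<close> the terms in which \<open>u\<close> comes first and those in which \<open>z a\<close> does have
  opposite residues, because what remains is symmetric. Hence there are no poles, and the growth at
  infinity bounds the degree by the largest exponent.
\<close>

lemma hl_sum_poly:
  fixes z :: "'k \<Rightarrow> complex"
  assumes "finite K" "inj_on z K" "k0 \<notin> K" "\<And>m. m \<in> set ms \<Longrightarrow> m \<le> M"
  shows "\<exists>p. degree p \<le> M \<and> (\<forall>u. u \<notin> z ` K \<longrightarrow> hl_sum t ms (z(k0 := u)) (insert k0 K) = poly p u)"
  using assms
proof (induction ms arbitrary: K)
  case Nil
  show ?case by (rule exI[of _ 1]) simp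
next
  case (Cons m ms)
  let ?F = "\<lambda>x y. (x - t * y) / (x - y)"
  have "\<exists>p. degree p \<le> M \<and> (\<forall>u. u \<notin> z ` (K - {a}) \<longrightarrow>
      hl_sum t ms (z(k0 := u)) (insert k0 (K - {a})) = poly p u)" for a
    by (rule Cons.IH) (use Cons.prems in \<open>auto simp: inj_on_def\<close>)
  then obtain p where p: "\<And>a. degree (p a) \<le> M"
    "\<And>a u. u \<notin> z ` (K - {a}) \<Longrightarrow> hl_sum t ms (z(k0 := u)) (insert k0 (K - {a})) = poly (p a) u"
    by metis
  define R where "R = hl_sum t ms z K"
  define c where "c a = z a ^ m * (\<Prod>b\<in>K - {a}. ?F (z a) (z b))" for a
  \<comment> \<open>\<open>V K\<close> clears the denominators; \<open>Q\<close> is the resulting polynomial, to be shown divisible by \<open>V K\<close>\<close>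
  define V where "V A = (\<Prod>b\<in>A. [:- z b, 1:])" for A
  define Q where "Q = smult R (monom 1 m * (\<Prod>b\<in>K. [:- t * z b, 1:])) -
    (\<Sum>a\<in>K. smult (c a) ([:z a, - t:] * p a * V (K - {a})))"
  have degV: "degree (V A) = card A" for A
    unfolding V_def by (rule prod_linear_factors)
  have V0: "V A \<noteq> 0" for A
    unfolding V_def by (rule prod_linear_factors)
  have polyV: "poly (V A) u = (\<Prod>b\<in>A. u - z b)" for A u
    by (simp add: V_def poly_prod)
  have lin: "poly [:z a, - t:] x = z a - t * x" "poly [:- t * z a, 1:] x = x - t * z a" for a x
    by simp_all
  have polyQ: "poly Q x = R * (x ^ m * (\<Prod>b\<in>K. x - t * z b)) -
    (\<Sum>a\<in>K. c a * ((z a - t * x) * poly (p a) x * poly (V (K - {a})) x))" for x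
    by (simp only: Q_def poly_diff poly_smult poly_mult poly_sum poly_prod poly_monom lin mult_1)
  have expand: "hl_sum t (m # ms) (z(k0 := u)) (insert k0 K) * poly (V K) u = poly Q u"
    if u: "u \<notin> z ` K" for u
  proof -
    let ?y = "z(k0 := u)"
    have nz: "u - z b \<noteq> 0" if "b \<in> K" for b using u that by auto
    have 1: "(\<Prod>b\<in>K. ?F u (z b)) * poly (V K) u = (\<Prod>b\<in>K. u - t * z b)"
      using nz by (simp add: polyV prod.distrib[symmetric])
    have 2: "?F (z a) u * poly (V K) u = - ((z a - t * u) * poly (V (K - {a})) u)" if a: "a \<in> K" for a
    proof -
      have "poly (V K) u = (u - z a) * poly (V (K - {a})) u"
        unfolding polyV using Cons.prems(1) a by (rule prod.remove)
      moreover have "?F (z a) u * (u - z a) = - (z a - t * u)"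
        using nz[OF a] by (simp add: divide_simps) (simp add: algebra_simps)
      ultimately show ?thesis
        by (metis (no_types, lifting) mult.assoc mult_minus_left)
    qed
    have 3: "?y b = z b" if "b \<in> K" for b
      using that Cons.prems(3) by auto
    have 4: "hl_sum t ms ?y K = R"
      unfolding R_def by (rule hl_sum_cong) (use 3 in auto)
    have 5: "(\<Prod>b\<in>insert k0 K - {k0}. ?F (?y k0) (?y b)) = (\<Prod>b\<in>K. ?F u (z b))"
      using Cons.prems(3) by (intro prod.cong) auto
    have 6: "insert k0 K - {a} = insert k0 (K - {a})" if "a \<in> K" for a
      using that Cons.prems(3) by auto
    have 7: "(\<Prod>b\<in>insert k0 K - {a}. ?F (?y a) (?y b)) =
       ?F (z a) u * (\<Prod>b\<in>K - {a}. ?F (z a) (z b))" if a: "a \<in> K" for a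
    proof -
      have "(\<Prod>b\<in>K - {a}. ?F (?y a) (?y b)) = (\<Prod>b\<in>K - {a}. ?F (z a) (z b))"
        using 3 a by (intro prod.cong) auto
      then show ?thesis
        unfolding 6[OF a] using Cons.prems(1,3) 3[OF a] by (subst prod.insert) auto
    qed
    have "hl_sum t (m # ms) ?y (insert k0 K) =
       u ^ m * (\<Prod>b\<in>K. ?F u (z b)) * R +
       (\<Sum>a\<in>K. c a * ?F (z a) u * poly (p a) u)"
    proof -
      have "hl_sum t (m # ms) ?y (insert k0 K) =
        ?y k0 ^ m * (\<Prod>b\<in>insert k0 K - {k0}. ?F (?y k0) (?y b)) *
          hl_sum t ms ?y (insert k0 K - {k0}) +
        (\<Sum>a\<in>K. ?y a ^ m * (\<Prod>b\<in>insert k0 K - {a}. ?F (?y a) (?y b)) *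
          hl_sum t ms ?y (insert k0 K - {a}))"
        unfolding hl_sum.simps using Cons.prems(1,3) by (rule sum.insert)
      also have "insert k0 K - {k0} = K" using Cons.prems(3) by auto
      also have "(\<Prod>b\<in>K. ?F (?y k0) (?y b)) = (\<Prod>b\<in>K. ?F u (z b))"
        using 3 by (intro prod.cong) auto
      also have "(\<Sum>a\<in>K. ?y a ^ m *
          (\<Prod>b\<in>insert k0 K - {a}. ?F (?y a) (?y b)) *
          hl_sum t ms ?y (insert k0 K - {a})) = (\<Sum>a\<in>K. c a * ?F (z a) u * poly (p a) u)"
      proof (rule sum.cong[OF refl])
        fix a assume a: "a \<in> K"
        have "u \<notin> z ` (K - {a})" using u by auto
        then have "hl_sum t ms ?y (insert k0 K - {a}) = poly (p a) u"
          unfolding 6[OF a] by (rule p(2))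
        then show "?y a ^ m *
          (\<Prod>b\<in>insert k0 K - {a}. ?F (?y a) (?y b)) *
          hl_sum t ms ?y (insert k0 K - {a}) = c a * ?F (z a) u * poly (p a) u"
          using 7[OF a] 3[OF a] by (simp only: c_def mult_ac)
      qed
      finally show ?thesis unfolding 4 by (simp only: fun_upd_same)
    qed
    then have "hl_sum t (m # ms) ?y (insert k0 K) * poly (V K) u =
       u ^ m * R * ((\<Prod>b\<in>K. ?F u (z b)) * poly (V K) u) +
       (\<Sum>a\<in>K. c a * poly (p a) u * (?F (z a) u * poly (V K) u))"
      by (simp only: distrib_right sum_distrib_right) (simp only: mult_ac)
    also have "\<dots> = u ^ m * R * (\<Prod>b\<in>K. u - t * z b) +
       (\<Sum>a\<in>K. c a * poly (p a) u * - ((z a - t * u) * poly (V (K - {a})) u))"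
      unfolding 1 by (intro arg_cong2[where f = "(+)"] sum.cong refl) (simp only: 2)
    also have "\<dots> = poly Q u"
    proof -
      have "(\<Sum>a\<in>K. c a * poly (p a) u * - ((z a - t * u) * poly (V (K - {a})) u)) =
        - (\<Sum>a\<in>K. c a * ((z a - t * u) * poly (p a) u * poly (V (K - {a})) u))"
        unfolding sum_negf[symmetric] by (rule sum.cong) (simp_all add: mult_ac)
      then show ?thesis
        unfolding polyQ diff_conv_add_uminus[of "R * _"] by (simp only: mult_ac)
    qed
    finally show ?thesis .
  qed
  have "poly Q (z a) = 0" if a: "a \<in> K" for a
  proof -
    have split: "poly (V (K - {b})) (z a) = 0" if "b \<in> K" "b \<noteq> a" for b
      unfolding polyV using a that Cons.prems(1) by (intro prod_zero) auto
    have "(\<Sum>b\<in>K. c b * ((z b - t * z a) * poly (p b) (z a) * poly (V (K - {b})) (z a))) =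
        (\<Sum>b\<in>{a}. c b * ((z b - t * z a) * poly (p b) (z a) * poly (V (K - {b})) (z a)))"
      using a Cons.prems(1) split by (intro sum.mono_neutral_right) auto
    moreover have "poly (p a) (z a) = R"
    proof -
      have "z a \<notin> z ` (K - {a})" using Cons.prems(2) a by (auto simp: inj_on_def)
      then have "poly (p a) (z a) = hl_sum t ms (z(k0 := z a)) (insert k0 (K - {a}))"
        using p(2) by simp
      \<comment> \<open>exchanging the names \<open>a\<close> and \<open>k0\<close>, which carry the same value here\<close>
      also have "insert k0 (K - {a}) = (\<lambda>k. if k = a then k0 else k) ` K"
        using a by auto
      also have "hl_sum t ms (z(k0 := z a)) \<dots> = hl_sum t ms z K"
        by (rule hl_sum_reindex) (use Cons.prems(3) in \<open>auto simp: inj_on_def\<close>)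
      finally show ?thesis by (simp add: R_def)
    qed
    moreover have "c a * poly (V (K - {a})) (z a) = z a ^ m * (\<Prod>b\<in>K - {a}. z a - t * z b)"
    proof -
      have "(\<Prod>b\<in>K - {a}. ?F (z a) (z b)) * (\<Prod>b\<in>K - {a}. z a - z b) = (\<Prod>b\<in>K - {a}. z a - t * z b)"
        unfolding prod.distrib[symmetric]
        by (rule prod.cong) (use Cons.prems(2) a in \<open>auto simp: inj_on_def\<close>)
      then show ?thesis unfolding c_def polyV by (simp add: mult.assoc)
    qed
    moreover have "(\<Prod>b\<in>K. z a - t * z b) = (z a - t * z a) * (\<Prod>b\<in>K - {a}. z a - t * z b)"
      using Cons.prems(1) a by (rule prod.remove)
    ultimately have "poly Q (z a) = R * (z a ^ m * ((z a - t * z a) * (\<Prod>b\<in>K - {a}. z a - t * z b))) -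
        c a * ((z a - t * z a) * R * poly (V (K - {a})) (z a))"
      unfolding polyQ by simp
    also have "\<dots> = 0"
    proof -
      have "c a * ((z a - t * z a) * R * poly (V (K - {a})) (z a)) =
          (z a - t * z a) * R * (c a * poly (V (K - {a})) (z a))"
        by (simp only: mult_ac)
      also have "\<dots> = R * (z a ^ m * ((z a - t * z a) * (\<Prod>b\<in>K - {a}. z a - t * z b)))"
        unfolding \<open>c a * poly (V (K - {a})) (z a) = z a ^ m * (\<Prod>b\<in>K - {a}. z a - t * z b)\<close>
        by (simp only: mult_ac)
      finally show ?thesis by (simp only: diff_self)
    qed
    finally show ?thesis .
  qed
  then have "V K dvd Q"
    unfolding V_def using Cons.prems by (intro prod_linear_factors_dvd) auto
  then obtain P where P: "Q = V K * P" by (elim dvdE)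
  have "degree Q \<le> card K + M"
    unfolding Q_def
  proof (intro degree_diff_le degree_sum_le Cons.prems(1))
    have "degree (monom (1::complex) m * (\<Prod>b\<in>K. [:- t * z b, 1:])) \<le> m + card K"
      by (rule order.trans[OF degree_mult_le])
         (simp add: degree_monom_eq degree_prod_eq_sum_degree)
    then show "degree (smult R (monom 1 m * (\<Prod>b\<in>K. [:- t * z b, 1:]))) \<le> card K + M"
      using Cons.prems(4)[of m] by (intro order.trans[OF degree_smult_le]) auto
  next
    fix a assume a: "a \<in> K"
    have "degree ([:z a, - t:] * p a * V (K - {a})) \<le> degree [:z a, - t:] + degree (p a) + card (K - {a})"
      unfolding degV[symmetric] by (meson add_le_cancel_right degree_mult_le order.trans)
    also have "\<dots> \<le> 1 + M + card (K - {a})"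
      using p(1)[of a] by (intro add_mono) auto
    also have "\<dots> = card K + M"
      using card_Suc_Diff1[OF Cons.prems(1) a] by simp
    finally show "degree (smult (c a) ([:z a, - t:] * p a * V (K - {a}))) \<le> card K + M"
      by (intro order.trans[OF degree_smult_le])
  qed
  then have "degree P \<le> M"
    using V0[of K] by (cases "P = 0") (simp_all add: P degree_mult_eq degV)
  moreover have "hl_sum t (m # ms) (z(k0 := u)) (insert k0 K) = poly P u" if u: "u \<notin> z ` K" for u
  proof -
    have "poly (V K) u \<noteq> 0"
      unfolding polyV using u Cons.prems(1) by auto
    with expand[OF u] show ?thesis by (simp add: P)
  qed
  ultimately show ?case by blast
qed

text \<open>
  The index that carries the distinguished variable is immaterial: one polynomial serves all of them.
\<close>

lemma hl_sum_poly_any_index: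
  fixes z :: "'k \<Rightarrow> complex"
  assumes "finite K" "inj_on z K" "infinite (UNIV :: 'k set)" "\<And>m. m \<in> set ms \<Longrightarrow> m \<le> M"
  obtains p where "degree p \<le> M"
    "\<And>k0 z' u. k0 \<notin> K \<Longrightarrow> (\<And>k. k \<in> K \<Longrightarrow> z' k = z k) \<Longrightarrow> z' k0 \<notin> z ` K \<Longrightarrow>
       hl_sum t ms z' (insert k0 K) = poly p (z' k0)"
proof -
  obtain k1 where k1: "k1 \<notin> K" using assms(1,3) by (meson ex_new_if_finite)
  obtain p where p: "degree p \<le> M"
    "\<And>u. u \<notin> z ` K \<Longrightarrow> hl_sum t ms (z(k1 := u)) (insert k1 K) = poly p u"
    using hl_sum_poly[OF assms(1,2) k1 assms(4), where t = t] by blast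
  show thesis
  proof (rule that[OF p(1)])
    fix k0 :: 'k and z' assume *: "k0 \<notin> K" "\<And>k. k \<in> K \<Longrightarrow> z' k = z k" "z' k0 \<notin> z ` K"
    have "insert k1 K = (\<lambda>k. if k = k0 then k1 else k) ` insert k0 K"
      using * by auto
    also have "hl_sum t ms (z(k1 := z' k0)) \<dots> = hl_sum t ms z' (insert k0 K)"
      by (rule hl_sum_reindex) (use * k1 in \<open>auto simp: inj_on_def\<close>)
    finally show "hl_sum t ms z' (insert k0 K) = poly p (z' k0)"
      using p(2)[OF *(3)] by (simp only:)
  qed
qed

lemma poly_Lipschitz_unit_circle:
  fixes p :: "complex poly"
  obtains L where "L \<ge> 0" "\<And>u. norm u = 1 \<Longrightarrow> norm (poly p u) \<le> L"
    "\<And>u v. norm u = 1 \<Longrightarrow> norm v = 1 \<Longrightarrow> norm (poly p u - poly p v) \<le> L * norm (u - v)"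
proof -
  have "\<exists>L\<ge>0. (\<forall>u. norm u = 1 \<longrightarrow> norm (poly p u) \<le> L) \<and>
    (\<forall>u v. norm u = 1 \<longrightarrow> norm v = 1 \<longrightarrow> norm (poly p u - poly p v) \<le> L * norm (u - v))"
  proof (induction p)
    case 0
    show ?case by (rule exI[of _ 0]) simp
  next
    case (pCons a p)
    then obtain L where L: "L \<ge> 0" "\<And>u. norm u = 1 \<Longrightarrow> norm (poly p u) \<le> L"
      "\<And>u v. norm u = 1 \<Longrightarrow> norm v = 1 \<Longrightarrow> norm (poly p u - poly p v) \<le> L * norm (u - v)"
      by blast
    show ?case
    proof (intro exI[of _ "norm a + 2 * L"] conjI allI impI)
      fix u :: complex assume u: "norm u = 1"
      have "norm (a + u * poly p u) \<le> norm a + norm (u * poly p u)" by (rule norm_triangle_ineq)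
      also have "norm (u * poly p u) \<le> 2 * L" using L(1,2) u by (simp add: norm_mult) (smt (verit))
      finally show "norm (poly (pCons a p) u) \<le> norm a + 2 * L" by simp
      fix v :: complex assume v: "norm v = 1"
      have "poly (pCons a p) u - poly (pCons a p) v = u * (poly p u - poly p v) + (u - v) * poly p v"
        by (simp add: algebra_simps)
      also have "norm \<dots> \<le> norm (u * (poly p u - poly p v)) + norm ((u - v) * poly p v)"
        by (rule norm_triangle_ineq)
      also have "\<dots> \<le> L * norm (u - v) + norm (u - v) * L"
        unfolding norm_mult u mult_1
        by (intro add_mono mult_left_mono L(2)[OF v] L(3)[OF u v] norm_ge_zero)
      also have "\<dots> \<le> (norm a + 2 * L) * norm (u - v)"
        by (simp add: algebra_simps)
      finally show "norm (poly (pCons a p) u - poly (pCons a p) v) \<le> (norm a + 2 * L) * norm (u - v)" .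
    qed (use L in auto)
  qed
  then show thesis using that by blast
qed

lemma lagrange_interpolation:
  fixes p :: "complex poly"
  assumes "finite S" "card S = Suc M" "degree p \<le> M"
  shows "poly p x = (\<Sum>s\<in>S. poly p s * (\<Prod>r\<in>S - {s}. (x - r) / (s - r)))"
proof -
  define l where "l s = smult (inverse (\<Prod>r\<in>S - {s}. s - r)) (\<Prod>r\<in>S - {s}. [:- r, 1:])" for s :: complex
  have l: "poly (l s) x = (\<Prod>r\<in>S - {s}. (x - r) / (s - r))" for s x
    by (simp add: l_def poly_prod prod_dividef divide_inverse[of "prod _ _"] mult.commute)
  have deg: "degree (l s) \<le> M" if "s \<in> S" for s
    unfolding l_def using assms(1,2) that
    by (intro order.trans[OF degree_smult_le]) (simp add: degree_prod_eq_sum_degree)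
  have "p = (\<Sum>s\<in>S. smult (poly p s) (l s))"
  proof (rule poly_eqI_degree[of S])
    fix x assume x: "x \<in> S"
    have 0: "poly (l s) x = 0" if "s \<in> S" "s \<noteq> x" for s
      unfolding l using assms(1) x that by (intro prod_zero) auto
    have 1: "poly (l x) x = 1"
      unfolding l by (rule prod.neutral) auto
    have "(\<Sum>s\<in>S. poly p s * poly (l s) x) = (\<Sum>s\<in>{x}. poly p s * poly (l s) x)"
      using assms(1) x 0 by (intro sum.mono_neutral_right) auto
    then show "poly p x = poly (\<Sum>s\<in>S. smult (poly p s) (l s)) x"
      by (simp add: poly_sum 1)
  next
    show "degree p < card S" using assms by simp
    show "degree (\<Sum>s\<in>S. smult (poly p s) (l s)) < card S"
      using assms(1,2) deg by (auto simp: less_Suc_eq_le intro!: degree_sum_le order.trans[OF degree_smult_le])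
  qed
  then have "poly p x = poly (\<Sum>s\<in>S. smult (poly p s) (l s)) x" by simp
  then show ?thesis by (simp add: poly_sum l)
qed

text \<open>
  Lagrange interpolation turns bounds at \<open>M + 1\<close> nodes into a bound and a Lipschitz constant on the
  unit circle that are uniform over all polynomials of degree at most \<open>M\<close>.
\<close>

lemma poly_bounds_from_nodes:
  fixes S :: "complex set"
  assumes "finite S" "card S = Suc M"
  obtains L where "L \<ge> 0"
    "\<And>p C u. degree p \<le> M \<Longrightarrow> (\<And>s. s \<in> S \<Longrightarrow> norm (poly p s) \<le> C) \<Longrightarrow> norm u = 1 \<Longrightarrow>
       norm (poly p u) \<le> C * L"
    "\<And>p C u v. degree p \<le> M \<Longrightarrow> (\<And>s. s \<in> S \<Longrightarrow> norm (poly p s) \<le> C) \<Longrightarrow> norm u = 1 \<Longrightarrow>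
       norm v = 1 \<Longrightarrow> norm (poly p u - poly p v) \<le> C * L * norm (u - v)"
proof -
  define l where "l s = smult (inverse (\<Prod>r\<in>S - {s}. s - r)) (\<Prod>r\<in>S - {s}. [:- r, 1:])" for s :: complex
  have l: "poly (l s) x = (\<Prod>r\<in>S - {s}. (x - r) / (s - r))" for s x
    by (simp add: l_def poly_prod prod_dividef divide_inverse[of "prod _ _"] mult.commute)
  have "\<exists>L\<ge>0. (\<forall>u. norm u = 1 \<longrightarrow> norm (poly (l s) u) \<le> L) \<and> (\<forall>u v. norm u = 1 \<longrightarrow> norm v = 1 \<longrightarrow>
    norm (poly (l s) u - poly (l s) v) \<le> L * norm (u - v))" for s
    by (rule poly_Lipschitz_unit_circle[of "l s"]) blast
  then obtain L where L: "\<And>s. L s \<ge> 0" "\<And>s u. norm u = 1 \<Longrightarrow> norm (poly (l s) u) \<le> L s"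
    "\<And>s u v. norm u = 1 \<Longrightarrow> norm v = 1 \<Longrightarrow> norm (poly (l s) u - poly (l s) v) \<le> L s * norm (u - v)"
    by metis
  have rep: "poly p x = (\<Sum>s\<in>S. poly p s * poly (l s) x)" if "degree p \<le> M" for p x
    unfolding l by (rule lagrange_interpolation[OF assms that])
  show thesis
  proof (rule that[of "\<Sum>s\<in>S. L s"])
    show "(\<Sum>s\<in>S. L s) \<ge> 0" using L(1) by (rule sum_nonneg)
  next
    fix p :: "complex poly" and C and u :: complex
    assume *: "degree p \<le> M" "\<And>s. s \<in> S \<Longrightarrow> norm (poly p s) \<le> C" "norm u = 1"
    have "norm (poly p u) \<le> (\<Sum>s\<in>S. norm (poly p s * poly (l s) u))"
      unfolding rep[OF *(1), of u] by (rule norm_sum)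
    also have "\<dots> \<le> (\<Sum>s\<in>S. C * L s)"
      unfolding norm_mult using *(2,3) L(2)
      by (intro sum_mono mult_mono) (auto intro: order.trans[OF norm_ge_zero])
    finally show "norm (poly p u) \<le> C * (\<Sum>s\<in>S. L s)" by (simp add: sum_distrib_left)
    fix v :: complex assume v: "norm v = 1"
    have "poly p u - poly p v = (\<Sum>s\<in>S. poly p s * (poly (l s) u - poly (l s) v))"
      unfolding rep[OF *(1), of u] rep[OF *(1), of v] by (simp add: sum_subtractf right_diff_distrib)
    also have "norm \<dots> \<le> (\<Sum>s\<in>S. norm (poly p s * (poly (l s) u - poly (l s) v)))"
      by (rule norm_sum)
    also have "\<dots> \<le> (\<Sum>s\<in>S. C * (L s * norm (u - v)))"
      unfolding norm_mult using *(2,3) L(3) v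
      by (intro sum_mono mult_mono) (auto intro: order.trans[OF norm_ge_zero])
    finally show "norm (poly p u - poly p v) \<le> C * (\<Sum>s\<in>S. L s) * norm (u - v)"
      by (simp add: sum_distrib_left sum_distrib_right mult.assoc)
  qed
qed

lemma interpolation_nodes:
  assumes "finite B"
  obtains S :: "complex set" where "finite S" "card S = Suc M" "\<And>s. s \<in> S \<Longrightarrow> norm s > 1" "S \<inter> B = {}"
proof -
  have "infinite (range (\<lambda>n::nat. of_nat (n + 2) :: complex))"
    by (rule range_inj_infinite) (auto simp: inj_def)
  then have "infinite (range (\<lambda>n::nat. of_nat (n + 2) :: complex) - B)"
    using assms by simp
  then obtain S where S: "S \<subseteq> range (\<lambda>n::nat. of_nat (n + 2) :: complex) - B" "card S = Suc M" "finite S"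
    by (meson infinite_arbitrarily_large)
  show thesis
  proof (rule that[OF S(3,2)])
    fix s assume "s \<in> S"
    then obtain n where "s = of_nat (n + 2)" using S(1) by blast
    then show "norm s > 1" by (simp only: norm_of_nat)
  qed (use S in auto)
qed

text \<open>
  The individual fractions blow up where variables collide, but their sum does not. The variables in
  \<open>F\<close>, which range over the unit circle, are replaced one after the other by interpolation nodes.
  Nodes of modulus greater than 1 are distinct from all the variables that are still free, so the
  variables stay pairwise distinct throughout.
\<close>

lemma hl_sum_bounded:
  fixes c :: "'k \<Rightarrow> complex"
  assumes "finite K" "F \<subseteq> K"
  obtains C where "\<And>z. (\<And>k. k \<in> K - F \<Longrightarrow> z k = c k) \<Longrightarrow> (\<And>k. k \<in> F \<Longrightarrow> norm (z k) = 1) \<Longrightarrow>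
    inj_on z K \<Longrightarrow> norm (hl_sum t ms z K) \<le> C"
proof -
  have "finite F" using assms finite_subset by blast
  then have "\<exists>C. \<forall>z. (\<forall>k\<in>K - F. z k = c k) \<longrightarrow> (\<forall>k\<in>F. norm (z k) = 1) \<longrightarrow>
    inj_on z K \<longrightarrow> norm (hl_sum t ms z K) \<le> C"
    using assms(2)
  proof (induction F arbitrary: c rule: finite_induct)
    case empty
    show ?case
    proof (intro exI[of _ "norm (hl_sum t ms c K)"] allI impI)
      fix z :: "'k \<Rightarrow> complex" assume "\<forall>k\<in>K - {}. z k = c k"
      then have "hl_sum t ms z K = hl_sum t ms c K" by (intro hl_sum_cong) auto
      then show "norm (hl_sum t ms z K) \<le> norm (hl_sum t ms c K)" by simp
    qed
  next
    case (insert k0 F)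
    obtain M where M: "\<And>m. m \<in> set ms \<Longrightarrow> m \<le> M"
      using finite_nat_set_iff_bounded_le[of "set ms"] by auto
    obtain S where S: "finite S" "card S = Suc M" "\<And>s. s \<in> S \<Longrightarrow> norm s > 1" "S \<inter> c ` K = {}"
      using interpolation_nodes[of "c ` K" M] assms(1) by auto
    obtain L where L: "L \<ge> 0"
      "\<And>p C u. degree p \<le> M \<Longrightarrow> (\<And>s. s \<in> S \<Longrightarrow> norm (poly p s) \<le> C) \<Longrightarrow> norm u = 1 \<Longrightarrow>
         norm (poly p u) \<le> C * L"
      using poly_bounds_from_nodes[OF S(1,2)] by metis
    have "\<exists>C. \<forall>z. (\<forall>k\<in>K - F. z k = (c(k0 := s)) k) \<longrightarrow> (\<forall>k\<in>F. norm (z k) = 1) \<longrightarrow>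
      inj_on z K \<longrightarrow> norm (hl_sum t ms z K) \<le> C" for s
      using insert.IH[of "c(k0 := s)"] insert.prems by blast
    then obtain C where C: "\<And>s z. (\<forall>k\<in>K - F. z k = (c(k0 := s)) k) \<Longrightarrow> (\<forall>k\<in>F. norm (z k) = 1) \<Longrightarrow>
      inj_on z K \<Longrightarrow> norm (hl_sum t ms z K) \<le> C s"
      by metis
    define D where "D = (\<Sum>s\<in>S. \<bar>C s\<bar>)"
    have CD: "C s \<le> D" if "s \<in> S" for s
      unfolding D_def using member_le_sum[of s S "\<lambda>s. \<bar>C s\<bar>"] S(1) that by auto
    show ?case
    proof (intro exI[of _ "D * L"] allI impI)
      fix z :: "'k \<Rightarrow> complex"
      assume z: "\<forall>k\<in>K - insert k0 F. z k = c k" "\<forall>k\<in>insert k0 F. norm (z k) = 1" "inj_on z K"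
      let ?K = "K - {k0}"
      have K: "K = insert k0 ?K" using insert.prems by auto
      have "inj_on z ?K" using z(3) by (rule inj_on_subset) auto
      then obtain p where p: "degree p \<le> M"
        "\<And>u. u \<notin> z ` ?K \<Longrightarrow> hl_sum t ms (z(k0 := u)) (insert k0 ?K) = poly p u"
        using hl_sum_poly[of ?K z k0 ms M t] M assms(1) by auto
      have nodes: "norm (poly p s) \<le> D" if s: "s \<in> S" for s
      proof -
        have s': "s \<notin> z ` ?K"
        proof
          assume "s \<in> z ` ?K"
          then obtain k where k: "k \<in> K" "k \<noteq> k0" "s = z k" by auto
          show False
          proof (cases "k \<in> F")
            case True
            then show False using z(2) S(3)[OF s] k(3) by auto
          next
            case False
            then show False using z(1) S(4) s k by auto
          qed
        qed
        then have "poly p s = hl_sum t ms (z(k0 := s)) K"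
          using p(2) K by metis
        also have "norm \<dots> \<le> C s"
        proof (rule C)
          show "inj_on (z(k0 := s)) K"
            using z(3) s' by (auto simp: inj_on_def)
        qed (use z insert.hyps in auto)
        finally show ?thesis using CD[OF s] by simp
      qed
      have "z k0 \<notin> z ` ?K" using z(3) insert.prems by (auto simp: inj_on_def)
      then have "hl_sum t ms z K = poly p (z k0)"
        using p(2)[of "z k0"] K by simp
      then show "norm (hl_sum t ms z K) \<le> D * L"
        using L(2)[OF p(1) nodes] z(2) by simp
    qed
  qed
  then obtain C where "\<forall>z. (\<forall>k\<in>K - F. z k = c k) \<longrightarrow> (\<forall>k\<in>F. norm (z k) = 1) \<longrightarrow>
    inj_on z K \<longrightarrow> norm (hl_sum t ms z K) \<le> C" ..
  then show thesis by (intro that[of C]) auto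
qed

section \<open>Integration over the circle and the torus\<close>

lemma sets_circle_measure [simp, measurable_cong]: "sets circle_measure = sets borel"
  by (simp add: circle_measure_def)

lemma space_circle_measure [simp]: "space circle_measure = UNIV"
  by (simp add: circle_measure_def)

lemma uniform_circle_density:
  "uniform_measure lborel {0..2 * pi} =
     density lborel (\<lambda>\<theta>::real. ennreal (indicator {0..2 * pi} \<theta> / (2 * pi)))"
proof -
  have "indicator {0..2 * pi} \<theta> / ennreal (2 * pi) = ennreal (indicator {0..2 * pi} \<theta> / (2 * pi))" for \<theta> :: real
    by (simp add: indicator_def divide_ennreal[symmetric] ennreal_divide_numeral)
  then show ?thesis by (simp add: uniform_measure_def)
qed

lemma cis_measurable [measurable]: "cis \<in> borel_measurable borel"
  by (intro borel_measurable_continuous_onI continuous_intros)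

lemma prob_space_circle_measure: "prob_space circle_measure"
  unfolding circle_measure_def
proof (rule prob_space.prob_space_distr)
  show "prob_space (uniform_measure lborel {0..2 * pi})"
    by (rule prob_space_uniform_measure) auto
qed measurable

lemma countable_cis_vimage: "finite A \<Longrightarrow> countable (cis -` A)"
proof -
  assume A: "finite A"
  have "countable {\<theta>. cis \<theta> = a}" for a
  proof (cases "\<exists>\<theta>0. cis \<theta>0 = a")
    case True
    then obtain \<theta>0 where 0: "cis \<theta>0 = a" ..
    have "{\<theta>. cis \<theta> = a} \<subseteq> range (\<lambda>n::int. \<theta>0 + 2 * pi * of_int n)"
    proof clarsimp
      fix \<theta> assume "a = cis \<theta>"
      then have "cis (\<theta> - \<theta>0) = 1" using 0 by (simp add: cis_divide[symmetric])
      then obtain n where "\<theta> - \<theta>0 = of_int n * (2 * pi)" 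
        using cos_one_2pi_int by (metis cis.simps(1) mult.assoc one_complex.simps(1))
      then have "\<theta> = \<theta>0 + 2 * pi * of_int n" by (simp add: algebra_simps)
      then show "\<theta> \<in> range (\<lambda>n::int. \<theta>0 + 2 * pi * of_int n)" by blast
    qed
    then show ?thesis by (rule countable_subset) simp
  next
    case False
    then have "{\<theta>. cis \<theta> = a} = {}" by auto
    then show ?thesis by simp
  qed
  moreover have "cis -` A = (\<Union>a\<in>A. {\<theta>. cis \<theta> = a})" by auto
  ultimately show ?thesis using A by (auto intro: countable_finite)
qed

lemma AE_cis_notin: "finite A \<Longrightarrow> AE \<theta> in lborel. cis \<theta> \<notin> A"
  by (drule AE_not_in[OF countable_imp_null_set_lborel[OF countable_cis_vimage]]) simp

lemma AE_circle_measure: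
  assumes "finite A"
  shows "AE x in circle_measure. norm x = 1 \<and> x \<notin> A"
  unfolding circle_measure_def
proof (subst AE_distr_iff)
  have "A \<in> sets borel" using assms by (simp add: borel_closed finite_imp_closed)
  then show "{x \<in> space borel. norm x = 1 \<and> x \<notin> A} \<in> sets borel" by measurable
  show "AE x in uniform_measure lborel {0..2 * pi}. norm (cis x) = 1 \<and> cis x \<notin> A"
    by (rule AE_uniform_measureI) (use AE_cis_notin[OF assms] in auto)
qed measurable

lemma circle_integral_eq:
  fixes f k :: "complex \<Rightarrow> complex" and I :: complex
  assumes [measurable]: "f \<in> borel_measurable borel" and "finite A"
    and eq: "\<And>x. norm x = 1 \<Longrightarrow> x \<notin> A \<Longrightarrow> f x = k x"
    and cont: "continuous_on {0..2 * pi} (\<lambda>\<theta>. k (cis \<theta>))"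
    and int: "((\<lambda>\<theta>. k (cis \<theta>)) has_integral 2 * pi * I) {0..2 * pi}"
  shows "(LINT x|circle_measure. f x) = I"
proof -
  have "(LINT x|circle_measure. f x) = (LINT \<theta>|uniform_measure lborel {0..2 * pi}. f (cis \<theta>))"
    unfolding circle_measure_def by (rule integral_distr) measurable
  also have "\<dots> = (LINT \<theta>|lborel. (indicator {0..2 * pi} \<theta> / (2 * pi)) *\<^sub>R f (cis \<theta>))"
    unfolding uniform_circle_density by (rule integral_density) auto
  also have "\<dots> = (LINT \<theta>|lborel. (indicator {0..2 * pi} \<theta> / (2 * pi)) *\<^sub>R k (cis \<theta>))"
  proof (rule integral_cong_AE)
    have "(\<lambda>\<theta>. indicator {0..2 * pi} \<theta> *\<^sub>R k (cis \<theta>)) \<in> borel_measurable lborel"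
      using borel_integrable_atLeastAtMost'[OF cont] by (simp add: set_integrable_def)
    then have "(\<lambda>\<theta>. (1 / (2 * pi)) *\<^sub>R (indicator {0..2 * pi} \<theta> *\<^sub>R k (cis \<theta>))) \<in> borel_measurable lborel"
      by measurable
    then show "(\<lambda>\<theta>. (indicator {0..2 * pi} \<theta> / (2 * pi)) *\<^sub>R k (cis \<theta>)) \<in> borel_measurable lborel"
      by simp
    show "AE \<theta> in lborel. (indicator {0..2 * pi} \<theta> / (2 * pi)) *\<^sub>R f (cis \<theta>) =
        (indicator {0..2 * pi} \<theta> / (2 * pi)) *\<^sub>R k (cis \<theta>)"
      using AE_cis_notin[OF assms(2)] by eventually_elim (simp add: eq)
  qed measurable
  also have "\<dots> = (LINT \<theta>|lborel. (1 / (2 * pi)) *\<^sub>R (indicator {0..2 * pi} \<theta> *\<^sub>R k (cis \<theta>)))"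
    by simp
  also have "\<dots> = (1 / (2 * pi)) *\<^sub>R (LINT \<theta>:{0..2 * pi}|lborel. k (cis \<theta>))"
    unfolding set_lebesgue_integral_def by (rule integral_scaleR_right)
  also have "(LINT \<theta>:{0..2 * pi}|lborel. k (cis \<theta>)) = integral {0..2 * pi} (\<lambda>\<theta>. k (cis \<theta>))"
    by (rule set_borel_integral_eq_integral(2)[OF borel_integrable_atLeastAtMost'[OF cont]])
  also have "\<dots> = 2 * pi * I" using int by (rule integral_unique)
  finally show ?thesis by (simp add: scaleR_conv_of_real)
qed

lemma circle_mean_value:
  fixes h :: "complex \<Rightarrow> complex"
  assumes "h holomorphic_on ball 0 R" "R > 1"
  shows "((\<lambda>\<theta>. h (cis \<theta>)) has_integral 2 * pi * h 0) {0..2 * pi}"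
proof -
  have "h holomorphic_on cball 0 1"
    using assms by (elim holomorphic_on_subset) auto
  then have "((\<lambda>u. h u / (u - 0)) has_contour_integral (2 * complex_of_real pi * \<i> * h 0)) (circlepath 0 1)"
    by (rule Cauchy_integral_circlepath_simple) simp
  then have "((\<lambda>\<theta>. h (0 + 1 * cis \<theta>) / (0 + 1 * cis \<theta> - 0) * 1 * \<i> * cis \<theta>) has_integral
     (2 * complex_of_real pi * \<i> * h 0)) {0..2 * pi}"
    unfolding circlepath_def by (subst (asm) has_contour_integral_part_circlepath_iff) auto
  then have "((\<lambda>\<theta>. \<i> * h (cis \<theta>)) has_integral (2 * complex_of_real pi * \<i> * h 0)) {0..2 * pi}"
    by (simp add: mult.commute)
  from has_integral_mult_right[OF this, of "- \<i>"]
  show ?thesis by (simp add: mult.assoc[symmetric]) (simp add: mult_ac)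
qed

lemma circle_mean_value_cnj:
  fixes h :: "complex \<Rightarrow> complex"
  assumes "h holomorphic_on ball 0 R" "R > 1"
  shows "((\<lambda>\<theta>. h (cnj (cis \<theta>))) has_integral 2 * pi * h 0) {0..2 * pi}"
proof -
  have "cnj ` ball 0 R = ball 0 R"
    by (force simp: image_iff intro!: bexI[of _ "cnj _"])
  then have "cnj \<circ> h \<circ> cnj holomorphic_on ball 0 R"
    using assms(1) by (intro holomorphic_on_compose_cnj_cnj) auto
  from circle_mean_value[OF this assms(2)]
  have "((\<lambda>\<theta>. cnj (h (cnj (cis \<theta>)))) has_integral 2 * pi * cnj (h 0)) {0..2 * pi}"
    by simp
  then show ?thesis
    by (subst has_integral_cnj[symmetric]) (simp add: o_def)
qed

text \<open>
  The principal value of \<open>\<integral> x\<^sup>2 g(x) / (x\<^sup>2 - 1) dT\<close> is half the sum of the residues at \<open>1\<close> and \<open>- 1\<close>,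
  which lie on the contour. Adding the integrand at \<open>x\<close> and at \<open>1/x\<close> removes the singularities and
  doubles the value.
\<close>

lemma circle_integral_symmetrised:
  fixes f g :: "complex \<Rightarrow> complex"
  assumes [measurable]: "f \<in> borel_measurable borel" and "finite A"
    and hol: "g holomorphic_on ball 0 R" "R > 1"
    and eq: "\<And>x. norm x = 1 \<Longrightarrow> x \<notin> A \<Longrightarrow> f x = (x\<^sup>2 * g x - g (inverse x)) / (x\<^sup>2 - 1)"
  shows "(LINT x|circle_measure. f x) = (g 1 + g (- 1)) / 2"
proof -
  let ?B = "ball (0::complex) R"
  have in1: "1 \<in> interior ?B" "-1 \<in> interior ?B" using hol(2) by auto
  define h :: "complex \<Rightarrow> complex" where "h z = (if z = 1 then deriv g 1 else (g z - g 1) / (z - 1))" for z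
  have gh: "g z = g 1 + (z - 1) * h z" for z by (simp add: h_def)
  have "(\<lambda>z. if z = 1 then deriv g 1 else g z / (z - 1) - g 1 / (z - 1)) holomorphic_on ?B"
    by (rule pole_theorem[OF hol(1) in1(1)]) simp
  then have holh: "h holomorphic_on ?B"
    unfolding h_def[abs_def] diff_divide_distrib .
  define c where "c = h (- 1)"
  define k :: "complex \<Rightarrow> complex" where "k z = (if z = - 1 then deriv h (- 1) else (h z - c) / (z - (- 1)))" for z
  have hk: "h z = c + (z + 1) * k z" for z
  proof (cases "z = - 1")
    case False
    then have "z + 1 \<noteq> 0" by (simp add: add_eq_0_iff2)
    then show ?thesis using False by (simp add: k_def)
  qed (simp add: c_def)
  have "(\<lambda>z. if z = - 1 then deriv h (- 1) else h z / (z - (- 1)) - h (- 1) / (z - (- 1))) holomorphic_on ?B"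
    by (rule pole_theorem[OF holh in1(2)]) (simp add: add_eq_0_iff2)
  then have holk: "k holomorphic_on ?B"
    unfolding k_def[abs_def] c_def diff_divide_distrib .
  \<comment> \<open>subtracting a linear interpolant at \<open>1\<close> and \<open>- 1\<close>; only its value and the mean value property of the rest enter the integral\<close>
  have g: "g z = g 1 + (z - 1) * c + (z\<^sup>2 - 1) * k z" for z
    by (subst gh, subst hk) (simp add: algebra_simps power2_eq_square)
  define G where "G z = c * z + z\<^sup>2 * k z" for z
  define K where "K z = (g 1 - c) + G z + G (cnj z)" for z
  have holG: "G holomorphic_on ?B"
    unfolding G_def by (intro holomorphic_intros holk)
  have holH: "(\<lambda>z. (g 1 - c) + G z) holomorphic_on ?B"
    by (intro holomorphic_intros holG)
  have "(LINT x|circle_measure. f x) = g 1 - c"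
  proof (rule circle_integral_eq[where A = "A \<union> {1, -1}" and k = K])
    fix x :: complex assume x: "norm x = 1" "x \<notin> A \<union> {1, -1}"
    have x0: "x \<noteq> 0" using x by auto
    have x1: "x\<^sup>2 - 1 \<noteq> 0" using x(2) by (auto simp: power2_eq_1_iff)
    have inv: "inverse x = cnj x" using x(1)
      by (metis complex_cnj_cnj complex_div_cnj div_by_1 inverse_eq_divide mult_1 norm_one of_real_1 power_one)
    have "x\<^sup>2 * g x - g (inverse x) = (x\<^sup>2 - 1) * ((g 1 - c) + G x + G (inverse x))"
      unfolding G_def g[of x] g[of "inverse x"]
      using x0 by (simp add: field_simps power2_eq_square)
    then have "f x = (g 1 - c) + G x + G (inverse x)"
      using x x1 by (subst eq) auto
    then show "f x = K x" by (simp add: K_def inv)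
  next
    have cG: "continuous_on ?B G" by (rule holomorphic_on_imp_continuous_on[OF holG])
    show "continuous_on {0..2 * pi} (\<lambda>\<theta>. K (cis \<theta>))"
      unfolding K_def
      by (intro continuous_intros continuous_on_compose2[OF cG]) (use hol(2) in auto)
    show "((\<lambda>\<theta>. K (cis \<theta>)) has_integral 2 * pi * (g 1 - c)) {0..2 * pi}"
      using has_integral_add[OF circle_mean_value[OF holH hol(2)] circle_mean_value_cnj[OF holG hol(2)]]
      by (simp add: K_def G_def)
  qed (use assms in auto)
  also have "c = (g 1 - g (- 1)) / 2" using gh[of "- 1"] by (simp add: c_def field_simps)
  finally show ?thesis by (simp add: field_simps)
qed

text \<open>
  The index sets are arbitrary so that single variables can be removed without renumbering.
\<close>

definition torus :: "nat set \<Rightarrow> (nat \<Rightarrow> complex) measure" where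
  "torus I = PiM I (\<lambda>_. circle_measure)"

interpretation circle_product: product_sigma_finite "\<lambda>_::nat. circle_measure"
  by (simp add: product_sigma_finite_def prob_space_circle_measure prob_space_imp_sigma_finite)

lemma prob_space_torus: "prob_space (torus I)"
  unfolding torus_def by (rule prob_space_PiM) (rule prob_space_circle_measure)

lemma sets_torus: "sets (torus I) = sets (PiM I (\<lambda>_. borel))"
  unfolding torus_def by (rule sets_PiM_cong) auto

lemma torus_component [measurable]: "i \<in> I \<Longrightarrow> (\<lambda>x. x i) \<in> borel_measurable (torus I)"
  unfolding measurable_cong_sets[OF sets_torus refl] by (rule measurable_component_singleton)

lemma AE_torus_insert:
  assumes "finite I" "i \<notin> I" and [measurable]: "Measurable.pred (torus (insert i I)) P"
    and AE: "AE y in torus I. AE x in circle_measure. P (y(i := x))"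
  shows "AE x in torus (insert i I). P x"
proof -
  let ?T = "torus (insert i I)"
  let ?f = "\<lambda>x. indicator {x \<in> space ?T. \<not> P x} x :: ennreal"
  have [measurable]: "{x \<in> space ?T. \<not> P x} \<in> sets ?T" by measurable
  have "(\<integral>\<^sup>+x. ?f x \<partial>?T) = (\<integral>\<^sup>+y. (\<integral>\<^sup>+x. ?f (y(i := x)) \<partial>circle_measure) \<partial>torus I)"
    unfolding torus_def
    by (rule circle_product.product_nn_integral_insert) (use assms(1,2) in \<open>auto simp: torus_def[symmetric]\<close>)
  also have "\<dots> = (\<integral>\<^sup>+y. 0 \<partial>torus I)"
  proof (rule nn_integral_cong_AE)
    show "AE y in torus I. (\<integral>\<^sup>+x. ?f (y(i := x)) \<partial>circle_measure) = 0"
      using AE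
    proof eventually_elim
      case (elim y)
      have "(\<integral>\<^sup>+x. ?f (y(i := x)) \<partial>circle_measure) = (\<integral>\<^sup>+x. 0 \<partial>circle_measure)"
        by (rule nn_integral_cong_AE) (use elim in \<open>auto elim!: eventually_mono\<close>)
      then show ?case by simp
    qed
  qed
  finally have "emeasure ?T {x \<in> space ?T. \<not> P x} = 0" by simp
  then show ?thesis by (subst AE_iff_measurable[OF _ refl]) auto
qed

lemma AE_torus_component:
  assumes "i \<in> I" "finite A"
  shows "AE x in torus I. norm (x i) = 1 \<and> x i \<notin> A"
  unfolding torus_def
  by (rule AE_PiM_component) (use assms prob_space_circle_measure AE_circle_measure in auto)

lemma AE_torus_distinct:
  assumes "finite I" "i \<in> I" "j \<in> I" "i \<noteq> j"
  shows "AE x in torus I. x i \<noteq> x j \<and> x i \<noteq> inverse (x j)"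
proof -
  have I: "insert i (I - {i}) = I" using assms by auto
  have [measurable]: "(\<lambda>x. x i) \<in> borel_measurable (torus I)" "(\<lambda>x. x j) \<in> borel_measurable (torus I)"
    by (rule torus_component, fact)+
  have "AE x in torus (insert i (I - {i})). x i \<noteq> x j \<and> x i \<noteq> inverse (x j)"
  proof (rule AE_torus_insert)
    show "Measurable.pred (torus (insert i (I - {i}))) (\<lambda>x. x i \<noteq> x j \<and> x i \<noteq> inverse (x j))"
    proof -
      have "Measurable.pred (torus I) (\<lambda>x. x i - x j \<noteq> 0 \<and> x i - inverse (x j) \<noteq> 0)"
        by measurable
      then show ?thesis unfolding I by simp
    qed
    show "AE y in torus (I - {i}). AE x in circle_measure.
        (y(i := x)) i \<noteq> (y(i := x)) j \<and> (y(i := x)) i \<noteq> inverse ((y(i := x)) j)"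
    proof (rule always_eventually, rule allI)
      fix y :: "nat \<Rightarrow> complex"
      show "AE x in circle_measure. (y(i := x)) i \<noteq> (y(i := x)) j \<and> (y(i := x)) i \<noteq> inverse ((y(i := x)) j)"
        by (rule eventually_mono[OF AE_circle_measure[of "{y j, inverse (y j)}"]]) (use assms in auto)
    qed
  qed (use assms in auto)
  then show ?thesis by (simp only: I)
qed

section \<open>Arguments, generic points and the density\<close>

type_synonym arg_index = "(nat \<times> bool) + complex"

text \<open>
  Indices for the arguments of \<open>P\<^sub>\<lambda>\<close>: \<open>Inl (i, b)\<close> stands for \<open>x\<^sub>i\<close> or its inverse, and \<open>Inr e\<close> for an extra
  argument with the constant value \<open>e\<close>.
\<close>

fun arg_val :: "(nat \<Rightarrow> complex) \<Rightarrow> arg_index \<Rightarrow> complex" where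
  "arg_val x (Inl (i, b)) = (if b then x i else inverse (x i))"
| "arg_val x (Inr e) = e"

definition arg_ix :: "nat set \<Rightarrow> complex set \<Rightarrow> arg_index set" where
  "arg_ix I E = (I \<times> UNIV) <+> E"

lemma in_arg_ix [simp]:
  "Inl (i, b) \<in> arg_ix I E \<longleftrightarrow> i \<in> I" "Inr e \<in> arg_ix I E \<longleftrightarrow> e \<in> E"
  by (auto simp: arg_ix_def)

lemma arg_ix_cases:
  assumes "k \<in> arg_ix I E"
  obtains i b where "k = Inl (i, b)" "i \<in> I" | e where "k = Inr e" "e \<in> E"
  using assms by (auto simp: arg_ix_def)

lemma finite_arg_ix [simp]: "finite I \<Longrightarrow> finite E \<Longrightarrow> finite (arg_ix I E)"
  by (simp add: arg_ix_def)

lemma card_arg_ix: "finite I \<Longrightarrow> finite E \<Longrightarrow> card (arg_ix I E) = 2 * card I + card E"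
  by (simp add: arg_ix_def card_Plus card_cartesian_product)

lemma infinite_arg_index: "infinite (UNIV :: arg_index set)"
  by (metis finite_Plus_UNIV_iff infinite_UNIV_char_0)

lemma arg_ix_mono: "I \<subseteq> I' \<Longrightarrow> E \<subseteq> E' \<Longrightarrow> arg_ix I E \<subseteq> arg_ix I' E'"
  by (auto simp: arg_ix_def)

lemma arg_ix_insert:
  "arg_ix (insert i I) E = {Inl (i, True), Inl (i, False)} \<union> arg_ix I E"
  "arg_ix I (insert e E) = insert (Inr e) (arg_ix I E)"
  "arg_ix I E - {Inr e} = arg_ix I (E - {e})"
  by (auto simp: arg_ix_def UNIV_bool)

lemma prod_arg_ix:
  assumes "finite I" "finite E"
  shows "(\<Prod>k\<in>arg_ix I E. f k) = (\<Prod>i\<in>I. f (Inl (i, True)) * f (Inl (i, False))) * (\<Prod>e\<in>E. f (Inr e))"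
  unfolding arg_ix_def using assms
  by (simp add: prod.Plus prod.cartesian_product' UNIV_bool mult.commute)

lemma sum_arg_ix:
  assumes "finite I" "finite E"
  shows "(\<Sum>k\<in>arg_ix I E. f k) = (\<Sum>i\<in>I. f (Inl (i, True)) + f (Inl (i, False))) + (\<Sum>e\<in>E. f (Inr e))"
  unfolding arg_ix_def using assms
  by (simp add: sum.Plus sum.cartesian_product' UNIV_bool add.commute)

lemma arg_val_upd: "i \<notin> I \<Longrightarrow> k \<in> arg_ix I E \<Longrightarrow> arg_val (y(i := u)) k = arg_val y k"
  by (elim arg_ix_cases) auto

lemma arg_val_measurable:
  assumes "k \<in> arg_ix I E"
  shows "(\<lambda>x. arg_val x k) \<in> borel_measurable (torus I)"
  using assms
proof (cases rule: arg_ix_cases)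
  case (1 i b)
  have [measurable]: "(\<lambda>x. x i) \<in> borel_measurable (torus I)" using 1(2) by (rule torus_component)
  show ?thesis by (cases b) (simp_all add: 1)
qed simp

text \<open>
  Points of the torus at which all arguments, with both \<open>1\<close> and \<open>- 1\<close> added, are distinct.
\<close>

definition generic :: "nat set \<Rightarrow> (nat \<Rightarrow> complex) \<Rightarrow> bool" where
  "generic I x \<longleftrightarrow> (\<forall>i\<in>I. norm (x i) = 1) \<and> inj_on (arg_val x) (arg_ix I {1, - 1})"

lemma AE_generic:
  assumes "finite I"
  shows "AE x in torus I. generic I x"
proof -
  have "AE x in torus I. \<forall>i\<in>I. norm (x i) = 1 \<and> x i \<notin> {1, - 1}"
    using assms by (intro AE_finite_allI AE_torus_component) auto
  moreover have "AE x in torus I. \<forall>i\<in>I. \<forall>j\<in>I. i \<noteq> j \<longrightarrow> x i \<noteq> x j \<and> x i \<noteq> inverse (x j)"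
    using assms by (intro AE_finite_allI AE_impI AE_torus_distinct) auto
  ultimately show ?thesis
  proof eventually_elim
    case (elim x)
    have inv0: "x i \<noteq> inverse (x i)" if "i \<in> I" for i
    proof
      assume "x i = inverse (x i)"
      moreover have "x i \<noteq> 0" using elim(1) that by force
      ultimately have "x i * x i = 1" by (metis right_inverse)
      then show False using elim(1) that by (auto simp: square_eq_1_iff)
    qed
    have h2: "x i \<noteq> inverse (x j)" if "i \<in> I" "j \<in> I" for i j
      using elim(2) inv0 that by (cases "i = j") auto
    have h3: "inverse (x i) \<noteq> x j" if "i \<in> I" "j \<in> I" for i j
      using h2[OF that(2,1)] by auto
    have h1: "x i = x j \<longleftrightarrow> i = j" if "i \<in> I" "j \<in> I" for i j
      using elim(2) that by auto
    have h5: "x i \<noteq> 1" "x i \<noteq> - 1" "1 \<noteq> x i" "- 1 \<noteq> x i" if "i \<in> I" for i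
      using elim(1) that by auto
    have h6: "inverse (x i) \<noteq> - 1" "- 1 \<noteq> inverse (x i)" if "i \<in> I" for i
      using h5(2)[OF that] inverse_eq_iff_eq[of "x i" "- 1"] by auto
    have "inj_on (arg_val x) (arg_ix I {1, - 1})"
    proof (rule inj_onI)
      fix k l assume kl: "k \<in> arg_ix I {1, - 1}" "l \<in> arg_ix I {1, - 1}" "arg_val x k = arg_val x l"
      from kl(1) show "k = l"
      proof (cases rule: arg_ix_cases)
        case (1 i b)
        from kl(2) show ?thesis
          by (cases rule: arg_ix_cases) (use kl(3) 1 h1 h2 h3 h5 h6 in \<open>auto split: if_splits\<close>)
      next
        case (2 e)
        from kl(2) show ?thesis
          by (cases rule: arg_ix_cases) (use kl(3) 2 h5 h6 in \<open>auto split: if_splits\<close>)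
      qed
    qed
    then show ?case using elim(1) by (simp add: generic_def)
  qed
qed

lemma genericD:
  assumes "generic I x"
  shows "i \<in> I \<Longrightarrow> norm (x i) = 1"
    and "E \<subseteq> {1, - 1} \<Longrightarrow> inj_on (arg_val x) (arg_ix I E)"
    and "k \<in> arg_ix I {1, - 1} \<Longrightarrow> norm (arg_val x k) = 1"
    and "J \<subseteq> I \<Longrightarrow> generic J x"
proof -
  show *: "norm (x i) = 1" if "i \<in> I" for i using assms that by (simp add: generic_def)
  show "inj_on (arg_val x) (arg_ix I E)" if "E \<subseteq> {1, - 1}"
    using assms by (intro inj_on_subset[OF _ arg_ix_mono[OF order_refl that]]) (simp add: generic_def)
  show "norm (arg_val x k) = 1" if "k \<in> arg_ix I {1, - 1}"
    using that by (cases rule: arg_ix_cases) (auto simp: * norm_inverse)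
  show "generic J x" if "J \<subseteq> I"
    using assms that arg_ix_mono[OF that order_refl]
    by (auto simp: generic_def intro: inj_on_subset)
qed

text \<open>
  The factors of the density. The factor \<open>(x - t b) / (x - b)\<close> of the symmetrised sum is the reciprocal of
  \<open>psi t b (1 / x)\<close>.
\<close>

definition psi :: "complex \<Rightarrow> complex \<Rightarrow> complex \<Rightarrow> complex" where
  "psi t b u = (1 - b * u) / (1 - t * b * u)"

definition pair_factor :: "complex \<Rightarrow> complex \<Rightarrow> complex \<Rightarrow> complex" where
  "pair_factor t u v = pm_fac 1 (u * v) * pm_fac 1 (u * inverse v) / (pm_fac t (u * v) * pm_fac t (u * inverse v))"

text \<open>
  The Koornwinder density without the factor \<open>1 / (2\<^sup>k k!)\<close>, uniformly in the four cases. For the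
  parameters \<open>1, - 1, \<surd>t, - \<surd>t\<close> the one-variable factor is \<open>1 / pm_fac t (x\<^sup>2)\<close>; replacing the
  parameter \<open>e = \<plusminus>1\<close> by \<open>t e\<close>, which happens exactly when \<open>e\<close> is an extra argument, multiplies it by
  \<open>pm_fac e x / pm_fac (t e) x\<close>.
\<close>

definition dens :: "complex \<Rightarrow> nat set \<Rightarrow> complex set \<Rightarrow> (nat \<Rightarrow> complex) \<Rightarrow> complex" where
  "dens t I E x =
     (\<Prod>i\<in>I. (\<Prod>e\<in>E. pm_fac e (x i) / pm_fac (t * e) (x i)) / pm_fac t ((x i)\<^sup>2)) *
     (\<Prod>i\<in>I. \<Prod>j\<in>{j \<in> I. i < j}. pair_factor t (x i) (x j))"

lemma pair_factor_psi:
  "pair_factor t u v = psi t v u * psi t v (inverse u) * (psi t (inverse v) u * psi t (inverse v) (inverse u))"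
  by (simp add: pair_factor_def psi_def pm_fac_def mult_ac)

lemma pair_factor_commute: "pair_factor t u v = pair_factor t v u"
  by (simp add: pair_factor_def pm_fac_def mult_ac)

text \<open>
  Written over all arguments, the factor that a new variable contributes treats the other variables
  and the extra arguments alike.
\<close>

lemma dens_insert:
  assumes "finite I" "finite E" "i \<notin> I"
  shows "dens t (insert i I) E x = dens t I E x *
    ((\<Prod>k\<in>arg_ix I E. psi t (arg_val x k) (x i) * psi t (arg_val x k) (inverse (x i))) / pm_fac t ((x i)\<^sup>2))"
proof -
  let ?P = "\<lambda>i j. pair_factor t (x i) (x j)"
  have 1: "(\<Prod>j\<in>{j \<in> insert i I. i < j}. ?P i j) = (\<Prod>j\<in>{j \<in> I. i < j}. ?P i j)"
    by (rule prod.cong) auto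
  have 2: "(\<Prod>j\<in>{j \<in> insert i I. l < j}. ?P l j) = (if l < i then ?P i l else 1) * (\<Prod>j\<in>{j \<in> I. l < j}. ?P l j)"
    if "l \<in> I" for l
  proof (cases "l < i")
    case True
    then have "{j \<in> insert i I. l < j} = insert i {j \<in> I. l < j}" by auto
    then show ?thesis using True assms by (simp add: pair_factor_commute[of t "x l"])
  next
    case False
    then have "{j \<in> insert i I. l < j} = {j \<in> I. l < j}" by auto
    then show ?thesis using False by simp
  qed
  have 3: "(\<Prod>j\<in>{j \<in> I. i < j}. ?P i j) * (\<Prod>l\<in>I. if l < i then ?P i l else 1) = (\<Prod>j\<in>I. ?P i j)"
  proof -
    have "(\<Prod>j\<in>{j \<in> I. i < j}. ?P i j) = (\<Prod>j\<in>I. if i < j then ?P i j else 1)"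
      using assms(1) by (simp add: prod.inter_filter)
    then show ?thesis
      using assms(3) by (simp only: prod.distrib[symmetric]) (auto intro!: prod.cong)
  qed
  have 4: "(\<Prod>j\<in>I. ?P i j) * (\<Prod>e\<in>E. pm_fac e (x i) / pm_fac (t * e) (x i)) =
    (\<Prod>k\<in>arg_ix I E. psi t (arg_val x k) (x i) * psi t (arg_val x k) (inverse (x i)))"
    unfolding prod_arg_ix[OF assms(1,2)]
    by (simp add: pair_factor_psi psi_def pm_fac_def)
  have "dens t (insert i I) E x = dens t I E x * (((\<Prod>j\<in>{j \<in> I. i < j}. ?P i j) * (\<Prod>l\<in>I. if l < i then ?P i l else 1)) *
      (\<Prod>e\<in>E. pm_fac e (x i) / pm_fac (t * e) (x i)) / pm_fac t ((x i)\<^sup>2))"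
  proof -
    have "(\<Prod>l\<in>insert i I. \<Prod>j\<in>{j \<in> insert i I. l < j}. ?P l j) =
      (\<Prod>j\<in>{j \<in> I. i < j}. ?P i j) * (\<Prod>l\<in>I. (if l < i then ?P i l else 1) * (\<Prod>j\<in>{j \<in> I. l < j}. ?P l j))"
      unfolding prod.insert[OF assms(1,3)] 1 by (intro arg_cong2[where f = "(*)"] prod.cong refl 2)
    then show ?thesis
      unfolding dens_def prod.insert[OF assms(1,3)] prod.distrib by (simp add: mult_ac)
  qed
  then show ?thesis unfolding 3 4 .
qed

lemma dens_insert_extra:
  assumes "finite I" "finite E" "e \<notin> E"
  shows "dens t I (insert e E) x = dens t I E x * (\<Prod>i\<in>I. pm_fac e (x i) / pm_fac (t * e) (x i))"
  using assms by (simp add: dens_def prod.distrib prod_dividef mult_ac)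

lemma dens_insert_extra_psi:
  assumes "finite I" "finite E" "e \<notin> E"
  shows "dens t I (insert e E) x = dens t I E x * (\<Prod>k\<in>arg_ix I {}. psi t (arg_val x k) e)"
  unfolding dens_insert_extra[OF assms] prod_arg_ix[OF assms(1) finite.emptyI]
  by (simp add: psi_def pm_fac_def mult_ac)

lemma one_minus_bound:
  assumes "norm (t::complex) < 1" "norm u = 1"
  shows "norm (1 - t * u) \<ge> 1 - norm t" "1 - t * u \<noteq> 0"
proof -
  have "norm (1::complex) - norm (t * u) \<le> norm (1 - t * u)" by (rule norm_triangle_ineq2)
  then show "norm (1 - t * u) \<ge> 1 - norm t" using assms by (simp add: norm_mult)
  then show "1 - t * u \<noteq> 0" using assms by auto
qed

lemma psi_bound:
  assumes "norm t < 1" "norm b = 1" "norm u = 1"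
  shows "norm (psi t b u) \<le> 2 / (1 - norm t)"
proof -
  have "norm (1 - b * u) \<le> norm (1::complex) + norm (b * u)" by (rule norm_triangle_ineq4)
  then have "norm (1 - b * u) \<le> 2" using assms by (simp add: norm_mult)
  moreover have "norm (1 - t * (b * u)) \<ge> 1 - norm t"
    using assms by (intro one_minus_bound) (auto simp: norm_mult)
  ultimately show ?thesis
    unfolding psi_def norm_divide using assms by (intro frac_le) (auto simp: mult.assoc)
qed

lemma dens_bounded:
  assumes "norm t < 1" "finite I" "E \<subseteq> {1, - 1}"
  obtains C where "\<And>x. (\<And>i. i \<in> I \<Longrightarrow> norm (x i) = 1) \<Longrightarrow> norm (dens t I E x) \<le> C"
proof -
  have fE: "finite E" using assms(3) finite_subset by auto
  have "\<exists>C. \<forall>x. (\<forall>i\<in>I. norm (x i) = 1) \<longrightarrow> norm (dens t I E x) \<le> C"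
    using assms(2)
  proof (induction I rule: finite_induct)
    case empty
    show ?case by (rule exI[of _ 1]) (simp add: dens_def)
  next
    case (insert i I)
    then obtain C where C: "\<And>x. \<forall>i\<in>I. norm (x i) = 1 \<Longrightarrow> norm (dens t I E x) \<le> C" by blast
    let ?c = "2 / (1 - norm t)" and ?n = "card (arg_ix I E)"
    have "1 \<le> ?c" using assms(1) order.trans[OF _ norm_ge_zero[of t], of "- 1"] by (simp add: le_divide_eq)
    then have c1: "1 \<le> ?c * ?c" using mult_mono[of 1 ?c 1 ?c] by linarith
    show ?case
    proof (intro exI[of _ "C * ((?c * ?c) ^ ?n / (1 - norm t)\<^sup>2)"] allI impI)
      fix x :: "nat \<Rightarrow> complex" assume x: "\<forall>i\<in>insert i I. norm (x i) = 1"
      have av: "norm (arg_val x k) = 1" if "k \<in> arg_ix I E" for k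
        using that x assms(3) by (cases rule: arg_ix_cases) (auto simp: norm_inverse)
      have "norm (\<Prod>k\<in>arg_ix I E. psi t (arg_val x k) (x i) * psi t (arg_val x k) (inverse (x i))) \<le> (?c * ?c) ^ ?n"
        unfolding prod_norm[symmetric]
      proof (rule prod_le_power)
        fix k assume k: "k \<in> arg_ix I E"
        show "0 \<le> norm (psi t (arg_val x k) (x i) * psi t (arg_val x k) (inverse (x i))) \<and>
           norm (psi t (arg_val x k) (x i) * psi t (arg_val x k) (inverse (x i))) \<le> ?c * ?c"
          unfolding norm_mult using x assms(1) av[OF k]
          by (intro conjI mult_mono psi_bound mult_nonneg_nonneg) (auto simp: norm_inverse)
      qed (use c1 in auto)
      moreover have "norm (pm_fac t ((x i)\<^sup>2)) \<ge> (1 - norm t)\<^sup>2"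
        unfolding pm_fac_def norm_mult power2_eq_square[of "1 - norm t"]
        using x assms(1) by (intro mult_mono one_minus_bound) (auto simp: norm_power norm_inverse)
      ultimately show "norm (dens t (insert i I) E x) \<le> C * ((?c * ?c) ^ ?n / (1 - norm t)\<^sup>2)"
        unfolding dens_insert[OF insert.hyps(1) fE insert.hyps(2)] norm_mult norm_divide
        using x assms(1) order.trans[OF norm_ge_zero C[of x]]
        by (intro mult_mono frac_le C) auto
    qed
  qed
  then show thesis using that by blast
qed

lemma hl_sum_measurable:
  assumes "finite K" "\<And>k. k \<in> K \<Longrightarrow> (\<lambda>x. z x k) \<in> borel_measurable M"
  shows "(\<lambda>x. hl_sum t ms (z x) K) \<in> borel_measurable M"
  using assms
proof (induction ms arbitrary: K)
  case (Cons m ms)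
  have IH: "(\<lambda>x. hl_sum t ms (z x) (K - {a})) \<in> borel_measurable M" for a
    using Cons.prems by (intro Cons.IH) auto
  show ?case
    unfolding hl_sum.simps
    by (intro borel_measurable_sum borel_measurable_times borel_measurable_prod
        borel_measurable_divide borel_measurable_diff borel_measurable_power borel_measurable_const
        Cons.prems(2) IH)
       (simp_all only: Diff_iff)
qed simp

lemma pm_fac_measurable [measurable]:
  assumes [measurable]: "f \<in> borel_measurable M"
  shows "(\<lambda>x. pm_fac c (f x)) \<in> borel_measurable M"
  unfolding pm_fac_def by measurable

lemma dens_measurable:
  assumes "finite I"
  shows "dens t I E \<in> borel_measurable (torus I)"
proof -
  show ?thesis
    unfolding dens_def[abs_def] pair_factor_def
    by (intro borel_measurable_times borel_measurable_prod borel_measurable_divide pm_fac_measurable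
        borel_measurable_power borel_measurable_inverse torus_component)
       (simp_all only: mem_Collect_eq)
qed

lemma hl_sum_arg_bounded:
  assumes "finite I" "E \<subseteq> {1, - 1}"
  obtains C where "\<And>x. generic I x \<Longrightarrow> norm (hl_sum t ms (arg_val x) (arg_ix I E)) \<le> C"
proof -
  have fE: "finite E" using assms(2) finite_subset by auto
  have sub: "arg_ix I {} \<subseteq> arg_ix I E" by (rule arg_ix_mono) auto
  have fin: "finite (arg_ix I E)" using assms fE by simp
  obtain C where C: "\<And>z. (\<And>k. k \<in> arg_ix I E - arg_ix I {} \<Longrightarrow> z k = arg_val undefined k) \<Longrightarrow>
    (\<And>k. k \<in> arg_ix I {} \<Longrightarrow> norm (z k) = 1) \<Longrightarrow>
    inj_on z (arg_ix I E) \<Longrightarrow> norm (hl_sum t ms z (arg_ix I E)) \<le> C"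
    by (rule hl_sum_bounded[OF fin sub, where c = "arg_val undefined" and t = t and ms = ms]) blast
  show thesis
  proof (rule that, rule C)
    fix x k assume g: "generic I x"
    show "inj_on (arg_val x) (arg_ix I E)" by (rule genericD(2)[OF g assms(2)])
    show "norm (arg_val x k) = 1" if "k \<in> arg_ix I {}"
      using that arg_ix_mono[of I I "{}" "{1, -1}"] by (intro genericD(3)[OF g]) auto
    show "arg_val x k = arg_val undefined k" if "k \<in> arg_ix I E - arg_ix I {}"
      using that by (auto elim!: arg_ix_cases)
  qed
qed

lemma integrable_torus:
  fixes f :: "(nat \<Rightarrow> complex) \<Rightarrow> complex"
  assumes "finite I" "f \<in> borel_measurable (torus I)" "\<And>x. generic I x \<Longrightarrow> norm (f x) \<le> C"
  shows "integrable (torus I) f"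
proof -
  interpret prob_space "torus I" by (rule prob_space_torus)
  show ?thesis
    by (rule integrable_const_bound[where B = C])
       (use AE_generic[OF assms(1)] assms in \<open>auto elim!: eventually_mono\<close>)
qed

section \<open>The terms of a single torus variable\<close>

text \<open>
  A uniform bound for the symmetrised integrand near \<open>x = \<plusminus>1\<close> needs a bound for \<open>g(x) - g(1/x)\<close> by
  \<open>\<bar>x - 1/x\<bar>\<close> that does not depend on the other variables; one constant for both bounds is enough.
\<close>

definition circle_Lipschitz :: "real \<Rightarrow> (complex \<Rightarrow> complex) \<Rightarrow> bool" where
  "circle_Lipschitz C h \<longleftrightarrow> (\<forall>u. norm u = 1 \<longrightarrow> norm (h u) \<le> C) \<and>
     (\<forall>u v. norm u = 1 \<longrightarrow> norm v = 1 \<longrightarrow> norm (h u - h v) \<le> C * norm (u - v))"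

lemma circle_Lipschitz_nonneg: "circle_Lipschitz C h \<Longrightarrow> C \<ge> 0"
  unfolding circle_Lipschitz_def using order.trans[OF norm_ge_zero, of "h 1" C] by (simp add: norm_one)

lemma circle_Lipschitz_mult:
  assumes "circle_Lipschitz A f" "circle_Lipschitz B g"
  shows "circle_Lipschitz (2 * (A * B)) (\<lambda>u. f u * g u)"
proof -
  have f: "norm u = 1 \<Longrightarrow> norm (f u) \<le> A"
    "norm u = 1 \<Longrightarrow> norm v = 1 \<Longrightarrow> norm (f u - f v) \<le> A * norm (u - v)" for u v
    using assms(1) by (auto simp: circle_Lipschitz_def)
  have g: "norm u = 1 \<Longrightarrow> norm (g u) \<le> B"
    "norm u = 1 \<Longrightarrow> norm v = 1 \<Longrightarrow> norm (g u - g v) \<le> B * norm (u - v)" for u v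
    using assms(2) by (auto simp: circle_Lipschitz_def)
  have A: "A \<ge> 0" and B: "B \<ge> 0" using assms by (auto dest: circle_Lipschitz_nonneg)
  show ?thesis
    unfolding circle_Lipschitz_def
  proof (intro conjI allI impI)
    fix u :: complex assume u: "norm u = 1"
    have "norm (f u * g u) \<le> A * B"
      unfolding norm_mult using A by (intro mult_mono f g u norm_ge_zero)
    also have "\<dots> \<le> 2 * (A * B)" using A B by simp
    finally show "norm (f u * g u) \<le> 2 * (A * B)" .
    fix v :: complex assume v: "norm v = 1"
    have "f u * g u - f v * g v = f u * (g u - g v) + (f u - f v) * g v"
      by (simp add: algebra_simps)
    also have "norm \<dots> \<le> norm (f u * (g u - g v)) + norm ((f u - f v) * g v)"
      by (rule norm_triangle_ineq)
    also have "\<dots> \<le> A * (B * norm (u - v)) + (A * norm (u - v)) * B"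
      unfolding norm_mult using A B
      by (intro add_mono mult_mono f g u v norm_ge_zero mult_nonneg_nonneg)
    also have "\<dots> = 2 * (A * B) * norm (u - v)" by simp
    finally show "norm (f u * g u - f v * g v) \<le> 2 * (A * B) * norm (u - v)" .
  qed
qed

lemma circle_Lipschitz_prod:
  assumes "finite B" "C \<ge> 0" "\<And>b. b \<in> B \<Longrightarrow> circle_Lipschitz C (h b)"
  shows "circle_Lipschitz ((2 * C) ^ card B) (\<lambda>u. \<Prod>b\<in>B. h b u)"
  using assms(1,3)
proof (induction B rule: finite_induct)
  case (insert b B)
  have "circle_Lipschitz (2 * (C * (2 * C) ^ card B)) (\<lambda>u. h b u * (\<Prod>b\<in>B. h b u))"
    by (rule circle_Lipschitz_mult) (use insert in auto)
  then show ?case using insert.hyps by (simp add: mult.assoc)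
qed (simp add: circle_Lipschitz_def)

lemma circle_Lipschitz_psi:
  assumes "norm t < 1" "norm b = 1"
  shows "circle_Lipschitz (2 / (1 - norm t)\<^sup>2) (psi t b)"
  unfolding circle_Lipschitz_def
proof (intro conjI allI impI)
  fix u :: complex assume u: "norm u = 1"
  have pos: "0 < 1 - norm t" "1 - norm t \<le> 1" using assms by auto
  have "norm (psi t b u) \<le> 2 / (1 - norm t)" by (rule psi_bound[OF assms u])
  also have "\<dots> \<le> 2 / (1 - norm t)\<^sup>2"
    using pos by (intro divide_left_mono) (auto simp: power2_eq_square mult_le_one intro!: mult_left_le)
  finally show "norm (psi t b u) \<le> 2 / (1 - norm t)\<^sup>2" .
  fix v :: complex assume v: "norm v = 1"
  have bu: "norm (b * u) = 1" "norm (b * v) = 1" using assms u v by (auto simp: norm_mult)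
  have nz: "1 - t * (b * u) \<noteq> 0" "1 - t * (b * v) \<noteq> 0"
    using one_minus_bound(2)[OF assms(1)] bu by auto
  have "psi t b u - psi t b v = b * (u - v) * (t - 1) / ((1 - t * (b * u)) * (1 - t * (b * v)))"
    unfolding psi_def mult.assoc using nz by (simp add: field_simps)
  also have "norm \<dots> \<le> norm (u - v) * 2 / ((1 - norm t) * (1 - norm t))"
    unfolding norm_divide norm_mult
    using assms bu pos one_minus_bound(1)[OF assms(1)] norm_triangle_ineq4[of t 1]
    by (intro frac_le mult_mono mult_nonneg_nonneg mult_pos_pos) auto
  finally show "norm (psi t b u - psi t b v) \<le> 2 / (1 - norm t)\<^sup>2 * norm (u - v)"
    by (simp add: power2_eq_square mult.commute)
qed

lemma circle_Lipschitz_square_factor: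
  assumes "norm t < 1"
  shows "circle_Lipschitz (2 / (1 - norm t)\<^sup>2) (\<lambda>u. 1 / (1 - t * u\<^sup>2))"
  unfolding circle_Lipschitz_def
proof (intro conjI allI impI)
  fix u :: complex assume u: "norm u = 1"
  have pos: "0 < 1 - norm t" "1 - norm t \<le> 1" using assms by auto
  have u2: "norm (u\<^sup>2) = 1" using u by (simp add: norm_power)
  have "norm (1 / (1 - t * u\<^sup>2)) \<le> 1 / (1 - norm t)"
    unfolding norm_divide using one_minus_bound[OF assms u2] pos by (intro frac_le) auto
  also have "\<dots> \<le> 2 / (1 - norm t)\<^sup>2"
    using pos by (intro frac_le) (auto simp: power2_eq_square mult_le_one intro!: mult_left_le)
  finally show "norm (1 / (1 - t * u\<^sup>2)) \<le> 2 / (1 - norm t)\<^sup>2" .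
  fix v :: complex assume v: "norm v = 1"
  have v2: "norm (v\<^sup>2) = 1" using v by (simp add: norm_power)
  have nz: "1 - t * u\<^sup>2 \<noteq> 0" "1 - t * v\<^sup>2 \<noteq> 0"
    using one_minus_bound(2)[OF assms] u2 v2 by auto
  have "1 / (1 - t * u\<^sup>2) - 1 / (1 - t * v\<^sup>2) = (u - v) * (t * (u + v)) / ((1 - t * u\<^sup>2) * (1 - t * v\<^sup>2))"
    using nz by (simp add: divide_simps) (simp add: algebra_simps power2_eq_square)
  also have "norm \<dots> \<le> norm (u - v) * (1 * 2) / ((1 - norm t) * (1 - norm t))"
    unfolding norm_divide norm_mult
    using assms pos one_minus_bound(1)[OF assms] u2 v2 norm_triangle_ineq[of u v] u v
    by (intro frac_le mult_mono mult_nonneg_nonneg mult_pos_pos) auto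
  finally show "norm (1 / (1 - t * u\<^sup>2) - 1 / (1 - t * v\<^sup>2)) \<le> 2 / (1 - norm t)\<^sup>2 * norm (u - v)"
    by (simp add: power2_eq_square mult.commute)
qed

lemma circle_Lipschitz_power: obtains C where "circle_Lipschitz C (\<lambda>u. u ^ m)"
  using poly_Lipschitz_unit_circle[of "monom 1 m"] unfolding circle_Lipschitz_def poly_monom mult_1
  by metis

lemma norm_inverse_diff:
  assumes "norm (u::complex) = 1" "norm v = 1"
  shows "norm (inverse u - inverse v) = norm (u - v)"
proof -
  have "inverse u - inverse v = inverse u * (v - u) * inverse v"
    using assms by (intro division_ring_inverse_diff) auto
  then show ?thesis using assms by (simp add: norm_mult norm_inverse norm_minus_commute)
qed

text \<open>
  The function \<open>g\<close> for which the part of the integrand with \<open>x\<close> in first position is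
  \<open>x\<^sup>2 g(x) / (x\<^sup>2 - 1)\<close>. The polynomial \<open>p\<close> is the symmetrised sum over the remaining exponents, as a
  function of the remaining argument \<open>1/x\<close>.
\<close>

definition residue_fun :: "complex \<Rightarrow> nat \<Rightarrow> complex poly \<Rightarrow> ('k \<Rightarrow> complex) \<Rightarrow> 'k set \<Rightarrow> complex \<Rightarrow> complex" where
  "residue_fun t m p z K u = u ^ m * poly p (inverse u) * ((\<Prod>b\<in>K. psi t (z b) u) * (1 / (1 - t * u\<^sup>2)))"

lemma residue_fun_Lipschitz:
  fixes S :: "complex set" and z :: "'k \<Rightarrow> complex"
  assumes "norm t < 1" "finite S" "card S = Suc M" "finite (K :: 'k set)"
  obtains G where "\<And>p z. degree p \<le> M \<Longrightarrow> (\<And>s. s \<in> S \<Longrightarrow> norm (poly p s) \<le> C) \<Longrightarrow>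
     (\<And>b. b \<in> K \<Longrightarrow> norm (z b) = 1) \<Longrightarrow> circle_Lipschitz G (residue_fun t m p z K)"
proof -
  obtain L where L: "\<And>p C u. degree p \<le> M \<Longrightarrow> (\<And>s. s \<in> S \<Longrightarrow> norm (poly p s) \<le> C) \<Longrightarrow> norm u = 1 \<Longrightarrow>
       norm (poly p u) \<le> C * L"
    "\<And>p C u v. degree p \<le> M \<Longrightarrow> (\<And>s. s \<in> S \<Longrightarrow> norm (poly p s) \<le> C) \<Longrightarrow> norm u = 1 \<Longrightarrow>
       norm v = 1 \<Longrightarrow> norm (poly p u - poly p v) \<le> C * L * norm (u - v)"
    using poly_bounds_from_nodes[OF assms(2,3)] by metis
  obtain B where B: "circle_Lipschitz B (\<lambda>u. u ^ m)" by (rule circle_Lipschitz_power)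
  let ?c = "2 / (1 - norm t)\<^sup>2"
  show thesis
  proof (rule that)
    fix p and z :: "'k \<Rightarrow> complex"
    assume p: "degree p \<le> M" "\<And>s. s \<in> S \<Longrightarrow> norm (poly p s) \<le> C" and z: "\<And>b. b \<in> K \<Longrightarrow> norm (z b) = 1"
    have "circle_Lipschitz (C * L) (\<lambda>u. poly p (inverse u))"
      unfolding circle_Lipschitz_def
    proof (intro conjI allI impI)
      fix u :: complex assume u: "norm u = 1"
      then have iu: "norm (inverse u) = 1" by (simp add: norm_inverse)
      show "norm (poly p (inverse u)) \<le> C * L" by (rule L(1)[OF p iu])
      fix v :: complex assume v: "norm v = 1"
      then have iv: "norm (inverse v) = 1" by (simp add: norm_inverse)
      show "norm (poly p (inverse u) - poly p (inverse v)) \<le> C * L * norm (u - v)"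
        using L(2)[OF p iu iv] unfolding norm_inverse_diff[OF u v] .
    qed
    then show "circle_Lipschitz (2 * ((2 * (B * (C * L))) * (2 * ((2 * ?c) ^ card K * ?c)))) (residue_fun t m p z K)"
      unfolding residue_fun_def[abs_def]
      using assms z by (intro circle_Lipschitz_mult B circle_Lipschitz_prod circle_Lipschitz_psi
          circle_Lipschitz_square_factor) auto
  qed
qed

text \<open>
  The powers of \<open>1/u\<close> in \<open>p\<close> are absorbed by \<open>u\<^sup>m\<close>: this is where the first exponent has to be the
  largest. All other singularities lie outside the unit disc because \<open>\<bar>t\<bar> < 1\<close>.
\<close>

lemma residue_fun_holomorphic:
  assumes "norm t < 1" "degree p \<le> m" "finite K" "\<And>b. b \<in> K \<Longrightarrow> norm (z b) = 1"
  obtains g R where "g holomorphic_on ball 0 R" "R > 1" "\<And>u. u \<noteq> 0 \<Longrightarrow> g u = residue_fun t m p z K u"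
proof -
  define g where "g u = (\<Sum>j\<le>m. coeff p j * u ^ (m - j)) * ((\<Prod>b\<in>K. psi t (z b) u) * (1 / (1 - t * u\<^sup>2)))" for u
  \<comment> \<open>any radius with \<open>R > 1\<close> and \<open>\<bar>t\<bar> R\<^sup>2 < 1\<close> will do\<close>
  define R where "R = sqrt (2 / (1 + norm t))"
  have R2: "R\<^sup>2 = 2 / (1 + norm t)" by (simp add: R_def add_nonneg_nonneg)
  have R1: "R > 1"
    unfolding R_def using assms(1) by (intro real_less_rsqrt) (simp add: add_pos_nonneg less_divide_eq)
  have tR: "norm t * R\<^sup>2 < 1"
    unfolding R2 using assms(1) by (simp add: add_pos_nonneg divide_less_eq)
  have nz2: "1 - t * u\<^sup>2 \<noteq> 0" if "u \<in> ball 0 R" for u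
  proof
    assume "1 - t * u\<^sup>2 = 0"
    then have "norm (t * u\<^sup>2) = 1" by (metis eq_iff_diff_eq_0 norm_one)
    moreover have "norm (t * u\<^sup>2) \<le> norm t * R\<^sup>2"
      using that by (auto simp: norm_mult norm_power intro!: mult_left_mono power_mono)
    ultimately show False using tR by simp
  qed
  have nz1: "1 - t * z b * u \<noteq> 0" if "u \<in> ball 0 R" "b \<in> K" for u b
  proof
    assume "1 - t * z b * u = 0"
    then have "norm (t * z b * u) = 1" by (metis eq_iff_diff_eq_0 norm_one)
    moreover have "norm (t * z b * u) \<le> norm t * R"
      using that assms(4) by (auto simp: norm_mult intro!: mult_left_mono)
    moreover have "norm t * R \<le> norm t * R\<^sup>2"
      using R1 by (intro mult_left_mono) (auto simp: power2_eq_square)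
    ultimately show False using tR by simp
  qed
  show thesis
  proof (rule that[OF _ R1])
    show "g holomorphic_on ball 0 R"
      unfolding g_def psi_def using nz1 nz2 by (intro holomorphic_intros) auto
    fix u :: complex assume u: "u \<noteq> 0"
    have "poly p w = (\<Sum>j\<le>m. coeff p j * w ^ j)" for w
      unfolding poly_altdef using assms(2)
      by (intro sum.mono_neutral_left) (auto simp: coeff_eq_0)
    then have "u ^ m * poly p (inverse u) = (\<Sum>j\<le>m. coeff p j * (u ^ m * inverse u ^ j))"
      by (simp only: sum_distrib_left mult.left_commute)
    also have "\<dots> = (\<Sum>j\<le>m. coeff p j * u ^ (m - j))"
    proof (intro sum.cong refl)
      fix j assume "j \<in> {..m}"
      then have "u ^ m = u ^ (m - j) * u ^ j" by (simp flip: power_add)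
      moreover have "u ^ j * inverse u ^ j = 1" using u by (simp flip: power_mult_distrib)
      ultimately show "coeff p j * (u ^ m * inverse u ^ j) = coeff p j * u ^ (m - j)"
        by (simp add: mult.assoc)
    qed
    finally show "g u = residue_fun t m p z K u" by (simp add: g_def residue_fun_def)
  qed
qed

definition hl_term :: "complex \<Rightarrow> nat \<Rightarrow> nat list \<Rightarrow> ('k \<Rightarrow> complex) \<Rightarrow> 'k set \<Rightarrow> 'k \<Rightarrow> complex" where
  "hl_term t m ms z K a = z a ^ m * (\<Prod>b\<in>K - {a}. (z a - t * z b) / (z a - z b)) * hl_sum t ms z (K - {a})"

text \<open>
  The two arguments \<open>x\<^sub>i\<close> and \<open>1/x\<^sub>i\<close> have to be kept together, since each of the two terms alone
  has poles on the torus.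
\<close>

definition var_term :: "complex \<Rightarrow> nat \<Rightarrow> nat list \<Rightarrow> nat set \<Rightarrow> complex set \<Rightarrow> nat \<Rightarrow> (nat \<Rightarrow> complex) \<Rightarrow> complex" where
  "var_term t m ms I E i x =
     (hl_term t m ms (arg_val x) (arg_ix I E) (Inl (i, True)) +
      hl_term t m ms (arg_val x) (arg_ix I E) (Inl (i, False))) * dens t I E x"

text \<open>
  When \<open>u\<close> is the first argument, its factors \<open>(u - t b) / (u - b)\<close> cancel half of the factors of the
  density that involve \<open>u\<close>. What remains has no poles in the closed unit disc except at \<open>u = \<plusminus>1\<close>.
\<close>

lemma half_term:
  fixes z :: "'k \<Rightarrow> complex"
  assumes t: "norm t < 1" and u: "norm u = 1" "u\<^sup>2 \<noteq> 1" and K: "finite K" "\<And>b. b \<in> K \<Longrightarrow> norm (z b) = 1" "u \<notin> z ` K"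
  shows "u ^ m * ((u - t * inverse u) / (u - inverse u) * (\<Prod>b\<in>K. (u - t * z b) / (u - z b))) * poly p (inverse u) *
      ((\<Prod>b\<in>K. psi t (z b) u * psi t (z b) (inverse u)) / pm_fac t (u\<^sup>2)) =
     u\<^sup>2 / (u\<^sup>2 - 1) * residue_fun t m p z K u"
proof -
  have u0: "u \<noteq> 0" using u by auto
  have cancel: "(u - t * z b) / (u - z b) * psi t (z b) (inverse u) = 1" if "b \<in> K" for b
  proof -
    have "u \<noteq> z b" using K(3) that by auto
    then have A: "1 - z b * inverse u \<noteq> 0" using u0 by (simp add: divide_inverse[symmetric])
    have "norm (z b * inverse u) = 1" using u(1) K(2)[OF that] by (simp add: norm_mult norm_inverse)
    then have B: "1 - t * (z b * inverse u) \<noteq> 0" by (rule one_minus_bound(2)[OF t])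
    have e1: "u - t * z b = u * (1 - t * (z b * inverse u))" and e2: "u - z b = u * (1 - z b * inverse u)"
      using u0 by (simp_all add: right_diff_distrib)
    have "(u * w) / (u * v) * (v / w) = 1" if "v \<noteq> 0" "w \<noteq> 0" for v w
      using that u0 by simp
    from this[OF A B] show ?thesis unfolding psi_def mult.assoc e1 e2 .
  qed
  have 1: "(\<Prod>b\<in>K. (u - t * z b) / (u - z b)) * (\<Prod>b\<in>K. psi t (z b) (inverse u)) = 1"
    unfolding prod.distrib[symmetric] by (intro prod.neutral ballI cancel)
  have n2: "norm (u\<^sup>2) = 1" using u by (simp add: norm_power)
  then have "norm (inverse (u\<^sup>2)) = 1" by (simp add: norm_inverse)
  then have nz: "1 - t * u\<^sup>2 \<noteq> 0" "1 - t * inverse (u\<^sup>2) \<noteq> 0" "u\<^sup>2 - 1 \<noteq> 0"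
    using one_minus_bound(2)[OF t n2] one_minus_bound(2)[OF t] u(2) by (blast, blast, simp)
  have e1: "u - t * inverse u = u * (1 - t * inverse (u\<^sup>2))"
    using u0 by (simp add: power2_eq_square algebra_simps)
  have e2: "u - inverse u = (u\<^sup>2 - 1) / u"
    using u0 by (simp add: power2_eq_square diff_divide_distrib divide_inverse[of 1])
  have "(u * r) / (w / u) / (q * r) = u\<^sup>2 / w * (1 / q)" if "q \<noteq> 0" "r \<noteq> 0" "w \<noteq> 0" for q r w
    using that u0 by (simp add: power2_eq_square)
  from this[OF nz] have 2: "(u - t * inverse u) / (u - inverse u) / pm_fac t (u\<^sup>2) = u\<^sup>2 / (u\<^sup>2 - 1) * (1 / (1 - t * u\<^sup>2))"
    unfolding pm_fac_def e1 e2 .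
  have "u ^ m * ((u - t * inverse u) / (u - inverse u) * (\<Prod>b\<in>K. (u - t * z b) / (u - z b))) * poly p (inverse u) *
      ((\<Prod>b\<in>K. psi t (z b) u * psi t (z b) (inverse u)) / pm_fac t (u\<^sup>2)) =
    ((\<Prod>b\<in>K. (u - t * z b) / (u - z b)) * (\<Prod>b\<in>K. psi t (z b) (inverse u))) *
    ((u - t * inverse u) / (u - inverse u) / pm_fac t (u\<^sup>2)) * (u ^ m * poly p (inverse u) * (\<Prod>b\<in>K. psi t (z b) u))"
    by (simp only: prod.distrib divide_inverse mult_ac)
  then show ?thesis unfolding 1 2 residue_fun_def by (simp only: mult_1 mult_ac)
qed

lemma var_term_section:
  assumes t: "norm t < 1" and I: "finite I" "i \<notin> I" "E \<subseteq> {1, - 1}" and y: "generic I y"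
    and ms: "\<And>n. n \<in> set ms \<Longrightarrow> n \<le> m"
  obtains p where "degree p \<le> m"
    "\<And>k0 z. k0 \<notin> arg_ix I E \<Longrightarrow> (\<And>k. k \<in> arg_ix I E \<Longrightarrow> z k = arg_val y k) \<Longrightarrow>
       z k0 \<notin> arg_val y ` arg_ix I E \<Longrightarrow> hl_sum t ms z (insert k0 (arg_ix I E)) = poly p (z k0)"
    "\<And>x. norm x = 1 \<Longrightarrow> x \<notin> arg_val y ` arg_ix I {1, - 1} \<Longrightarrow>
       var_term t m ms (insert i I) E i (y(i := x)) = dens t I E y *
         ((x\<^sup>2 * residue_fun t m p (arg_val y) (arg_ix I E) x -
           residue_fun t m p (arg_val y) (arg_ix I E) (inverse x)) / (x\<^sup>2 - 1))"
proof -
  let ?K = "arg_ix I E" and ?z = "arg_val y"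
  have fE: "finite E" using I(3) finite_subset by auto
  have fK: "finite ?K" using I fE by simp
  have sub: "?K \<subseteq> arg_ix I {1, - 1}" using I(3) by (intro arg_ix_mono) auto
  obtain p where p: "degree p \<le> m"
    "\<And>k0 z. k0 \<notin> ?K \<Longrightarrow> (\<And>k. k \<in> ?K \<Longrightarrow> z k = ?z k) \<Longrightarrow> z k0 \<notin> ?z ` ?K \<Longrightarrow>
       hl_sum t ms z (insert k0 ?K) = poly p (z k0)"
    using hl_sum_poly_any_index[OF fK genericD(2)[OF y I(3)] infinite_arg_index ms, where t = t] by metis
  show thesis
  proof (rule that[OF p])
    fix x :: complex assume x: "norm x = 1" "x \<notin> ?z ` arg_ix I {1, - 1}"
    let ?x = "y(i := x)" and ?K' = "arg_ix (insert i I) E"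
    let ?W = "(\<Prod>k\<in>?K. psi t (?z k) x * psi t (?z k) (inverse x)) / pm_fac t (x\<^sup>2)"
    let ?g = "residue_fun t m p ?z ?K"
    have x0: "x \<noteq> 0" using x by auto
    have "e \<in> ?z ` arg_ix I {1, - 1}" if "e \<in> {1, - 1}" for e
      using that by (intro image_eqI[of _ _ "Inr e"]) auto
    then have xpm: "x \<noteq> 1" "x \<noteq> - 1" using x(2) by auto
    then have x2: "x\<^sup>2 \<noteq> 1" by (simp add: power2_eq_1_iff)
    have norm1: "norm (?z b) = 1" if "b \<in> ?K" for b
      using genericD(3)[OF y] that sub by auto
    have xK: "x \<notin> ?z ` ?K" using x(2) sub by auto
    have xK': "inverse x \<notin> ?z ` ?K"
    proof
      assume "inverse x \<in> ?z ` ?K"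
      then obtain k where k: "k \<in> ?K" "inverse x = ?z k" by auto
      from k(1) have "x \<in> ?z ` arg_ix I {1, - 1}"
      proof (cases rule: arg_ix_cases)
        case (1 j b)
        then have "?z (Inl (j, \<not> b)) = x" using k(2) inverse_inverse_eq[of x] by (cases b) auto
        then show ?thesis using 1 by (intro image_eqI[of _ _ "Inl (j, \<not> b)"]) auto
      next
        case (2 e)
        then have "inverse e = e" using I(3) by auto
        then have "x = e" using k(2) 2(1) by (metis arg_val.simps(2) inverse_inverse_eq)
        then show ?thesis using 2 I(3) by (intro image_eqI[of _ _ "Inr e"]) auto
      qed
      then show False using x(2) by simp
    qed
    have av: "arg_val ?x b = ?z b" if "b \<in> ?K" for b
      using arg_val_upd[OF I(2) that] .
    have notin: "Inl (i, b) \<notin> ?K" for b using I(2) by simp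
    have rem: "?K' - {Inl (i, b)} = insert (Inl (i, \<not> b)) ?K" for b
      using I(2) unfolding arg_ix_insert by (cases b) auto
    have D: "dens t (insert i I) E ?x = dens t I E y *
      ?W"
    proof -
      have "dens t I E ?x = dens t I E y"
        unfolding dens_def using I(2) by (intro arg_cong2[where f = "(*)"] prod.cong) auto
      moreover have "(\<Prod>k\<in>?K. psi t (arg_val ?x k) (?x i) * psi t (arg_val ?x k) (inverse (?x i))) =
         (\<Prod>k\<in>?K. psi t (?z k) x * psi t (?z k) (inverse x))"
        by (intro prod.cong refl) (simp add: av)
      ultimately show ?thesis
        using dens_insert[OF I(1) fE I(2), of t ?x] by simp
    qed
    have T: "hl_term t m ms (arg_val ?x) ?K' (Inl (i, b)) * ?W =
        u\<^sup>2 / (u\<^sup>2 - 1) * ?g u"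
      if u: "u = (if b then x else inverse x)" for u b
    proof -
      have hs: "hl_sum t ms (arg_val ?x) (insert (Inl (i, \<not> b)) ?K) = poly p (inverse u)"
      proof -
        have "arg_val ?x (Inl (i, \<not> b)) = inverse u" using u by simp
        then show ?thesis
          using p(2)[OF notin[of "\<not> b"] av] xK xK' u by (cases b) simp_all
      qed
      have u1: "norm u = 1" "u\<^sup>2 \<noteq> 1" "u \<notin> ?z ` ?K"
        using x(1) x2 xK xK' u by (cases b; simp add: norm_inverse power_inverse)+
      have pr: "(\<Prod>k\<in>insert (Inl (i, \<not> b)) ?K. (u - t * arg_val ?x k) / (u - arg_val ?x k)) =
          (u - t * inverse u) / (u - inverse u) * (\<Prod>k\<in>?K. (u - t * ?z k) / (u - ?z k))"
      proof -
        have "arg_val ?x (Inl (i, \<not> b)) = inverse u" using u by simp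
        moreover have "(\<Prod>k\<in>?K. (u - t * arg_val ?x k) / (u - arg_val ?x k)) = (\<Prod>k\<in>?K. (u - t * ?z k) / (u - ?z k))"
          by (intro prod.cong refl) (simp only: av)
        ultimately show ?thesis unfolding prod.insert[OF fK notin] by (simp only:)
      qed
      have sym: "(\<Prod>k\<in>?K. psi t (?z k) x * psi t (?z k) (inverse x)) = (\<Prod>k\<in>?K. psi t (?z k) u * psi t (?z k) (inverse u))"
        "pm_fac t (x\<^sup>2) = pm_fac t (u\<^sup>2)"
        using u by (cases b; simp add: mult.commute pm_fac_def power_inverse)+
      have "arg_val ?x (Inl (i, b)) = u" using u by simp
      then show ?thesis
        unfolding hl_term_def rem hs sym by (simp only: pr half_term[OF t u1(1,2) fK norm1 u1(3)])
    qed
    have alg: "(A + B) * (d * q) = d * (A * q + B * q)" for A B d q :: complex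
      by (simp add: algebra_simps)
    have "var_term t m ms (insert i I) E i ?x = dens t I E y *
      (hl_term t m ms (arg_val ?x) ?K' (Inl (i, True)) * ?W +
       hl_term t m ms (arg_val ?x) ?K' (Inl (i, False)) * ?W)"
      unfolding var_term_def D by (rule alg)
    also have "\<dots> = dens t I E y * (x\<^sup>2 / (x\<^sup>2 - 1) * ?g x +
       (inverse x)\<^sup>2 / ((inverse x)\<^sup>2 - 1) * ?g (inverse x))"
      by (simp only: T[of x True] T[of "inverse x" False] if_True if_False)
    also have "(inverse x)\<^sup>2 / ((inverse x)\<^sup>2 - 1) = - (1 / (x\<^sup>2 - 1))"
    proof -
      have "(inverse x)\<^sup>2 - 1 = - ((x\<^sup>2 - 1) * (inverse x)\<^sup>2)"
        using x0 by (simp add: field_simps power2_eq_square)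
      then show ?thesis using x0 x2 by simp
    qed
    finally show "var_term t m ms (insert i I) E i ?x = dens t I E y *
         ((x\<^sup>2 * ?g x - ?g (inverse x)) / (x\<^sup>2 - 1))"
      unfolding diff_divide_distrib by (simp only: mult_minus_left mult_1 times_divide_eq_left diff_conv_add_uminus)
  qed
qed

section \<open>Integrating out one variable\<close>

lemma var_term_bounded:
  assumes t: "norm t < 1" and I: "finite I" "i \<notin> I" "E \<subseteq> {1, - 1}" and ms: "\<And>n. n \<in> set ms \<Longrightarrow> n \<le> m"
  obtains C where "\<And>x. generic (insert i I) x \<Longrightarrow> norm (var_term t m ms (insert i I) E i x) \<le> C"
proof -
  let ?v = "var_term t m ms (insert i I) E i"
  let ?K = "arg_ix I E" and ?k0 = "Inl (i, False) :: arg_index"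
  have fE: "finite E" using I(3) finite_subset by auto
  have fK: "finite ?K" using I fE by simp
  have sub: "?K \<subseteq> arg_ix I {1, - 1}" using I(3) by (intro arg_ix_mono) auto
  obtain S :: "complex set" where S: "finite S" "card S = Suc m" "\<And>s. s \<in> S \<Longrightarrow> norm s > 1" "S \<inter> {} = {}"
    by (rule interpolation_nodes[of "{}" m]) auto
  have "\<exists>C. \<forall>z. (\<forall>k\<in>insert ?k0 ?K - arg_ix I {}. z k = (if k = ?k0 then s else arg_val undefined k)) \<longrightarrow>
      (\<forall>k\<in>arg_ix I {}. norm (z k) = 1) \<longrightarrow> inj_on z (insert ?k0 ?K) \<longrightarrow>
      norm (hl_sum t ms z (insert ?k0 ?K)) \<le> C" for s
  proof -
    have "finite (insert ?k0 ?K)" "arg_ix I {} \<subseteq> insert ?k0 ?K"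
      using fK arg_ix_mono[of I I "{}" E] by auto
    from hl_sum_bounded[OF this, where c = "\<lambda>k. if k = ?k0 then s else arg_val undefined k" and t = t and ms = ms]
    show ?thesis by metis
  qed
  then obtain C where C: "\<And>s z. (\<And>k. k \<in> insert ?k0 ?K - arg_ix I {} \<Longrightarrow> z k = (if k = ?k0 then s else arg_val undefined k)) \<Longrightarrow>
      (\<And>k. k \<in> arg_ix I {} \<Longrightarrow> norm (z k) = 1) \<Longrightarrow> inj_on z (insert ?k0 ?K) \<Longrightarrow>
      norm (hl_sum t ms z (insert ?k0 ?K)) \<le> C s"
    by metis
  define B where "B = (\<Sum>s\<in>S. \<bar>C s\<bar>)"
  have CB: "C s \<le> B" if "s \<in> S" for s
    unfolding B_def using member_le_sum[of s S "\<lambda>s. \<bar>C s\<bar>"] S(1) that by auto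
  obtain G where G: "\<And>p z. degree p \<le> m \<Longrightarrow> (\<And>s. s \<in> S \<Longrightarrow> norm (poly p s) \<le> B) \<Longrightarrow>
     (\<And>b. b \<in> ?K \<Longrightarrow> norm (z b) = 1) \<Longrightarrow> circle_Lipschitz G (residue_fun t m p z ?K)"
    using residue_fun_Lipschitz[OF t S(1,2) fK, where m = m and C = B] by metis
  obtain D where D: "\<And>x. (\<And>i. i \<in> I \<Longrightarrow> norm (x i) = 1) \<Longrightarrow> norm (dens t I E x) \<le> D"
    using dens_bounded[OF t I(1,3)] by metis
  show thesis
  proof (rule that)
    fix x assume x: "generic (insert i I) x"
    have y: "generic I x" by (rule genericD(4)[OF x]) auto
    have n1: "norm (arg_val x b) = 1" if "b \<in> ?K" for b
      using genericD(3)[OF y] sub that by auto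
    obtain p where p: "degree p \<le> m"
      "\<And>k0 z. k0 \<notin> ?K \<Longrightarrow> (\<And>k. k \<in> ?K \<Longrightarrow> z k = arg_val x k) \<Longrightarrow>
         z k0 \<notin> arg_val x ` ?K \<Longrightarrow> hl_sum t ms z (insert k0 ?K) = poly p (z k0)"
      "\<And>u. norm u = 1 \<Longrightarrow> u \<notin> arg_val x ` arg_ix I {1, - 1} \<Longrightarrow>
       ?v (x(i := u)) = dens t I E x *
         ((u\<^sup>2 * residue_fun t m p (arg_val x) ?K u - residue_fun t m p (arg_val x) ?K (inverse u)) / (u\<^sup>2 - 1))"
      using var_term_section[OF t I y ms] by metis
    \<comment> \<open>at a node, \<open>p\<close> is a symmetrised sum with one argument fixed at the node, which is bounded uniformly in \<open>x\<close>\<close>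
    have nodes: "norm (poly p s) \<le> B" if s: "s \<in> S" for s
    proof -
      let ?z = "(arg_val x)(?k0 := s)"
      have k0: "?k0 \<notin> ?K" using I(2) by simp
      have eq: "?z k = arg_val x k" if "k \<in> ?K" for k using that k0 by auto
      have snot: "s \<notin> arg_val x ` ?K" using n1 S(3)[OF s] by force
      have "poly p s = hl_sum t ms ?z (insert ?k0 ?K)"
      proof -
        have "hl_sum t ms ?z (insert ?k0 ?K) = poly p (?z ?k0)"
          by (rule p(2)[OF k0 eq]) (use snot in simp_all)
        then show ?thesis by (simp only: fun_upd_same)
      qed
      also have "norm \<dots> \<le> C s"
      proof (rule C)
        show "?z k = (if k = ?k0 then s else arg_val undefined k)" if "k \<in> insert ?k0 ?K - arg_ix I {}" for k
          using that I(2) by (auto elim!: arg_ix_cases)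
        show "norm (?z k) = 1" if "k \<in> arg_ix I {}" for k
        proof -
          have "k \<in> ?K" using that arg_ix_mono[of I I "{}" E] by auto
          then show ?thesis using eq[of k] n1[of k] by (simp only:)
        qed
        have "inj_on ?z ?K"
          using genericD(2)[OF y I(3)] eq by (simp add: inj_on_def)
        moreover have "?z ?k0 \<notin> ?z ` ?K"
        proof -
          have "?z ` ?K = arg_val x ` ?K" by (rule image_cong[OF refl eq])
          then show ?thesis using snot by (simp only: fun_upd_same not_False_eq_True)
        qed
        ultimately show "inj_on ?z (insert ?k0 ?K)" using k0 by (simp add: inj_on_insert)
      qed
      finally show ?thesis using CB[OF s] by simp
    qed
    let ?u = "x i" and ?g = "residue_fun t m p (arg_val x) ?K"
    have L: "circle_Lipschitz G ?g" by (rule G[OF p(1) nodes n1])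
    have u: "norm ?u = 1" using genericD(1)[OF x] by simp
    have iu: "norm (inverse ?u) = 1" using u by (simp add: norm_inverse)
    have inj: "inj_on (arg_val x) (arg_ix (insert i I) {1, - 1})" by (rule genericD(2)[OF x]) simp
    have unot: "?u \<notin> arg_val x ` arg_ix I {1, - 1}"
    proof
      assume "?u \<in> arg_val x ` arg_ix I {1, - 1}"
      then obtain k where k: "k \<in> arg_ix I {1, - 1}" "arg_val x (Inl (i, True)) = arg_val x k" by auto
      then have "Inl (i, True) = k"
        using subsetD[OF arg_ix_mono[of I "insert i I" "{1, - 1}" "{1, - 1}"] k(1)]
        by (intro inj_onD[OF inj k(2)]) auto
      then show False using k(1) I(2) by auto
    qed
    have "?u \<noteq> 1" "?u \<noteq> - 1"
      using unot image_eqI[of "?u" "arg_val x" "Inr ?u" "arg_ix I {1, - 1}"] by auto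
    then have u2: "?u\<^sup>2 - 1 \<noteq> 0" by (simp add: power2_eq_1_iff)
    have "norm (?u\<^sup>2 * ?g ?u - ?g (inverse ?u)) \<le> 2 * G * norm (?u\<^sup>2 - 1)"
    proof -
      have "?u - inverse ?u = inverse ?u * (?u\<^sup>2 - 1)"
        using u by (cases "?u = 0") (auto simp: power2_eq_square algebra_simps)
      then have e: "norm (?u - inverse ?u) = norm (?u\<^sup>2 - 1)" using iu by (simp add: norm_mult)
      have "?u\<^sup>2 * ?g ?u - ?g (inverse ?u) = (?u\<^sup>2 - 1) * ?g ?u + (?g ?u - ?g (inverse ?u))"
        by (simp add: algebra_simps)
      also have "norm \<dots> \<le> norm (?u\<^sup>2 - 1) * norm (?g ?u) + norm (?g ?u - ?g (inverse ?u))"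
        unfolding norm_mult[symmetric] by (rule norm_triangle_ineq)
      also have "\<dots> \<le> norm (?u\<^sup>2 - 1) * G + G * norm (?u\<^sup>2 - 1)"
        using L u iu unfolding circle_Lipschitz_def
        by (intro add_mono mult_left_mono) (auto simp flip: e)
      finally show ?thesis by simp
    qed
    then have 1: "norm ((?u\<^sup>2 * ?g ?u - ?g (inverse ?u)) / (?u\<^sup>2 - 1)) \<le> 2 * G"
      using u2 by (simp add: norm_divide divide_le_eq)
    have "?v (x(i := ?u)) = dens t I E x *
         ((?u\<^sup>2 * ?g ?u - ?g (inverse ?u)) / (?u\<^sup>2 - 1))"
      by (rule p(3)[OF u unot])
    then have "norm (?v x) =
        norm (dens t I E x) * norm ((?u\<^sup>2 * ?g ?u - ?g (inverse ?u)) / (?u\<^sup>2 - 1))"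
      by (simp only: fun_upd_triv norm_mult)
    also have "\<dots> \<le> D * (2 * G)"
      using genericD(1)[OF y] D[of x]
      by (intro mult_mono 1 D order.trans[OF norm_ge_zero D]) auto
    finally show "norm (?v x) \<le> D * (2 * G)" .
  qed
qed

lemma var_term_measurable:
  assumes "finite I" "finite E" "i \<in> I"
  shows "var_term t m ms I E i \<in> borel_measurable (torus I)"
proof -
  have fK: "finite (arg_ix I E)" using assms by simp
  have av: "(\<lambda>x. arg_val x k) \<in> borel_measurable (torus I)" if "k \<in> arg_ix I E" for k
    using that by (rule arg_val_measurable)
  have hs: "(\<lambda>x. hl_sum t ms (arg_val x) (arg_ix I E - {a})) \<in> borel_measurable (torus I)" for a
    by (rule hl_sum_measurable) (use fK av in auto)
  have "(\<lambda>x. hl_term t m ms (arg_val x) (arg_ix I E) (Inl (i, b))) \<in> borel_measurable (torus I)" for b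
    unfolding hl_term_def
    by (intro borel_measurable_times borel_measurable_prod borel_measurable_divide borel_measurable_diff
        borel_measurable_power borel_measurable_const hs av) (use assms in \<open>simp_all only: Diff_iff in_arg_ix\<close>)
  then show ?thesis
    unfolding var_term_def[abs_def]
    by (intro borel_measurable_times borel_measurable_add dens_measurable assms)
qed

text \<open>
  The function \<open>f\<close> will be 1 or a product of linear factors over all arguments.
\<close>

definition hl_int :: "complex \<Rightarrow> nat set \<Rightarrow> complex set \<Rightarrow> ((nat \<Rightarrow> complex) \<Rightarrow> complex) \<Rightarrow> nat list \<Rightarrow> complex" where
  "hl_int t I E f ms = (LINT x|torus I. hl_sum t ms (arg_val x) (arg_ix I E) * f x * dens t I E x)"

lemma integrable_hl_int:
  assumes "norm t < 1" "finite I" "E \<subseteq> {1, - 1}" "f \<in> borel_measurable (torus I)"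
    "\<And>x. generic I x \<Longrightarrow> norm (f x) \<le> B"
  shows "integrable (torus I) (\<lambda>x. hl_sum t ms (arg_val x) (arg_ix I E) * f x * dens t I E x)"
proof -
  have fE: "finite E" using assms(3) finite_subset by auto
  obtain C where C: "\<And>x. generic I x \<Longrightarrow> norm (hl_sum t ms (arg_val x) (arg_ix I E)) \<le> C"
    using hl_sum_arg_bounded[OF assms(2,3)] by metis
  obtain D where D: "\<And>x. (\<And>i. i \<in> I \<Longrightarrow> norm (x i) = 1) \<Longrightarrow> norm (dens t I E x) \<le> D"
    using dens_bounded[OF assms(1,2,3)] by metis
  show ?thesis
  proof (rule integrable_torus[OF assms(2)])
    show "(\<lambda>x. hl_sum t ms (arg_val x) (arg_ix I E) * f x * dens t I E x) \<in> borel_measurable (torus I)"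
      using assms(2) fE by (intro borel_measurable_times hl_sum_measurable arg_val_measurable dens_measurable assms(4)) auto
    fix x assume x: "generic I x"
    show "norm (hl_sum t ms (arg_val x) (arg_ix I E) * f x * dens t I E x) \<le> C * B * D"
      unfolding norm_mult
      using C[OF x] assms(5)[OF x] D[of x] genericD(1)[OF x]
      by (intro mult_mono mult_nonneg_nonneg) (auto intro: order.trans[OF norm_ge_zero])
  qed
qed

text \<open>
  Integrating one variable replaces it by its residues at \<open>\<plusminus>1\<close>, and up to a constant the residue at \<open>e\<close> is the
  integrand with one variable less and the extra argument \<open>e\<close>. If \<open>e\<close> is already an extra argument, the
  factor \<open>psi t e e = 0\<close> removes the pole.
\<close>

lemma integral_var_term:
  assumes t: "norm t < 1" and I: "finite I" "i \<notin> I" "E \<subseteq> {1, - 1}" and ms: "\<And>n. n \<in> set ms \<Longrightarrow> n \<le> m"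
  shows "(LINT x|torus (insert i I). var_term t m ms (insert i I) E i x) =
    (\<Sum>e\<in>{1, - 1} - E. e ^ m * (\<Prod>e'\<in>E. psi t e' e) / (2 * (1 - t)) * hl_int t I (insert e E) (\<lambda>_. 1) ms)"
proof -
  let ?v = "var_term t m ms (insert i I) E i"
  let ?K = "arg_ix I E"
  have fE: "finite E" using I(3) finite_subset by auto
  have fK: "finite ?K" using I fE by simp
  have sub: "?K \<subseteq> arg_ix I {1, - 1}" using I(3) by (intro arg_ix_mono) auto
  have meas: "?v \<in> borel_measurable (torus (insert i I))"
    by (rule var_term_measurable) (use I fE in auto)
  obtain C where "\<And>x. generic (insert i I) x \<Longrightarrow> norm (?v x) \<le> C"
    using var_term_bounded[OF t I ms] by metis
  then have int: "integrable (torus (insert i I)) (?v)"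
    using I meas by (intro integrable_torus) auto
  let ?c = "\<lambda>e. e ^ m * (\<Prod>e'\<in>E. psi t e' e) / (2 * (1 - t))"
  let ?h = "\<lambda>e y. hl_sum t ms (arg_val y) (arg_ix I (insert e E)) * 1 * dens t I (insert e E) y"
  have inth: "integrable (torus I) (?h e)" if "e \<in> {1, - 1}" for e
    by (rule integrable_hl_int[where B = 1]) (use t I that in auto)
  have slice: "(LINT x|circle_measure. ?v (y(i := x))) =
      (\<Sum>e\<in>{1, - 1} - E. ?c e * ?h e y)" if y: "generic I y" "y \<in> space (torus I)" for y
  proof -
    obtain p where p: "degree p \<le> m"
      "\<And>k0 z. k0 \<notin> ?K \<Longrightarrow> (\<And>k. k \<in> ?K \<Longrightarrow> z k = arg_val y k) \<Longrightarrow>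
         z k0 \<notin> arg_val y ` ?K \<Longrightarrow> hl_sum t ms z (insert k0 ?K) = poly p (z k0)"
      "\<And>u. norm u = 1 \<Longrightarrow> u \<notin> arg_val y ` arg_ix I {1, - 1} \<Longrightarrow>
       ?v (y(i := u)) = dens t I E y *
         ((u\<^sup>2 * residue_fun t m p (arg_val y) ?K u - residue_fun t m p (arg_val y) ?K (inverse u)) / (u\<^sup>2 - 1))"
      using var_term_section[OF t I y(1) ms] by metis
    have n1: "norm (arg_val y b) = 1" if "b \<in> ?K" for b
      using genericD(3)[OF y(1)] sub that by auto
    let ?r = "residue_fun t m p (arg_val y) ?K"
    obtain g R where g: "g holomorphic_on ball 0 R" "R > 1" "\<And>u. u \<noteq> 0 \<Longrightarrow> g u = ?r u"
      using residue_fun_holomorphic[OF t p(1) fK, of "arg_val y"] n1 by metis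
    have hol: "(\<lambda>u. dens t I E y * g u) holomorphic_on ball 0 R"
      by (intro holomorphic_intros g(1))
    have "(LINT x|circle_measure. ?v (y(i := x))) =
      (dens t I E y * g 1 + dens t I E y * g (- 1)) / 2"
    proof (rule circle_integral_symmetrised[OF _ _ hol g(2)])
      have "(\<lambda>x. y(i := x)) \<in> measurable circle_measure (torus (insert i I))"
        unfolding torus_def using y(2) I(2) by (intro measurable_component_update) (auto simp: torus_def)
      from measurable_compose[OF this meas]
      show "(\<lambda>x. ?v (y(i := x))) \<in> borel_measurable borel"
        by (simp add: measurable_cong_sets[OF sets_circle_measure refl])
      show "finite (arg_val y ` arg_ix I {1, - 1})" using I(1) by simp
      fix x :: complex assume x: "norm x = 1" "x \<notin> arg_val y ` arg_ix I {1, - 1}"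
      then have "x \<noteq> 0" by auto
      then have "g x = ?r x" "g (inverse x) = ?r (inverse x)" using g(3) by auto
      then show "?v (y(i := x)) =
        (x\<^sup>2 * (dens t I E y * g x) - dens t I E y * g (inverse x)) / (x\<^sup>2 - 1)"
        unfolding p(3)[OF x] by (simp add: right_diff_distrib mult.left_commute)
    qed
    also have "\<dots> = (\<Sum>e\<in>{1, - 1}. dens t I E y * g e / 2)"
      by (simp add: add_divide_distrib)
    also have "\<dots> = (\<Sum>e\<in>{1, - 1} - E. ?c e * ?h e y)"
    proof (rule sum.mono_neutral_cong_right)
      show "\<forall>e\<in>{1, - 1} - ({1, - 1} - E). dens t I E y * g e / 2 = 0"
      proof
        fix e assume "e \<in> {1, - 1} - ({1, - 1} - E)"
        then have e: "e \<in> {1, - 1}" "e \<in> E" by auto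
        have "psi t e e = 0" using e(1) by (auto simp: psi_def)
        then have "(\<Prod>b\<in>?K. psi t (arg_val y b) e) = 0"
          using fK e(2) by (intro prod_zero) (auto intro!: bexI[of _ "Inr e"])
        then have "?r e = 0" by (simp add: residue_fun_def)
        moreover have "g e = ?r e" using e(1) by (intro g(3)) auto
        ultimately show "dens t I E y * g e / 2 = 0" by simp
      qed
      fix e assume "e \<in> {1, - 1} - E"
      then have e: "e \<in> {1, - 1}" "e \<notin> E" by auto
      have ee: "e * e = 1" "inverse e = e" "e \<noteq> 0" using e(1) by auto
      have inj: "inj_on (arg_val y) (arg_ix I {1, - 1})" by (rule genericD(2)[OF y(1)]) simp
      have "e \<notin> arg_val y ` ?K"
      proof
        assume "e \<in> arg_val y ` ?K"
        then obtain k where k: "k \<in> ?K" "arg_val y (Inr e) = arg_val y k" by auto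
        then have "Inr e = k" using subsetD[OF sub k(1)] e(1) by (intro inj_onD[OF inj k(2)]) auto
        then show False using k(1) e(2) by auto
      qed
      then have pe: "poly p e = hl_sum t ms (arg_val y) (arg_ix I (insert e E))"
        using p(2)[of "Inr e" "arg_val y"] e(2) by (simp add: arg_ix_insert)
      have "g e = e ^ m * poly p e * ((\<Prod>b\<in>?K. psi t (arg_val y b) e) * (1 / (1 - t)))"
        using g(3)[OF ee(3)] ee by (simp add: residue_fun_def power2_eq_square)
      moreover have "(\<Prod>b\<in>?K. psi t (arg_val y b) e) = (\<Prod>b\<in>arg_ix I {}. psi t (arg_val y b) e) * (\<Prod>e'\<in>E. psi t e' e)"
        unfolding prod_arg_ix[OF I(1) fE] prod_arg_ix[OF I(1) finite.emptyI] by simp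
      moreover have "dens t I (insert e E) y = dens t I E y * (\<Prod>b\<in>arg_ix I {}. psi t (arg_val y b) e)"
        by (rule dens_insert_extra_psi[OF I(1) fE e(2)])
      ultimately show "dens t I E y * g e / 2 = ?c e * ?h e y"
        unfolding pe by (simp add: mult_ac)
    qed auto
    finally show ?thesis .
  qed
  have "(LINT x|torus (insert i I). ?v x) =
     (LINT y|torus I. LINT x|circle_measure. ?v (y(i := x)))"
    using circle_product.product_integral_insert[OF I(1,2)] int unfolding torus_def by blast
  also have "\<dots> = (LINT y|torus I. (\<Sum>e\<in>{1, - 1} - E. ?c e * ?h e y))"
  proof (rule integral_cong_AE)
    have "(\<lambda>(y, x). y(i := x)) \<in> measurable (torus I \<Otimes>\<^sub>M circle_measure) (torus (insert i I))"
      unfolding torus_def by (rule measurable_add_dim)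
    from measurable_compose[OF this meas]
    have "(\<lambda>(y, x). ?v (y(i := x))) \<in> borel_measurable (torus I \<Otimes>\<^sub>M circle_measure)"
      by (simp add: case_prod_unfold)
    then show "(\<lambda>y. LINT x|circle_measure. ?v (y(i := x))) \<in> borel_measurable (torus I)"
      by (rule sigma_finite_measure.borel_measurable_lebesgue_integral[rotated])
         (rule prob_space_imp_sigma_finite[OF prob_space_circle_measure])
    show "(\<lambda>y. \<Sum>e\<in>{1, - 1} - E. ?c e * ?h e y) \<in> borel_measurable (torus I)"
      using inth by (intro borel_measurable_sum borel_measurable_times borel_measurable_const borel_measurable_integrable) auto
    show "AE y in torus I. (LINT x|circle_measure. ?v (y(i := x))) =
      (\<Sum>e\<in>{1, - 1} - E. ?c e * ?h e y)"
      using AE_generic[OF I(1)] AE_space by eventually_elim (rule slice)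
  qed
  also have "\<dots> = (\<Sum>e\<in>{1, - 1} - E. ?c e * hl_int t I (insert e E) (\<lambda>_. 1) ms)"
    unfolding hl_int_def using inth by (subst Bochner_Integration.integral_sum) auto
  finally show ?thesis .
qed

section \<open>The recursion and its solution\<close>

text \<open>
  Putting an extra argument \<open>e\<close> first cancels the factors of the density that \<open>e\<close> brings along, so
  that the density of the case without \<open>e\<close> appears.
\<close>

lemma extra_term:
  assumes t: "norm t < 1" and I: "finite I" "E \<subseteq> {1, - 1}" and e: "e \<in> E" and x: "generic I x"
  shows "hl_term t m ms (arg_val x) (arg_ix I E) (Inr e) * dens t I E x =
    e ^ m * (\<Prod>e'\<in>E - {e}. (e - t * e') / (e - e')) *
      (hl_sum t ms (arg_val x) (arg_ix I (E - {e})) * 1 * dens t I (E - {e}) x)"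
proof -
  have fE: "finite (E - {e})" using I(2) finite_subset by auto
  have e1: "e \<in> {1, - 1}" using e I(2) by auto
  then have ee: "e * e = 1" "norm e = 1" by auto
  have inj: "inj_on (arg_val x) (arg_ix I {1, - 1})" by (rule genericD(2)[OF x]) simp
  have ne: "arg_val x k \<noteq> e" if "k \<in> arg_ix I {}" for k
  proof
    assume "arg_val x k = e"
    then have "arg_val x k = arg_val x (Inr e)" by simp
    moreover have "k \<in> arg_ix I {1, - 1}"
      using that arg_ix_mono[of I I "{}" "{1, - 1}"] by auto
    ultimately have "k = Inr e" using e1 by (intro inj_onD[OF inj]) auto
    then show False using that by simp
  qed
  have cancel: "(e - t * a) / (e - a) * psi t a e = 1" if "a \<noteq> e" "norm a = 1" for a
  proof -
    have "norm (a * e) = 1" using that ee by (simp add: norm_mult)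
    then have 1: "1 - t * (a * e) \<noteq> 0" by (rule one_minus_bound(2)[OF t])
    have e0: "e \<noteq> 0" using ee by auto
    have 2: "e - t * a = e * (1 - t * (a * e))" "e - a = e * (1 - a * e)"
      using ee by (simp_all add: algebra_simps)
    have "e - a \<noteq> 0" using that(1) by auto
    then have 3: "1 - a * e \<noteq> 0" using 2(2) by auto
    show ?thesis unfolding 2 psi_def mult.assoc using 1 3 e0 by simp
  qed
  have "(\<Prod>k\<in>arg_ix I {}. (e - t * arg_val x k) / (e - arg_val x k)) * (\<Prod>k\<in>arg_ix I {}. psi t (arg_val x k) e) = 1"
    unfolding prod.distrib[symmetric]
  proof (intro prod.neutral ballI cancel ne)
    fix k assume k: "k \<in> arg_ix I {}"
    then show "norm (arg_val x k) = 1"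
      using arg_ix_mono[of I I "{}" "{1, - 1}"] by (intro genericD(3)[OF x]) auto
  qed
  moreover have "dens t I E x = dens t I (E - {e}) x * (\<Prod>k\<in>arg_ix I {}. psi t (arg_val x k) e)"
    using dens_insert_extra_psi[OF I(1) fE, of e t x] e by (simp add: insert_absorb)
  moreover have "(\<Prod>k\<in>arg_ix I (E - {e}). (e - t * arg_val x k) / (e - arg_val x k)) =
    (\<Prod>k\<in>arg_ix I {}. (e - t * arg_val x k) / (e - arg_val x k)) * (\<Prod>e'\<in>E - {e}. (e - t * e') / (e - e'))"
    unfolding prod_arg_ix[OF I(1) fE] prod_arg_ix[OF I(1) finite.emptyI] by simp
  moreover have "A * B * H * (D * C) = A' * (H * 1 * D)" if "P * C = 1" "B = P * Q" "A' = A * Q" for A B H D C A' P Q :: complex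
  proof -
    have "A * B * H * (D * C) = A * Q * (P * C) * (H * D)" unfolding that(2) by (simp only: mult_ac)
    then show ?thesis using that by simp
  qed
  ultimately show ?thesis
    unfolding hl_term_def arg_ix_insert by simp
qed

text \<open>
  The recursion by the argument that carries the first exponent: either an extra argument, or one of
  \<open>x\<^sub>i\<^sup>\<plusminus>\<^sup>1\<close>. It links the four kinds of integrals, since \<open>E\<close> loses or gains one of \<open>\<plusminus>1\<close>.
\<close>

lemma hl_int_recursion:
  assumes t: "norm t < 1" and I: "finite I" "E \<subseteq> {1, - 1}" and ms: "\<And>n. n \<in> set ms \<Longrightarrow> n \<le> m"
  shows "hl_int t I E (\<lambda>_. 1) (m # ms) =
    (\<Sum>e\<in>E. e ^ m * (\<Prod>e'\<in>E - {e}. (e - t * e') / (e - e')) * hl_int t I (E - {e}) (\<lambda>_. 1) ms) +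
    (\<Sum>i\<in>I. \<Sum>e\<in>{1, - 1} - E. e ^ m * (\<Prod>e'\<in>E. psi t e' e) / (2 * (1 - t)) *
       hl_int t (I - {i}) (insert e E) (\<lambda>_. 1) ms)"
proof -
  have fE: "finite E" using I(2) finite_subset by auto
  let ?w = "\<lambda>i. \<Sum>e\<in>{1, - 1} - E. e ^ m * (\<Prod>e'\<in>E. psi t e' e) / (2 * (1 - t)) * hl_int t (I - {i}) (insert e E) (\<lambda>_. 1) ms"
  let ?v = "var_term t m ms I E" and ?S = "\<lambda>x. hl_sum t (m # ms) (arg_val x) (arg_ix I E)"
  let ?c = "\<lambda>e. e ^ m * (\<Prod>e'\<in>E - {e}. (e - t * e') / (e - e'))"
  let ?h = "\<lambda>e x. hl_sum t ms (arg_val x) (arg_ix I (E - {e})) * 1 * dens t I (E - {e}) x"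
  have inth: "integrable (torus I) (?h e)" for e
    by (rule integrable_hl_int[where B = 1]) (use t I in auto)
  have intv: "integrable (torus I) (?v i)" and
    valv: "(LINT x|torus I. ?v i x) = ?w i" if i: "i \<in> I" for i
  proof -
    have ins: "insert i (I - {i}) = I" using i by auto
    obtain C where "\<And>x. generic I x \<Longrightarrow> norm (?v i x) \<le> C"
      using var_term_bounded[OF t _ _ I(2) ms, of "I - {i}" i] I(1) unfolding ins by auto
    then show "integrable (torus I) (?v i)"
      by (intro integrable_torus[OF I(1)] var_term_measurable I fE i) auto
    show "(LINT x|torus I. ?v i x) = ?w i"
      using integral_var_term[OF t _ _ I(2) ms, of "I - {i}" i] I(1) unfolding ins by simp
  qed
  have "hl_int t I E (\<lambda>_. 1) (m # ms) =
    (LINT x|torus I. (\<Sum>e\<in>E. ?c e * ?h e x) + (\<Sum>i\<in>I. ?v i x))"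
    unfolding hl_int_def
  proof (rule integral_cong_AE)
    show "(\<lambda>x. ?S x * 1 * dens t I E x) \<in> borel_measurable (torus I)"
      by (rule borel_measurable_integrable, rule integrable_hl_int[where B = 1]) (use t I in auto)
    show "(\<lambda>x. (\<Sum>e\<in>E. ?c e * ?h e x) + (\<Sum>i\<in>I. ?v i x)) \<in> borel_measurable (torus I)"
      using inth intv
      by (intro borel_measurable_add borel_measurable_sum borel_measurable_times borel_measurable_const
          borel_measurable_integrable) auto
    show "AE x in torus I. ?S x * 1 * dens t I E x =
       (\<Sum>e\<in>E. ?c e * ?h e x) + (\<Sum>i\<in>I. ?v i x)"
      using AE_generic[OF I(1)]
    proof eventually_elim
      case (elim x)
      have "?S x =
         (\<Sum>a\<in>arg_ix I E. hl_term t m ms (arg_val x) (arg_ix I E) a)"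
        by (simp add: hl_term_def)
      then have "?S x * 1 * dens t I E x =
        (\<Sum>e\<in>E. hl_term t m ms (arg_val x) (arg_ix I E) (Inr e) * dens t I E x) +
        (\<Sum>i\<in>I. ?v i x)"
        by (simp only: sum_arg_ix[OF I(1) fE] var_term_def distrib_right sum_distrib_right mult_1_right add.commute)
      also have "(\<Sum>e\<in>E. hl_term t m ms (arg_val x) (arg_ix I E) (Inr e) * dens t I E x) = (\<Sum>e\<in>E. ?c e * ?h e x)"
        by (intro sum.cong refl extra_term[OF t I _ elim])
      finally show ?case .
    qed
  qed
  also have "\<dots> = (\<Sum>e\<in>E. ?c e * hl_int t I (E - {e}) (\<lambda>_. 1) ms) + (\<Sum>i\<in>I. (LINT x|torus I. ?v i x))"
    unfolding hl_int_def using inth intv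
    by (simp add: Bochner_Integration.integral_add Bochner_Integration.integral_sum)
  also have "(\<Sum>i\<in>I. (LINT x|torus I. ?v i x)) = (\<Sum>i\<in>I. ?w i)"
    by (intro sum.cong refl valv)
  finally show ?thesis .
qed

definition all_even :: "nat list \<Rightarrow> complex" where "all_even ms = (if \<forall>n\<in>set ms. even n then 1 else 0)"
definition all_odd :: "nat list \<Rightarrow> complex" where "all_odd ms = (if \<forall>n\<in>set ms. odd n then 1 else 0)"

definition hl_const :: "complex \<Rightarrow> complex set \<Rightarrow> nat \<Rightarrow> complex" where
  "hl_const t E n = 2 ^ n * fact n / (1 - t) ^ n * (if E = {} then 1 / 2 else if E = {1, - 1} then 1 + t else 1)"

lemma all_even_odd_Cons:
  "all_even (m # ms) = (if even m then all_even ms else 0)"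
  "all_odd (m # ms) = (if odd m then all_odd ms else 0)"
  by (auto simp: all_even_def all_odd_def)

text \<open>
  The integral sees only whether all exponents have the same parity. The recursion combines two
  integrals that differ, up to a constant, in the sign in front of the odd indicator, and one of them
  comes with the factor \<open>(- 1)\<^sup>m\<close>; in the sum only the parity class of the first exponent \<open>m\<close> survives.
\<close>

lemma hl_int_value:
  assumes t: "norm t < 1" and "finite I" "E \<subseteq> {1, - 1}" "sorted_wrt (\<ge>) ms" "length ms = 2 * card I + card E"
  shows "hl_int t I E (\<lambda>_. 1) ms = hl_const t E (card I) * (all_even ms + \<Prod>E * all_odd ms)"
  using assms(2-)
proof (induction ms arbitrary: I E)
  case Nil
  then have "card I = 0" "card E = 0" by simp_all
  moreover have "finite E" using Nil.prems(2) finite_subset by auto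
  ultimately have "I = {}" "E = {}" using Nil.prems(1) by simp_all
  moreover have "measure (torus {}) (space (torus {})) = 1"
    using prob_space.prob_space[OF prob_space_torus] .
  ultimately show ?case by (simp add: hl_int_def dens_def hl_const_def all_even_def all_odd_def)
next
  case (Cons m ms)
  note fI = Cons.prems(1)
  have ms: "\<And>n. n \<in> set ms \<Longrightarrow> n \<le> m" and sorted: "sorted_wrt (\<ge>) ms" using Cons.prems(3) by auto
  have t1: "1 - t \<noteq> 0" "1 + t \<noteq> 0"
    using one_minus_bound(2)[OF t, of 1] one_minus_bound(2)[OF t, of "- 1"] by auto
  have rec: "hl_int t I E (\<lambda>_. 1) (m # ms) =
    (\<Sum>e\<in>E. e ^ m * (\<Prod>e'\<in>E - {e}. (e - t * e') / (e - e')) * hl_int t I (E - {e}) (\<lambda>_. 1) ms) +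
    (\<Sum>i\<in>I. \<Sum>e\<in>{1, - 1} - E. e ^ m * (\<Prod>e'\<in>E. psi t e' e) / (2 * (1 - t)) *
       hl_int t (I - {i}) (insert e E) (\<lambda>_. 1) ms)"
    by (rule hl_int_recursion[OF t fI Cons.prems(2)]) (rule ms)
  have IH1: "hl_int t I E' (\<lambda>_. 1) ms = hl_const t E' (card I) * (all_even ms + \<Prod>E' * all_odd ms)"
    if "E' \<subseteq> {1, - 1}" "card E = Suc (card E')" for E'
    by (rule Cons.IH[OF fI that(1) sorted]) (use Cons.prems(4) that in simp)
  define V where "V E' = (if card I = 0 then 0 else hl_const t E' (card I - 1) * (all_even ms + \<Prod>E' * all_odd ms))" for E'
  have IH2: "hl_int t (I - {i}) E' (\<lambda>_. 1) ms = V E'"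
    if "E' \<subseteq> {1, - 1}" "card E' = Suc (card E)" "i \<in> I" for E' i
  proof -
    have c: "card (I - {i}) = card I - 1" "card I \<noteq> 0" using fI that(3) by (auto simp: card_gt_0_iff)
    have "hl_int t (I - {i}) E' (\<lambda>_. 1) ms = hl_const t E' (card (I - {i})) * (all_even ms + \<Prod>E' * all_odd ms)"
    proof (rule Cons.IH[OF _ that(1) sorted])
      show "length ms = 2 * card (I - {i}) + card E'"
        using Cons.prems(4) c that(2) unfolding length_Cons by linarith
    qed (use fI in simp)
    then show ?thesis using c by (simp add: V_def)
  qed
  define n where "n = card I"
  define C where "C = (2::complex) ^ n * fact n / (1 - t) ^ n"
  have Cn: "of_nat n * (2 ^ (n - 1) * fact (n - 1) / (1 - t) ^ (n - 1)) = C * (1 - t) / 2" if "n \<noteq> 0"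
    using that t1(1) by (cases n) (simp_all add: C_def field_simps)
  have pm: "(- 1) ^ m = (if even m then 1 else - 1 :: complex)" by simp
  have fourE: "E = {} \<or> E = {1} \<or> E = {- 1} \<or> E = {1, - 1}" using Cons.prems(2) by blast
  have neq: "(1::complex) \<noteq> - 1" "(- 1::complex) \<noteq> 1" by simp_all
  have E3: "{1, - 1} - {} = {1, - 1 :: complex}" "{1, - 1} - {1} = {- 1 :: complex}" "{1, - 1} - {- 1} = {1 :: complex}"
    by auto
  have hc: "hl_const t {} n = C / 2" "hl_const t {1} n = C" "hl_const t {- 1} n = C" "hl_const t {1, - 1} n = C * (1 + t)"
    using neq by (simp_all add: hl_const_def C_def)
  have quarter: "C * (1 - t) / 2 / (2 * (1 - t)) = C / 4"
    using t1(1) nonzero_mult_divide_mult_cancel_right[of "1 - t" C 4] by (simp add: mult_ac)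
  have psi2: "psi t 1 (- 1) * (1 + t) = 2" "psi t (- 1) 1 * (1 + t) = 2"
  proof -
    have "psi t 1 (- 1) = 2 / (1 + t)" "psi t (- 1) 1 = 2 / (1 + t)"
      by (simp_all add: psi_def)
    then show "psi t 1 (- 1) * (1 + t) = 2" "psi t (- 1) 1 * (1 + t) = 2"
      using t1(2) by (simp_all only: nonzero_divide_eq_eq[symmetric] not_False_eq_True divide_self_if times_divide_eq_left nonzero_mult_div_cancel_right)
  qed
  have W: "of_nat n * (P / (2 * (1 - t)) * V {1, - 1}) = C / 2 * (all_even ms - all_odd ms)"
    if P: "P * (1 + t) = 2" and E: "card E = 1" for P
  proof (cases "n = 0")
    case True
    then have "ms = []" using Cons.prems(4) E by (simp add: n_def)
    then show ?thesis using True by (simp add: V_def n_def all_even_def all_odd_def)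
  next
    case False
    have "of_nat n * (P / (2 * (1 - t)) * V {1, - 1}) =
      (of_nat n * (2 ^ (n - 1) * fact (n - 1) / (1 - t) ^ (n - 1))) * (P * (1 + t)) / (2 * (1 - t)) *
       (all_even ms - all_odd ms)"
      using False neq by (simp add: V_def n_def hl_const_def mult_ac)
    moreover have "C * (1 - t) / 2 * 2 / (2 * (1 - t)) = C / 2"
      using t1(1) nonzero_mult_divide_mult_cancel_right[of "1 - t" C 2] by (simp add: mult_ac)
    ultimately show ?thesis unfolding Cn[OF False] P by (simp only:)
  qed
  from fourE show ?case
  proof (elim disjE)
    assume E: "E = {}"
    have n0: "n \<noteq> 0" using Cons.prems(4) E by (auto simp: n_def)
    have "hl_int t I E (\<lambda>_. 1) (m # ms) = of_nat n * (V {1} / (2 * (1 - t)) + (- 1) ^ m * V {- 1} / (2 * (1 - t)))"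
      unfolding rec unfolding E E3 using IH2[of "{1}"] IH2[of "{- 1}"] neq by (simp add: E n_def cong: sum.cong)
    also have "\<dots> = (of_nat n * (2 ^ (n - 1) * fact (n - 1) / (1 - t) ^ (n - 1))) / (2 * (1 - t)) *
        ((all_even ms + all_odd ms) + (- 1) ^ m * (all_even ms - all_odd ms))"
      using n0 by (simp add: V_def n_def hl_const_def algebra_simps add_divide_distrib diff_divide_distrib)
    also have "\<dots> = C / 4 * ((all_even ms + all_odd ms) + (- 1) ^ m * (all_even ms - all_odd ms))"
      unfolding Cn[OF n0] quarter by simp
    also have "\<dots> = hl_const t E n * (all_even (m # ms) + \<Prod>E * all_odd (m # ms))"
      unfolding all_even_odd_Cons pm E hc by simp
    finally show ?case by (simp add: n_def)
  next
    assume E: "E = {1}"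
    have "hl_int t I E (\<lambda>_. 1) (m # ms) = hl_int t I {} (\<lambda>_. 1) ms +
       (- 1) ^ m * (of_nat n * (psi t 1 (- 1) / (2 * (1 - t)) * V {1, - 1}))"
      unfolding rec unfolding E E3 using IH2[of "{1, - 1}"] neq by (simp add: E n_def insert_commute[of "- 1" 1] mult_ac cong: sum.cong)
    also have "hl_int t I {} (\<lambda>_. 1) ms = C / 2 * (all_even ms + all_odd ms)"
      using IH1[of "{}"] by (simp add: E n_def hl_const_def C_def)
    also have "of_nat n * (psi t 1 (- 1) / (2 * (1 - t)) * V {1, - 1}) = C / 2 * (all_even ms - all_odd ms)"
      using E by (intro W psi2) simp
    also have "C / 2 * (all_even ms + all_odd ms) + (- 1) ^ m * (C / 2 * (all_even ms - all_odd ms)) =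
       hl_const t E n * (all_even (m # ms) + \<Prod>E * all_odd (m # ms))"
      unfolding all_even_odd_Cons pm E hc by (simp add: field_simps)
    finally show ?case by (simp add: n_def)
  next
    assume E: "E = {- 1}"
    have "hl_int t I E (\<lambda>_. 1) (m # ms) = (- 1) ^ m * hl_int t I {} (\<lambda>_. 1) ms +
       of_nat n * (psi t (- 1) 1 / (2 * (1 - t)) * V {1, - 1})"
      unfolding rec unfolding E E3 using IH2[of "{1, - 1}"] neq by (simp add: E n_def insert_commute[of "- 1" 1] cong: sum.cong)
    also have "hl_int t I {} (\<lambda>_. 1) ms = C / 2 * (all_even ms + all_odd ms)"
      using IH1[of "{}"] by (simp add: E n_def hl_const_def C_def)
    also have "of_nat n * (psi t (- 1) 1 / (2 * (1 - t)) * V {1, - 1}) = C / 2 * (all_even ms - all_odd ms)"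
      using E by (intro W psi2) simp
    also have "(- 1) ^ m * (C / 2 * (all_even ms + all_odd ms)) + C / 2 * (all_even ms - all_odd ms) =
       hl_const t E n * (all_even (m # ms) + \<Prod>E * all_odd (m # ms))"
      unfolding all_even_odd_Cons pm E hc by (simp add: field_simps)
    finally show ?case by (simp add: n_def)
  next
    assume E: "E = {1, - 1}"
    have "hl_int t I E (\<lambda>_. 1) (m # ms) = (1 + t) / 2 * hl_int t I {- 1} (\<lambda>_. 1) ms +
       (- 1) ^ m * ((1 + t) / 2) * hl_int t I {1} (\<lambda>_. 1) ms"
    proof -
      have "{1, - 1} - {- 1} = {1 :: complex}" "{1, - 1} - {1} = {- 1 :: complex}" by auto
      moreover have "(- 1 - t) / (- 2) = (1 + t) / 2" by (simp add: field_simps)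
      ultimately show ?thesis
        unfolding rec unfolding E using neq by (simp add: insert_Diff_if) (simp add: algebra_simps)
    qed
    also have "hl_int t I {- 1} (\<lambda>_. 1) ms = C * (all_even ms - all_odd ms)"
      using IH1[of "{- 1}"] neq by (simp add: E n_def hl_const_def C_def)
    also have "hl_int t I {1} (\<lambda>_. 1) ms = C * (all_even ms + all_odd ms)"
      using IH1[of "{1}"] neq by (simp add: E n_def hl_const_def C_def)
    also have "(1 + t) / 2 * (C * (all_even ms - all_odd ms)) + (- 1) ^ m * ((1 + t) / 2) * (C * (all_even ms + all_odd ms)) =
       hl_const t E n * (all_even (m # ms) + \<Prod>E * all_odd (m # ms))"
      unfolding all_even_odd_Cons pm E hc using neq by (simp add: field_simps)
    finally show ?case by (simp add: n_def)
  qed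
qed

section \<open>Raising exponents and Gaussian binomial coefficients\<close>

lemma qnum_Suc: "t \<noteq> 1 \<Longrightarrow> qnum t (Suc n) = qnum t n + t ^ n"
  by (simp add: qnum_def divide_simps) (simp add: algebra_simps)

lemma qfact_Suc: "qfact t (Suc n) = qfact t n * qnum t (Suc n)"
  by (simp add: qfact_def)

lemma qfact_0 [simp]: "qfact t 0 = 1"
  by (simp add: qfact_def)

lemma qnum_nonzero:
  assumes "norm t < 1" "n > 0"
  shows "qnum t n \<noteq> 0"
proof -
  have "norm (t ^ n) < 1" using assms by (simp add: norm_power power_less_one_iff)
  then have "t ^ n \<noteq> 1" by auto
  moreover have "t \<noteq> 1" using assms by auto
  ultimately show ?thesis by (simp add: qnum_def)
qed

lemma qfact_nonzero: "norm t < 1 \<Longrightarrow> qfact t n \<noteq> 0"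
  by (simp add: qfact_def qnum_nonzero)

text \<open>
  The sum is constant in each variable, being a polynomial of degree 0 in it, so that one variable
  may be set to 0.
\<close>

lemma hl_sum_single_zero:
  fixes z :: "'k \<Rightarrow> complex"
  assumes t: "t \<noteq> 1" and "finite K" "inj_on z K"
  shows "hl_sum t [0] z K = qnum t (card K)"
  using assms(2,3)
proof (induction "card K" arbitrary: K)
  case 0
  then show ?case by (simp add: qnum_def)
next
  case (Suc N)
  \<comment> \<open>the variable with value 0 if there is one; otherwise any variable may take this value\<close>
  obtain k0 where k0: "k0 \<in> K" "\<And>k. k \<in> K - {k0} \<Longrightarrow> z k \<noteq> 0"
  proof (cases "\<exists>k\<in>K. z k = 0")
    case True
    then obtain k where "k \<in> K" "z k = 0" by auto
    then show thesis using Suc.prems(2) by (intro that[of k]) (auto simp: inj_on_def)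
  next
    case False
    moreover have "K \<noteq> {}" using Suc.hyps(2) by auto
    then obtain k where "k \<in> K" by blast
    ultimately show thesis by (intro that[of k]) auto
  qed
  let ?K = "K - {k0}"
  let ?F = "\<lambda>x y. (x - t * y) / (x - y)"
  have K: "K = insert k0 ?K" and fK: "finite ?K" and n0: "k0 \<notin> ?K"
    using k0(1) Suc.prems(1) by auto
  have N: "card ?K = N"
    using card_Suc_Diff1[OF Suc.prems(1) k0(1)] Suc.hyps(2) by simp
  have injK: "inj_on z ?K" using Suc.prems(2) by (rule inj_on_subset) auto
  have "\<exists>p. degree p \<le> 0 \<and> (\<forall>u. u \<notin> z ` ?K \<longrightarrow> hl_sum t [0] (z(k0 := u)) (insert k0 ?K) = poly p u)"
    by (rule hl_sum_poly[OF fK injK n0]) simp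
  then obtain p where p: "degree p = 0"
    "\<And>u. u \<notin> z ` ?K \<Longrightarrow> hl_sum t [0] (z(k0 := u)) K = poly p u"
    unfolding K[symmetric] by auto
  obtain c where c: "p = [:c:]" using p(1) by (rule degree_eq_zeroE)
  have z0: "z k0 \<notin> z ` ?K" using Suc.prems(2) k0(1) by (auto simp: inj_on_def)
  have 0: "0 \<notin> z ` ?K" using k0(2) by force
  let ?z = "z(k0 := 0)"
  have "hl_sum t [0] z K = hl_sum t [0] ?z K"
    using p(2)[OF z0] p(2)[OF 0] by (simp only: c fun_upd_triv) simp
  also have "\<dots> = (\<Sum>a\<in>insert k0 ?K. \<Prod>b\<in>K - {a}. ?F (?z a) (?z b))"
    unfolding K[symmetric] by simp
  also have "\<dots> = (\<Prod>b\<in>?K. ?F (?z k0) (?z b)) + (\<Sum>a\<in>?K. \<Prod>b\<in>K - {a}. ?F (?z a) (?z b))"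
    using fK n0 by (rule sum.insert)
  also have "(\<Prod>b\<in>?K. ?F (?z k0) (?z b)) = t ^ N"
  proof -
    have "(\<Prod>b\<in>?K. ?F (?z k0) (?z b)) = (\<Prod>b\<in>?K. t)"
      using k0(2) by (intro prod.cong) auto
    then show ?thesis by (simp only: prod_constant N)
  qed
  also have "(\<Sum>a\<in>?K. \<Prod>b\<in>K - {a}. ?F (?z a) (?z b)) = (\<Sum>a\<in>?K. \<Prod>b\<in>?K - {a}. ?F (z a) (z b))"
  proof (rule sum.cong[OF refl])
    fix a assume a: "a \<in> ?K"
    have "K - {a} = insert k0 (?K - {a})" using k0(1) a by auto
    moreover have "?F (?z a) (?z k0) = 1" using a k0(2)[OF a] by auto
    moreover have "(\<Prod>b\<in>?K - {a}. ?F (?z a) (?z b)) = (\<Prod>b\<in>?K - {a}. ?F (z a) (z b))"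
      using a by (intro prod.cong) auto
    ultimately show "(\<Prod>b\<in>K - {a}. ?F (?z a) (?z b)) = (\<Prod>b\<in>?K - {a}. ?F (z a) (z b))"
      using fK by simp
  qed
  also have "\<dots> = qnum t N"
    using Suc.hyps(1)[OF N[symmetric] fK injK] unfolding N by simp
  finally show ?case
    unfolding Suc.hyps(2)[symmetric] qnum_Suc[OF t] by (simp only: add.commute)
qed

lemma hl_sum_zeros:
  assumes "t \<noteq> 1" "finite K" "inj_on z K"
  shows "hl_sum t (replicate (card K) 0) z K = qfact t (card K)"
  using assms(2,3)
proof (induction "card K" arbitrary: K)
  case (Suc N)
  have "hl_sum t (replicate N 0) z (K - {a}) = qfact t N" if "a \<in> K" for a
  proof -
    have "N = card (K - {a})" using Suc.hyps(2) Suc.prems(1) that by simp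
    moreover have "inj_on z (K - {a})" using Suc.prems(2) by (rule inj_on_subset) auto
    ultimately show ?thesis using Suc.hyps(1)[of "K - {a}"] Suc.prems(1) by simp
  qed
  then have "hl_sum t (replicate (Suc N) 0) z K = hl_sum t [0] z K * qfact t N"
    unfolding replicate_Suc hl_sum.simps sum_distrib_right by (intro sum.cong refl) simp
  then show ?case
    unfolding Suc.hyps(2)[symmetric] qfact_Suc
    using hl_sum_single_zero[OF assms(1) Suc.prems] unfolding Suc.hyps(2)[symmetric]
    by (simp only: mult.commute)
qed simp

text \<open>
  \<open>raise c R \<lambda>\<close> is the sum of \<open>c\<^bsup>\<bar>\<epsilon>\<bar>\<^esup> R(\<lambda> + \<epsilon>)\<close> over all \<open>\<epsilon>\<close> with entries 0 and 1.
\<close>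

fun raise :: "complex \<Rightarrow> (nat list \<Rightarrow> complex) \<Rightarrow> nat list \<Rightarrow> complex" where
  "raise c R [] = R []"
| "raise c R (m # ms) = raise c (\<lambda>\<nu>. R (m # \<nu>)) ms + c * raise c (\<lambda>\<nu>. R (Suc m # \<nu>)) ms"

lemma raise_sum: "raise c (\<lambda>\<nu>. \<Sum>a\<in>A. f a * R a \<nu>) ms = (\<Sum>a\<in>A. f a * raise c (R a) ms)"
proof (induction ms arbitrary: R)
  case (Cons m ms)
  show ?case
    unfolding raise.simps Cons by (simp only: sum_distrib_left sum.distrib[symmetric] distrib_left mult.left_commute)
qed simp

lemma raise_mult: "raise c (\<lambda>\<nu>. R \<nu> * k) ms = raise c R ms * k"
  using raise_sum[where A = "{()}" and f = "\<lambda>_. k" and R = "\<lambda>_. R"] by (simp add: mult.commute)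

text \<open>
  A product of linear factors over all variables is symmetric, hence it can be moved inside the
  symmetrisation, where it acts on the exponents.
\<close>

lemma hl_sum_raise:
  assumes "finite K" "card K = length ms"
  shows "hl_sum t ms z K * (\<Prod>k\<in>K. 1 + c * z k) = raise c (\<lambda>\<nu>. hl_sum t \<nu> z K) ms"
  using assms
proof (induction ms arbitrary: K)
  case (Cons m ms)
  let ?P = "\<lambda>a. \<Prod>b\<in>K - {a}. (z a - t * z b) / (z a - z b)"
  have IH: "hl_sum t ms z (K - {a}) * (\<Prod>k\<in>K - {a}. 1 + c * z k) = raise c (\<lambda>\<nu>. hl_sum t \<nu> z (K - {a})) ms"
    if "a \<in> K" for a
    by (rule Cons.IH) (use Cons.prems that in auto)
  have "hl_sum t (m # ms) z K * (\<Prod>k\<in>K. 1 + c * z k) =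
    (\<Sum>a\<in>K. z a ^ m * ?P a * hl_sum t ms z (K - {a}) * ((1 + c * z a) * (\<Prod>k\<in>K - {a}. 1 + c * z k)))"
    unfolding hl_sum.simps sum_distrib_right
    by (intro sum.cong refl) (simp only: prod.remove[OF Cons.prems(1)])
  also have "\<dots> = (\<Sum>a\<in>K. z a ^ m * ?P a * raise c (\<lambda>\<nu>. hl_sum t \<nu> z (K - {a})) ms) +
     c * (\<Sum>a\<in>K. z a ^ Suc m * ?P a * raise c (\<lambda>\<nu>. hl_sum t \<nu> z (K - {a})) ms)"
    unfolding sum_distrib_left sum.distrib[symmetric]
    by (intro sum.cong refl) (simp only: IH[symmetric], simp add: algebra_simps)
  also have "\<dots> = raise c (\<lambda>\<nu>. hl_sum t \<nu> z K) (m # ms)"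
    by (simp only: raise.simps hl_sum.simps raise_sum)
  finally show ?case .
qed simp

lemma raise_integral:
  assumes "\<And>\<nu>. integrable M (\<lambda>x. R \<nu> x)"
  shows "integrable M (\<lambda>x. raise c (\<lambda>\<nu>. R \<nu> x) ms)"
    and "(LINT x|M. raise c (\<lambda>\<nu>. R \<nu> x) ms) = raise c (\<lambda>\<nu>. LINT x|M. R \<nu> x) ms"
proof -
  have "integrable M (\<lambda>x. raise c (\<lambda>\<nu>. R \<nu> x) ms) \<and>
    (LINT x|M. raise c (\<lambda>\<nu>. R \<nu> x) ms) = raise c (\<lambda>\<nu>. LINT x|M. R \<nu> x) ms"
    using assms
  proof (induction ms arbitrary: R)
    case (Cons m ms)
    from Cons.IH[of "\<lambda>\<nu>. R (m # \<nu>)", OF Cons.prems] Cons.IH[of "\<lambda>\<nu>. R (Suc m # \<nu>)", OF Cons.prems]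
    show ?case by simp
  qed simp
  then show "integrable M (\<lambda>x. raise c (\<lambda>\<nu>. R \<nu> x) ms)"
    "(LINT x|M. raise c (\<lambda>\<nu>. R \<nu> x) ms) = raise c (\<lambda>\<nu>. LINT x|M. R \<nu> x) ms" by auto
qed

text \<open>
  The Gaussian binomial coefficients, by the Pascal rule that arises from moving an exponent \<open>a\<close> past
  \<open>k\<close> exponents \<open>a + 1\<close>.
\<close>

fun qbinom :: "complex \<Rightarrow> nat \<Rightarrow> nat \<Rightarrow> complex" where
  "qbinom t m 0 = 1"
| "qbinom t 0 (Suc k) = 0"
| "qbinom t (Suc m) (Suc k) = qbinom t m k + t ^ Suc k * qbinom t m (Suc k)"

lemma qbinom_eq_0: "m < k \<Longrightarrow> qbinom t m k = 0"
  by (induction t m k rule: qbinom.induct) auto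

lemma qbinom_self [simp]: "qbinom t m m = 1"
  by (induction m) (auto simp: qbinom_eq_0)

lemma qbinom_qfact:
  assumes "norm t < 1" "k \<le> m"
  shows "qbinom t m k = qfact t m / (qfact t (m - k) * qfact t k)"
  using assms
proof (induction t m k rule: qbinom.induct)
  case (1 t m)
  then show ?case using qfact_nonzero[of t] by simp
next
  case (3 t m k)
  note t = 3(3)
  show ?case
  proof (cases "k = m")
    case True
    then show ?thesis using qfact_nonzero[OF t] by (simp add: qbinom_eq_0)
  next
    case False
    then obtain d where d: "m = k + Suc d" using 3(4) less_imp_Suc_add[of k m] by auto
    have t1: "t \<noteq> 1" using t by auto
    have "qnum t (Suc m) = qnum t (Suc k) + t ^ Suc k * qnum t (Suc d)"
      using t1 by (simp add: qnum_def d add_divide_distrib[symmetric] right_diff_distrib power_add)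
    moreover have "A / (D * d1 * K) + T * (A / (D * (K * k1))) = A * (k1 + T * d1) / (D * d1 * (K * k1))"
      if "D \<noteq> 0" "d1 \<noteq> 0" "K \<noteq> 0" "k1 \<noteq> 0" for A D d1 K k1 T :: complex
      using that by (simp add: field_simps)
    from this[OF qfact_nonzero[OF t, of d] qnum_nonzero[OF t, of "Suc d"] qfact_nonzero[OF t, of k] qnum_nonzero[OF t, of "Suc k"]]
    have "qfact t m / (qfact t d * qnum t (Suc d) * qfact t k) + t ^ Suc k * (qfact t m / (qfact t d * (qfact t k * qnum t (Suc k)))) =
      qfact t m * (qnum t (Suc k) + t ^ Suc k * qnum t (Suc d)) / (qfact t d * qnum t (Suc d) * (qfact t k * qnum t (Suc k)))"
      by simp
    ultimately show ?thesis
      using 3(1)[OF t] 3(2)[OF t] d by (simp add: qfact_Suc)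
  qed
qed auto

section \<open>The Pieri rule for integrals\<close>

text \<open>
  The straightening rule as a property of a functional on exponent sequences.
\<close>

definition exchange :: "complex \<Rightarrow> (nat list \<Rightarrow> complex) \<Rightarrow> bool" where
  "exchange t R \<longleftrightarrow> (\<forall>p a q. R (p @ [a, Suc a] @ q) = t * R (p @ [Suc a, a] @ q))"

lemma exchange_many:
  assumes "exchange t R"
  shows "R (p @ [a] @ replicate k (Suc a) @ q) = t ^ k * R (p @ replicate k (Suc a) @ [a] @ q)"
proof (induction k arbitrary: p)
  case (Suc k)
  have "R (p @ [a] @ replicate (Suc k) (Suc a) @ q) = R (p @ [a, Suc a] @ replicate k (Suc a) @ q)"
    by simp
  also have "\<dots> = t * R (p @ [Suc a, a] @ replicate k (Suc a) @ q)"
    using assms unfolding exchange_def by blast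
  also have "R (p @ [Suc a, a] @ replicate k (Suc a) @ q) = R ((p @ [Suc a]) @ [a] @ replicate k (Suc a) @ q)"
    by simp
  also have "\<dots> = t ^ k * R ((p @ [Suc a]) @ replicate k (Suc a) @ [a] @ q)"
    by (rule Suc.IH)
  finally show ?case by simp
qed simp

lemma raise_exchange:
  assumes "exchange t R"
  shows "raise c (\<lambda>\<nu>. R (p @ [a] @ replicate k (Suc a) @ r @ \<nu>)) q =
    t ^ k * raise c (\<lambda>\<nu>. R (p @ replicate k (Suc a) @ [a] @ r @ \<nu>)) q"
  unfolding exchange_many[OF assms]
  using raise_mult[of c "\<lambda>\<nu>. R (p @ replicate k (Suc a) @ [a] @ r @ \<nu>)" "t ^ k" q]
  by (simp only: mult.commute)

text \<open>
  Raising some of \<open>m\<close> equal exponents \<open>a\<close> and straightening the result moves the raised ones to the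
  front. Each inversion costs a factor \<open>t\<close>, so the \<open>k\<close>-subsets add up to a Gaussian binomial coefficient.
\<close>

lemma raise_block:
  assumes "exchange t R"
  shows "raise c (\<lambda>\<nu>. R (p @ \<nu>)) (replicate m a @ q) =
    (\<Sum>k\<le>m. qbinom t m k * c ^ k * raise c (\<lambda>\<nu>. R (p @ replicate k (Suc a) @ replicate (m - k) a @ \<nu>)) q)"
proof (induction m arbitrary: p)
  case (Suc m)
  define X where "X k = raise c (\<lambda>\<nu>. R (p @ replicate k (Suc a) @ replicate (Suc m - k) a @ \<nu>)) q" for k
  have 1: "raise c (\<lambda>\<nu>. R ((p @ [a]) @ replicate k (Suc a) @ replicate (m - k) a @ \<nu>)) q = t ^ k * X k"
    if "k \<le> m" for k
  proof -
    have "replicate (Suc m - k) a = a # replicate (m - k) a" using that by (simp add: Suc_diff_le)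
    then show ?thesis
      using raise_exchange[OF assms, of c p a k "replicate (m - k) a" q] by (simp add: X_def)
  qed
  have 2: "raise c (\<lambda>\<nu>. R ((p @ [Suc a]) @ replicate k (Suc a) @ replicate (m - k) a @ \<nu>)) q = X (Suc k)" for k
    by (simp add: X_def)
  have "raise c (\<lambda>\<nu>. R (p @ \<nu>)) (replicate (Suc m) a @ q) =
    raise c (\<lambda>\<nu>. R ((p @ [a]) @ \<nu>)) (replicate m a @ q) + c * raise c (\<lambda>\<nu>. R ((p @ [Suc a]) @ \<nu>)) (replicate m a @ q)"
    by simp
  also have "\<dots> = (\<Sum>k\<le>m. qbinom t m k * c ^ k * (t ^ k * X k)) + c * (\<Sum>k\<le>m. qbinom t m k * c ^ k * X (Suc k))"
    unfolding Suc.IH 2 using 1 by (intro arg_cong2[where f = "(+)"] sum.cong refl) simp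
  also have "(\<Sum>k\<le>m. qbinom t m k * c ^ k * (t ^ k * X k)) =
      X 0 + (\<Sum>k\<le>m. t ^ Suc k * qbinom t m (Suc k) * c ^ Suc k * X (Suc k))"
  proof -
    have "(\<Sum>k\<le>m. qbinom t m k * c ^ k * (t ^ k * X k)) = (\<Sum>k\<le>Suc m. qbinom t m k * c ^ k * (t ^ k * X k))"
      by (simp add: qbinom_eq_0)
    then show ?thesis
      unfolding sum.atMost_Suc_shift by (simp add: mult_ac)
  qed
  also have "X 0 + (\<Sum>k\<le>m. t ^ Suc k * qbinom t m (Suc k) * c ^ Suc k * X (Suc k)) +
      c * (\<Sum>k\<le>m. qbinom t m k * c ^ k * X (Suc k)) =
    X 0 + (\<Sum>k\<le>m. qbinom t (Suc m) (Suc k) * c ^ Suc k * X (Suc k))"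
    unfolding sum_distrib_left add.assoc sum.distrib[symmetric]
    by (intro arg_cong2[where f = "(+)"] sum.cong refl) (simp add: algebra_simps)
  also have "\<dots> = (\<Sum>k\<le>Suc m. qbinom t (Suc m) k * c ^ k * X k)"
    unfolding sum.atMost_Suc_shift by simp
  finally show ?case unfolding X_def .
qed simp

lemma sorted_leading_block:
  assumes "sorted_wrt (\<ge>) q" "\<And>x. x \<in> set q \<Longrightarrow> x \<le> (a::nat)"
  obtains q' where "q = replicate (count_list q a) a @ q'" "\<And>x. x \<in> set q' \<Longrightarrow> x < a" "sorted_wrt (\<ge>) q'"
proof -
  have "\<exists>q'. q = replicate (count_list q a) a @ q' \<and> (\<forall>x\<in>set q'. x < a) \<and> sorted_wrt (\<ge>) q'"
    using assms
  proof (induction q)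
    case (Cons b q)
    show ?case
    proof (cases "b = a")
      case True
      have "\<exists>q'. q = replicate (count_list q a) a @ q' \<and> (\<forall>x\<in>set q'. x < a) \<and> sorted_wrt (\<ge>) q'"
        by (rule Cons.IH) (use Cons.prems in auto)
      then show ?thesis using True by auto
    next
      case False
      have "\<forall>x\<in>set (b # q). x < a"
        using False Cons.prems by fastforce
      moreover then have "count_list (b # q) a = 0" by (meson count_list_0_iff less_irrefl)
      ultimately show ?thesis using Cons.prems(1) by (intro exI[of _ "b # q"]) auto
    qed
  qed simp
  then show thesis using that by blast
qed

text \<open>
  The homogeneous form of the Rogers--Szego polynomial.
\<close>

definition qbinom_sum :: "complex \<Rightarrow> nat \<Rightarrow> complex \<Rightarrow> complex \<Rightarrow> complex" where
  "qbinom_sum t m u v = (\<Sum>k\<le>m. qbinom t m k * u ^ (m - k) * v ^ k)"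

lemma sorted_append_ge:
  "sorted_wrt (\<ge>) (xs @ ys) \<longleftrightarrow> sorted_wrt (\<ge>) xs \<and> sorted_wrt (\<ge>) ys \<and> (\<forall>x\<in>set xs. \<forall>y\<in>set ys. (y::nat) \<le> x)"
  by (auto simp: sorted_wrt_append)

lemma sorted_replicate_ge: "sorted_wrt (\<ge>) (replicate n (a::nat))"
  by (induction n) auto

text \<open>
  Blocks of equal exponents are raised one after the other, and the result stays sorted, because a
  raised part is at most as large as the parts of the preceding blocks. Hence a functional that is
  a sum of multiplicative weights on sorted sequences produces a sum of products over the blocks.
\<close>

lemma raise_sorted_aux:
  fixes \<kappa> :: "'j \<Rightarrow> complex" and w :: "'j \<Rightarrow> nat \<Rightarrow> complex"
  assumes R: "exchange t R"
    and val: "\<And>\<nu>. sorted_wrt (\<ge>) \<nu> \<Longrightarrow> length \<nu> = N \<Longrightarrow> R \<nu> = (\<Sum>j\<in>J. \<kappa> j * (\<Prod>x\<leftarrow>\<nu>. w j x))"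
    and "sorted_wrt (\<ge>) p" "sorted_wrt (\<ge>) q" "\<And>x y. x \<in> set p \<Longrightarrow> y \<in> set q \<Longrightarrow> Suc y \<le> x"
    "length p + length q = N"
  shows "raise c (\<lambda>\<nu>. R (p @ \<nu>)) q =
    (\<Sum>j\<in>J. \<kappa> j * (\<Prod>x\<leftarrow>p. w j x) * (\<Prod>a\<in>set q. qbinom_sum t (count_list q a) (w j a) (c * w j (Suc a))))"
  using assms(3-)
proof (induction "length q" arbitrary: p q rule: less_induct)
  case less
  show ?case
  proof (cases q)
    case Nil
    then show ?thesis using val[of p] less.prems by simp
  next
    case (Cons a q1)
    obtain q' where q': "q = replicate (count_list q a) a @ q'" "\<And>x. x \<in> set q' \<Longrightarrow> x < a" "sorted_wrt (\<ge>) q'"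
      using sorted_leading_block[OF less.prems(2), of a] less.prems(2) Cons by auto
    define m where "m = count_list q a"
    have m: "m > 0" using Cons by (simp add: m_def)
    have q: "q = replicate m a @ q'" using q'(1) by (simp only: m_def)
    let ?p = "\<lambda>k. p @ replicate k (Suc a) @ replicate (m - k) a"
    let ?Q = "\<lambda>j q. \<Prod>a\<in>set q. qbinom_sum t (count_list q a) (w j a) (c * w j (Suc a))"
    have ap: "Suc a \<le> x" if "x \<in> set p" for x using less.prems(3)[OF that, of a] Cons by simp
    have IH: "raise c (\<lambda>\<nu>. R (?p k @ \<nu>)) q' = (\<Sum>j\<in>J. \<kappa> j * (\<Prod>x\<leftarrow>?p k. w j x) * ?Q j q')" if k: "k \<le> m" for k
    proof (rule less.hyps)
      show "length q' < length q" using m by (simp add: q)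
      show "length (?p k) + length q' = N" using less.prems(4) k by (simp add: q)
      show "sorted_wrt (\<ge>) (?p k)"
        using less.prems(1) ap Suc_leD[OF ap] by (auto simp: sorted_append_ge sorted_replicate_ge)
      show "sorted_wrt (\<ge>) q'" by (rule q'(3))
      show "Suc y \<le> x" if "x \<in> set (?p k)" "y \<in> set q'" for x y
        using that q'(2)[OF that(2)] ap by (fastforce simp: in_set_replicate split: if_splits)
    qed
    have split: "?Q j q = qbinom_sum t m (w j a) (c * w j (Suc a)) * ?Q j q'" for j
    proof -
      have a: "a \<notin> set q'" using q'(2) by blast
      have "set q = insert a (set q')" using m unfolding q by auto
      moreover have "count_list q x = count_list q' x" if "x \<in> set q'" for x
      proof -
        have "x \<noteq> a" using a that by auto
        then have "count_list (replicate m a) x = 0" by (simp add: count_list_0_iff)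
        then show ?thesis unfolding q by simp
      qed
      ultimately show ?thesis using a by (simp add: m_def cong: prod.cong)
    qed
    have "raise c (\<lambda>\<nu>. R (p @ \<nu>)) q = (\<Sum>k\<le>m. qbinom t m k * c ^ k * raise c (\<lambda>\<nu>. R (?p k @ \<nu>)) q')"
      unfolding q using raise_block[OF R, of c p m a q'] by simp
    also have "\<dots> = (\<Sum>k\<le>m. qbinom t m k * c ^ k * (\<Sum>j\<in>J. \<kappa> j * (\<Prod>x\<leftarrow>?p k. w j x) * ?Q j q'))"
      by (intro sum.cong refl) (simp only: IH atMost_iff)
    also have "\<dots> = (\<Sum>j\<in>J. \<kappa> j * (\<Prod>x\<leftarrow>p. w j x) * (qbinom_sum t m (w j a) (c * w j (Suc a)) * ?Q j q'))"
      unfolding qbinom_sum_def sum_distrib_left sum_distrib_right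
      by (subst sum.swap, intro sum.cong refl)
         (simp add: prod_list_replicate power_mult_distrib mult_ac)
    finally show ?thesis unfolding split .
  qed
qed

lemma raise_sorted:
  fixes \<kappa> :: "'j \<Rightarrow> complex" and w :: "'j \<Rightarrow> nat \<Rightarrow> complex"
  assumes "exchange t R"
    and "\<And>\<nu>. sorted_wrt (\<ge>) \<nu> \<Longrightarrow> length \<nu> = N \<Longrightarrow> R \<nu> = (\<Sum>j\<in>J. \<kappa> j * (\<Prod>x\<leftarrow>\<nu>. w j x))"
    and "sorted_wrt (\<ge>) q" "length q = N"
  shows "raise c R q = (\<Sum>j\<in>J. \<kappa> j * (\<Prod>a\<in>set q. qbinom_sum t (count_list q a) (w j a) (c * w j (Suc a))))"
  using raise_sorted_aux[where p = "[]", OF assms(1,2)] assms(3,4) by simp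

lemma hl_int_exchange:
  assumes t: "norm t < 1" and I: "finite I" "E \<subseteq> {1, - 1}"
    and f: "f \<in> borel_measurable (torus I)" "\<And>x. generic I x \<Longrightarrow> norm (f x) \<le> B"
  shows "exchange t (hl_int t I E f)"
  unfolding exchange_def
proof (intro allI)
  fix p a q
  let ?h = "\<lambda>ms x. hl_sum t ms (arg_val x) (arg_ix I E) * f x * dens t I E x"
  have int: "integrable (torus I) (?h ms)" for ms by (rule integrable_hl_int[OF t I f])
  have "finite E" using I(2) finite_subset by auto
  then have fK: "finite (arg_ix I E)" using I(1) by simp
  have "hl_int t I E f (p @ [a, Suc a] @ q) = (LINT x|torus I. t * ?h (p @ [Suc a, a] @ q) x)"
    unfolding hl_int_def
  proof (rule integral_cong_AE)
    show "AE x in torus I. ?h (p @ [a, Suc a] @ q) x = t * ?h (p @ [Suc a, a] @ q) x"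
      using AE_generic[OF I(1)]
    proof eventually_elim
      case (elim x)
      show ?case
        unfolding hl_sum_swap[OF fK genericD(2)[OF elim I(2)]] by (simp only: mult.assoc)
    qed
    show "?h (p @ [a, Suc a] @ q) \<in> borel_measurable (torus I)" using int by (rule borel_measurable_integrable)
    show "(\<lambda>x. t * ?h (p @ [Suc a, a] @ q) x) \<in> borel_measurable (torus I)"
      by (intro borel_measurable_times borel_measurable_const borel_measurable_integrable[OF int])
  qed
  then show "hl_int t I E f (p @ [a, Suc a] @ q) = t * hl_int t I E f (p @ [Suc a, a] @ q)"
    by (simp add: hl_int_def)
qed

definition arg_prod :: "nat set \<Rightarrow> complex set \<Rightarrow> complex \<Rightarrow> (nat \<Rightarrow> complex) \<Rightarrow> complex" where
  "arg_prod I E c x = (\<Prod>k\<in>arg_ix I E. 1 + c * arg_val x k)"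

lemma arg_prod_measurable: "finite I \<Longrightarrow> finite E \<Longrightarrow> arg_prod I E c \<in> borel_measurable (torus I)"
  unfolding arg_prod_def[abs_def]
  by (intro borel_measurable_prod borel_measurable_add borel_measurable_times borel_measurable_const arg_val_measurable)

lemma arg_prod_bounded:
  assumes "E \<subseteq> {1, - 1}" "generic I x"
  shows "norm (arg_prod I E c x) \<le> (1 + norm c) ^ card (arg_ix I E)"
proof -
  have "norm (arg_val x k) = 1" if "k \<in> arg_ix I E" for k
    using genericD(3)[OF assms(2)] that arg_ix_mono[OF order_refl assms(1)] by auto
  then have "norm (1 + c * arg_val x k) \<le> 1 + norm c" if "k \<in> arg_ix I E" for k
    using norm_triangle_ineq[of 1 "c * arg_val x k"] that by (simp add: norm_mult)
  then show ?thesis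
    unfolding arg_prod_def prod_norm[symmetric] by (intro prod_le_power) auto
qed

text \<open>
  The Pieri rule under the integral sign.
\<close>

lemma hl_int_arg_prod:
  assumes t: "norm t < 1" and I: "finite I" "E \<subseteq> {1, - 1}"
    and f: "f \<in> borel_measurable (torus I)" "\<And>x. generic I x \<Longrightarrow> norm (f x) \<le> B"
    and ms: "length ms = 2 * card I + card E"
  shows "hl_int t I E (\<lambda>x. arg_prod I E c x * f x) ms = raise c (hl_int t I E f) ms"
proof -
  have fE: "finite E" using I(2) finite_subset by auto
  let ?h = "\<lambda>ms x. hl_sum t ms (arg_val x) (arg_ix I E) * f x * dens t I E x"
  have int: "integrable (torus I) (?h ms)" for ms by (rule integrable_hl_int[OF t I f])
  have "hl_sum t ms (arg_val x) (arg_ix I E) * (arg_prod I E c x * f x) * dens t I E x = raise c (\<lambda>\<nu>. ?h \<nu> x) ms" for x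
  proof -
    have "raise c (\<lambda>\<nu>. ?h \<nu> x) ms = raise c (\<lambda>\<nu>. hl_sum t \<nu> (arg_val x) (arg_ix I E)) ms * f x * dens t I E x"
      unfolding raise_mult ..
    also have "raise c (\<lambda>\<nu>. hl_sum t \<nu> (arg_val x) (arg_ix I E)) ms =
        hl_sum t ms (arg_val x) (arg_ix I E) * arg_prod I E c x"
      unfolding arg_prod_def using I(1) fE ms
      by (intro hl_sum_raise[symmetric]) (auto simp: card_arg_ix)
    finally show ?thesis by (simp only: mult.assoc)
  qed
  then have "hl_int t I E (\<lambda>x. arg_prod I E c x * f x) ms = (LINT x|torus I. raise c (\<lambda>\<nu>. ?h \<nu> x) ms)"
    unfolding hl_int_def by (simp only:)
  also have "\<dots> = raise c (\<lambda>\<nu>. LINT x|torus I. ?h \<nu> x) ms"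
    using int by (rule raise_integral(2))
  finally show ?thesis unfolding hl_int_def[abs_def] .
qed

section \<open>Rogers--Szego polynomials and the four integrals\<close>

lemma prod_list_eq_prod_count:
  fixes f :: "'a \<Rightarrow> complex"
  shows "(\<Prod>x\<leftarrow>xs. f x) = (\<Prod>a\<in>set xs. f a ^ count_list xs a)"
proof (induction xs)
  case (Cons b xs)
  have "(\<Prod>a\<in>set (b # xs). f a ^ count_list (b # xs) a) =
     (\<Prod>a\<in>set (b # xs). (if a = b then f b else 1) * f a ^ count_list xs a)"
    by (intro prod.cong) auto
  also have "\<dots> = f b * (\<Prod>a\<in>set (b # xs). f a ^ count_list xs a)"
    by (simp add: prod.distrib prod.delta)
  also have "(\<Prod>a\<in>set (b # xs). f a ^ count_list xs a) = (\<Prod>a\<in>set xs. f a ^ count_list xs a)"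
    by (intro prod.mono_neutral_right) auto
  finally show ?case using Cons by simp
qed simp

lemma Prod_any_count_set:
  fixes f :: "nat \<Rightarrow> complex" and p :: "nat \<Rightarrow> nat"
  assumes "f 0 = 1" "\<And>i. i \<le> p i" "inj p" "range p = Collect P"
  shows "Prod_any (\<lambda>i. f (count_list lam (p i))) = (\<Prod>a\<in>{a \<in> set lam. P a}. f (count_list lam a))"
proof -
  have "Prod_any (\<lambda>i. f (count_list lam (p i))) = (\<Prod>i\<le>sum_list lam. f (count_list lam (p i)))"
    using assms(1,2) by (rule Prod_any_count)
  also have "\<dots> = (\<Prod>a\<in>p ` {..sum_list lam}. f (count_list lam a))"
    using assms(3) by (simp add: prod.reindex inj_on_subset)
  also have "\<dots> = (\<Prod>a\<in>{a \<in> set lam. P a}. f (count_list lam a))"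
  proof (rule prod.mono_neutral_right)
    show "{a \<in> set lam. P a} \<subseteq> p ` {..sum_list lam}"
    proof clarify
      fix a assume a: "a \<in> set lam" "P a"
      then obtain i where i: "a = p i" using assms(4) by blast
      have "p i \<le> sum_list lam" using a i member_le_sum_list by blast
      then show "a \<in> p ` {..sum_list lam}" using i assms(2)[of i] by auto
    qed
    show "\<forall>a\<in>p ` {..sum_list lam} - {a \<in> set lam. P a}. f (count_list lam a) = 1"
    proof
      fix a assume "a \<in> p ` {..sum_list lam} - {a \<in> set lam. P a}"
      then have "a \<notin> set lam" using assms(4) by auto
      then show "f (count_list lam a) = 1" using assms(1) by (simp add: count_list_0_iff)
    qed
  qed simp
  finally show ?thesis .
qed

lemma parity_product:
  fixes f g :: "nat \<Rightarrow> complex" and lam :: "nat list"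
  assumes "f 0 = 1" "g 0 = 1"
  shows "Prod_any (\<lambda>i. f (count_list lam (2 * i))) * Prod_any (\<lambda>i. g (count_list lam (2 * i + 1))) =
    (\<Prod>a\<in>set lam. if even a then f (count_list lam a) else g (count_list lam a))"
proof -
  have "Prod_any (\<lambda>i. f (count_list lam (2 * i))) = (\<Prod>a\<in>{a \<in> set lam. even a}. f (count_list lam a))"
    using Prod_any_count_set[of f "\<lambda>i. 2 * i" even lam] assms(1) range_even by (simp add: inj_def)
  moreover have "Prod_any (\<lambda>i. g (count_list lam (2 * i + 1))) = (\<Prod>a\<in>{a \<in> set lam. odd a}. g (count_list lam a))"
    using Prod_any_count_set[of g "\<lambda>i. 2 * i + 1" odd lam] assms(2) range_odd by (simp add: inj_def)
  ultimately show ?thesis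
    by (simp add: prod.If_cases Int_def)
qed

lemma qbinom_sum_qfact:
  assumes "norm t < 1"
  shows "qbinom_sum t m u v = (\<Sum>k\<le>m. u ^ (m - k) * v ^ k * (qfact t m / (qfact t (m - k) * qfact t k)))"
  unfolding qbinom_sum_def by (intro sum.cong refl) (simp add: qbinom_qfact[OF assms])

lemma rs_poly_eq: "norm t < 1 \<Longrightarrow> rs_poly m z t = qbinom_sum t m 1 z"
  by (simp add: rs_poly_def qbinom_sum_qfact)

lemma rs_hom_eq_qbinom_sum: "norm t < 1 \<Longrightarrow> rs_hom m a b t = qbinom_sum t m (- a) (- b)"
  by (simp add: rs_hom_def qbinom_sum_qfact)

text \<open>
  After the first set of linear factors every block has either no raised exponents or only raised
  ones, because the parity must not be mixed.
\<close>

lemma qbinom_sum_degenerate: "qbinom_sum t m u 0 = u ^ m" "qbinom_sum t m 0 v = v ^ m"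
proof -
  have "qbinom_sum t m u 0 = (\<Sum>k\<in>{0}. qbinom t m k * u ^ (m - k) * 0 ^ k)"
    unfolding qbinom_sum_def by (intro sum.mono_neutral_right) auto
  then show "qbinom_sum t m u 0 = u ^ m" by simp
  have "qbinom_sum t m 0 v = (\<Sum>k\<in>{m}. qbinom t m k * 0 ^ (m - k) * v ^ k)"
    unfolding qbinom_sum_def by (intro sum.mono_neutral_right) auto
  then show "qbinom_sum t m 0 v = v ^ m" by simp
qed

definition parity_weight :: "complex \<Rightarrow> bool \<Rightarrow> nat \<Rightarrow> complex" where
  "parity_weight c b n = (if even n = b then 1 else c)"

lemma all_even_odd_weight:
  "all_even \<nu> = (\<Prod>x\<leftarrow>\<nu>. parity_weight 0 True x)" "all_odd \<nu> = (\<Prod>x\<leftarrow>\<nu>. parity_weight 0 False x)"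
proof (induction \<nu>)
  case (Cons n \<nu>)
  show "all_even (n # \<nu>) = (\<Prod>x\<leftarrow>n # \<nu>. parity_weight 0 True x)"
    "all_odd (n # \<nu>) = (\<Prod>x\<leftarrow>n # \<nu>. parity_weight 0 False x)"
    unfolding all_even_odd_Cons using Cons.IH by (auto simp: parity_weight_def)
qed (simp_all add: all_even_def all_odd_def)

lemma qbinom_sum_parity_weight_0:
  "qbinom_sum t m (parity_weight 0 b a) (c * parity_weight 0 b (Suc a)) = parity_weight c b a ^ m"
  by (auto simp: parity_weight_def qbinom_sum_degenerate)

text \<open>
  In a block of the right parity the two weights are \<open>1\<close> and \<open>\<alpha> \<beta>\<close>; in a block of the other parity
  they are \<open>- \<alpha>\<close> and \<open>- \<beta>\<close>. These are the two kinds of Rogers--Szego factors.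
\<close>

lemma parity_weight_A_B:
  assumes t: "norm t < 1"
  shows "A_lam lam \<alpha> \<beta> t = (\<Prod>a\<in>set lam. qbinom_sum t (count_list lam a) (parity_weight (- \<alpha>) True a)
      (- \<beta> * parity_weight (- \<alpha>) True (Suc a)))"
    and "B_lam lam \<alpha> \<beta> t = (\<Prod>a\<in>set lam. qbinom_sum t (count_list lam a) (parity_weight (- \<alpha>) False a)
      (- \<beta> * parity_weight (- \<alpha>) False (Suc a)))"
proof -
  let ?f = "\<lambda>m. rs_poly m (\<alpha> * \<beta>) t" and ?g = "\<lambda>m. rs_hom m \<alpha> \<beta> t"
  show "A_lam lam \<alpha> \<beta> t = (\<Prod>a\<in>set lam. qbinom_sum t (count_list lam a) (parity_weight (- \<alpha>) True a)
      (- \<beta> * parity_weight (- \<alpha>) True (Suc a)))"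
    unfolding A_lam_polynomial parity_product[of ?f ?g, OF rs_poly_0 rs_hom_0]
    by (intro prod.cong refl)
       (auto simp: parity_weight_def rs_poly_eq[OF t] rs_hom_eq_qbinom_sum[OF t] mult.commute)
  show "B_lam lam \<alpha> \<beta> t = (\<Prod>a\<in>set lam. qbinom_sum t (count_list lam a) (parity_weight (- \<alpha>) False a)
      (- \<beta> * parity_weight (- \<alpha>) False (Suc a)))"
    unfolding B_lam_polynomial mult.commute[of "Prod_any (\<lambda>i. rs_poly (count_list lam (2 * i + 1)) (\<alpha> * \<beta>) t)"]
      parity_product[of ?g ?f, OF rs_hom_0 rs_poly_0]
    by (intro prod.cong refl)
       (auto simp: parity_weight_def rs_poly_eq[OF t] rs_hom_eq_qbinom_sum[OF t] mult.commute)
qed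

text \<open>
  The linear factors with \<open>\<alpha>\<close> turn the parity conditions into powers of \<open>- \<alpha>\<close>, and those with \<open>\<beta>\<close> turn
  these multiplicative weights into Rogers--Szego polynomials.
\<close>

lemma hl_int_arg_prods:
  assumes t: "norm t < 1" and I: "finite I" "E \<subseteq> {1, - 1}"
    and lam: "sorted_wrt (\<ge>) lam" "length lam = 2 * card I + card E"
  shows "hl_int t I E (\<lambda>x. arg_prod I E (- \<beta>) x * arg_prod I E (- \<alpha>) x) lam =
    hl_const t E (card I) * (A_lam lam \<alpha> \<beta> t + \<Prod>E * B_lam lam \<alpha> \<beta> t)"
proof -
  have fE: "finite E" using I(2) finite_subset by auto
  define \<kappa> where "\<kappa> b = hl_const t E (card I) * (if b then 1 else \<Prod>E)" for b
  have f1: "(\<lambda>_. 1) \<in> borel_measurable (torus I)" "generic I x \<Longrightarrow> norm (1::complex) \<le> 1" for x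
    by simp_all
  note f2 = arg_prod_measurable[OF I(1) fE, of "- \<alpha>"] arg_prod_bounded[OF I(2)]
  have R0: "hl_int t I E (\<lambda>_. 1) \<nu> = (\<Sum>b\<in>UNIV. \<kappa> b * (\<Prod>x\<leftarrow>\<nu>. parity_weight 0 b x))"
    if "sorted_wrt (\<ge>) \<nu>" "length \<nu> = 2 * card I + card E" for \<nu>
    unfolding hl_int_value[OF t I that] all_even_odd_weight by (simp add: \<kappa>_def UNIV_bool algebra_simps)
  have R1: "hl_int t I E (\<lambda>x. arg_prod I E (- \<alpha>) x) \<nu> = (\<Sum>b\<in>UNIV. \<kappa> b * (\<Prod>x\<leftarrow>\<nu>. parity_weight (- \<alpha>) b x))"
    if \<nu>: "sorted_wrt (\<ge>) \<nu>" "length \<nu> = 2 * card I + card E" for \<nu>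
  proof -
    have "hl_int t I E (\<lambda>x. arg_prod I E (- \<alpha>) x * 1) \<nu> = raise (- \<alpha>) (hl_int t I E (\<lambda>_. 1)) \<nu>"
      by (rule hl_int_arg_prod[OF t I f1 \<nu>(2)])
    also have "\<dots> = (\<Sum>b\<in>UNIV. \<kappa> b * (\<Prod>a\<in>set \<nu>. qbinom_sum t (count_list \<nu> a) (parity_weight 0 b a)
        (- \<alpha> * parity_weight 0 b (Suc a))))"
      by (rule raise_sorted[OF hl_int_exchange[OF t I f1] R0 \<nu>])
    finally show ?thesis
      unfolding qbinom_sum_parity_weight_0 prod_list_eq_prod_count by simp
  qed
  have "hl_int t I E (\<lambda>x. arg_prod I E (- \<beta>) x * arg_prod I E (- \<alpha>) x) lam =
      raise (- \<beta>) (hl_int t I E (\<lambda>x. arg_prod I E (- \<alpha>) x)) lam"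
    by (rule hl_int_arg_prod[OF t I f2 lam(2)])
  also have "\<dots> = (\<Sum>b\<in>UNIV. \<kappa> b * (\<Prod>a\<in>set lam. qbinom_sum t (count_list lam a) (parity_weight (- \<alpha>) b a)
        (- \<beta> * parity_weight (- \<alpha>) b (Suc a))))"
    by (rule raise_sorted[OF hl_int_exchange[OF t I f2] R1 lam])
  also have "\<dots> = hl_const t E (card I) * (A_lam lam \<alpha> \<beta> t + \<Prod>E * B_lam lam \<alpha> \<beta> t)"
    unfolding parity_weight_A_B[OF t] by (simp add: \<kappa>_def UNIV_bool algebra_simps)
  finally show ?thesis .
qed

text \<open>
  For the zero partition the symmetrised sum is a constant, so the normalisation is the case \<open>\<lambda> = 0\<close>
  of the evaluation; in particular it does not vanish.
\<close>

lemma integral_dens: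
  assumes t: "norm t < 1" and I: "finite I" "E \<subseteq> {1, - 1}" and N: "2 * card I + card E > 0"
  shows "qfact t (2 * card I + card E) * (LINT x|torus I. dens t I E x) = hl_const t E (card I)"
proof -
  let ?N = "2 * card I + card E"
  have t1: "t \<noteq> 1" using t by auto
  have fE: "finite E" using I(2) finite_subset by auto
  have fK: "finite (arg_ix I E)" using I(1) fE by simp
  have card: "card (arg_ix I E) = ?N" by (rule card_arg_ix[OF I(1) fE])
  have "hl_int t I E (\<lambda>_. 1) (replicate ?N 0) = (LINT x|torus I. qfact t ?N * dens t I E x)"
    unfolding hl_int_def
  proof (rule integral_cong_AE)
    show "AE x in torus I. hl_sum t (replicate ?N 0) (arg_val x) (arg_ix I E) * 1 * dens t I E x =
        qfact t ?N * dens t I E x"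
      using AE_generic[OF I(1)]
    proof eventually_elim
      case (elim x)
      show ?case
        using hl_sum_zeros[OF t1 fK genericD(2)[OF elim I(2)]] unfolding card by simp
    qed
    show "(\<lambda>x. hl_sum t (replicate ?N 0) (arg_val x) (arg_ix I E) * 1 * dens t I E x) \<in> borel_measurable (torus I)"
      by (rule borel_measurable_integrable, rule integrable_hl_int[where B = 1]) (use t I in auto)
    show "(\<lambda>x. qfact t ?N * dens t I E x) \<in> borel_measurable (torus I)"
      by (intro borel_measurable_times borel_measurable_const dens_measurable I)
  qed
  moreover have "hl_int t I E (\<lambda>_. 1) (replicate ?N 0) = hl_const t E (card I) * (1 + \<Prod>E * 0)"
  proof -
    have "all_even (replicate ?N 0) = 1" "all_odd (replicate ?N 0) = 0"
      using N by (auto simp: all_even_def all_odd_def)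
    then show ?thesis
      using hl_int_value[OF t I sorted_replicate_ge, of ?N 0] by simp
  qed
  ultimately show ?thesis by simp
qed

lemma hl_const_nonzero:
  assumes "norm t < 1"
  shows "hl_const t E n \<noteq> 0"
proof -
  have "1 - t \<noteq> 0" "1 + t \<noteq> 0"
    using one_minus_bound(2)[OF assms, of 1] one_minus_bound(2)[OF assms, of "- 1"] by auto
  then show ?thesis by (simp add: hl_const_def)
qed

lemma length_pm_args: "length (pm_args k x) = 2 * k"
  by (induction k) (auto simp: pm_args_def)

lemma nth_pm_args:
  assumes "j < 2 * k"
  shows "pm_args k x ! j = (if even j then x (j div 2) else inverse (x (j div 2)))"
  using assms
proof (induction k)
  case (Suc k)
  have app: "pm_args (Suc k) x = pm_args k x @ [x k, inverse (x k)]" by (simp add: pm_args_def)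
  have "j < 2 * k \<or> j = 2 * k \<or> j = Suc (2 * k)" using Suc.prems by auto
  then show ?case
    by (elim disjE) (simp_all add: app nth_append length_pm_args Suc.IH)
qed simp

lemma hl_poly_args:
  assumes "distinct extra" "length lam = 2 * k + length extra"
  shows "hl_poly lam (pm_args k x @ extra) t =
    1 / v_lam lam t * hl_sum t lam (arg_val x) (arg_ix {..<k} (set extra))"
proof -
  let ?N = "2 * k + length extra"
  define h where "h j = (if j < 2 * k then Inl (j div 2, even j) else Inr (extra ! (j - 2 * k)) :: arg_index)" for j
  have inj: "inj_on h {..<?N}"
  proof (rule inj_onI)
    fix i j assume ij: "i \<in> {..<?N}" "j \<in> {..<?N}" "h i = h j"
    show "i = j"
    proof (cases "i < 2 * k \<and> j < 2 * k")
      case True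
      then have "i div 2 = j div 2" "even i = even j" using ij(3) by (auto simp: h_def)
      then show ?thesis by (metis dvd_mult_div_cancel odd_two_times_div_two_succ)
    next
      case False
      then have "\<not> i < 2 * k" "\<not> j < 2 * k" "extra ! (i - 2 * k) = extra ! (j - 2 * k)"
        using ij(3) by (auto simp: h_def split: if_splits)
      moreover then have "i - 2 * k = j - 2 * k"
        using assms(1) ij(1,2) by (subst (asm) nth_eq_iff_index_eq) auto
      ultimately show ?thesis by linarith
    qed
  qed
  have "h ` {..<?N} = arg_ix {..<k} (set extra)"
  proof (rule card_subset_eq)
    show "finite (arg_ix {..<k} (set extra))" by simp
    show "h ` {..<?N} \<subseteq> arg_ix {..<k} (set extra)"
      by (auto simp: h_def intro!: nth_mem)
    show "card (h ` {..<?N}) = card (arg_ix {..<k} (set extra))"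
      using assms(1) by (simp add: card_image[OF inj] card_arg_ix distinct_card)
  qed
  moreover have "hl_sum t lam (arg_val x) (h ` {..<?N}) = hl_sum t lam ((!) (pm_args k x @ extra)) {..<?N}"
  proof (rule hl_sum_reindex[OF inj])
    fix j assume "j \<in> {..<?N}"
    show "arg_val x (h j) = (pm_args k x @ extra) ! j"
      by (simp add: h_def nth_append length_pm_args nth_pm_args)
  qed
  ultimately show ?thesis
    using hl_poly_eq_hl_sum[of "pm_args k x @ extra" lam t] assms(2) by (simp add: length_pm_args)
qed

text \<open>
  By \<open>1 - x\<^sup>\<plusminus>\<^sup>2 = (1 - x\<^sup>\<plusminus>\<^sup>1) (1 + x\<^sup>\<plusminus>\<^sup>1)\<close>, the parameters \<open>\<plusminus>1\<close> cancel at generic points.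
\<close>

lemma koornwinder_density_eq_dens:
  fixes a b :: complex
  assumes "s\<^sup>2 = t" "E \<subseteq> {1, - 1}" "a = (if 1 \<in> E then t else 1)" "b = (if - 1 \<in> E then - t else - 1)"
    and x: "generic {..<k} x"
  shows "koornwinder_density k x a b s (- s) t = 1 / (2 ^ k * fact k) * dens t {..<k} E x"
proof -
  have fE: "finite E" using assms(2) finite_subset by auto
  have one: "pm_fac 1 ((x i)\<^sup>2) / (pm_fac a (x i) * pm_fac b (x i) * pm_fac s (x i) * pm_fac (- s) (x i)) =
      (\<Prod>e\<in>E. pm_fac e (x i) / pm_fac (t * e) (x i)) / pm_fac t ((x i)\<^sup>2)" if i: "i < k" for i
  proof -
    have inj: "inj_on (arg_val x) (arg_ix {..<k} {1, - 1})" by (rule genericD(2)[OF x]) simp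
    have ne: "arg_val x (Inl (i, c)) \<noteq> arg_val x (Inr e)" if "e \<in> {1, - 1}" for c e
      using inj_onD[OF inj, of "Inl (i, c)" "Inr e"] i that by auto
    have nz: "pm_fac 1 (x i) \<noteq> 0" "pm_fac (- 1) (x i) \<noteq> 0"
      using ne[of 1 True] ne[of 1 False] ne[of "- 1" True] ne[of "- 1" False]
      by (simp_all add: pm_fac_def add_eq_0_iff)
    have sq: "pm_fac c u * pm_fac (- c) u = pm_fac (c\<^sup>2) (u\<^sup>2)" for c u
    proof -
      have "pm_fac c u * pm_fac (- c) u = ((1 - c * u) * (1 + c * u)) * ((1 - c * inverse u) * (1 + c * inverse u))"
        by (simp add: pm_fac_def mult_ac)
      moreover have "(1 - c * v) * (1 + c * v) = 1 - c\<^sup>2 * v\<^sup>2" for v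
        by (simp add: algebra_simps power2_eq_square)
      ultimately show ?thesis by (simp only: pm_fac_def power_inverse)
    qed
    have num: "pm_fac 1 ((x i)\<^sup>2) = pm_fac 1 (x i) * pm_fac (- 1) (x i)"
      using sq[of 1 "x i"] by simp
    have den: "pm_fac a (x i) * pm_fac b (x i) * pm_fac s (x i) * pm_fac (- s) (x i) =
       pm_fac a (x i) * pm_fac b (x i) * pm_fac t ((x i)\<^sup>2)"
      using sq[of s "x i"] assms(1) by (simp add: mult.assoc)
    have neq: "(1::complex) \<noteq> - 1" by simp
    have "E = {} \<or> E = {1} \<or> E = {- 1} \<or> E = {1, - 1}" using assms(2) by blast
    then have "pm_fac 1 (x i) * pm_fac (- 1) (x i) / (pm_fac a (x i) * pm_fac b (x i)) =
      (\<Prod>e\<in>E. pm_fac e (x i) / pm_fac (t * e) (x i))"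
    proof (elim disjE)
      assume "E = {1, - 1}"
      then show ?thesis using neq by (simp add: assms(3,4))
    qed (use nz neq in \<open>simp_all add: assms(3,4)\<close>)
    then show ?thesis unfolding num den by (simp only: divide_divide_eq_left[symmetric])
  qed
  have set: "{j \<in> {..<k}. i < j} = {i<..<k}" for i by auto
  have "(\<Prod>i<k. pm_fac 1 ((x i)\<^sup>2) / (pm_fac a (x i) * pm_fac b (x i) * pm_fac s (x i) * pm_fac (- s) (x i))) =
      (\<Prod>i<k. (\<Prod>e\<in>E. pm_fac e (x i) / pm_fac (t * e) (x i)) / pm_fac t ((x i)\<^sup>2))"
    by (intro prod.cong refl) (simp only: one lessThan_iff)
  then show ?thesis
    unfolding koornwinder_density_def dens_def pair_factor_def set by (simp only: mult.assoc)
qed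

lemma koornwinder_density_measurable:
  "(\<lambda>x. koornwinder_density k x a b c d t) \<in> borel_measurable (torus {..<k})"
  unfolding koornwinder_density_def
  by (intro borel_measurable_times borel_measurable_prod borel_measurable_divide pm_fac_measurable
      borel_measurable_power borel_measurable_inverse borel_measurable_const torus_component)
     auto

lemma torus_measure_eq: "torus_measure k = torus {..<k}"
  by (simp add: torus_measure_def torus_def)

text \<open>
  All four cases at once. The prefactor supplies the linear factors of the extra arguments, so that
  the linear factors run over all arguments of \<open>P\<^sub>\<lambda>\<close>.
\<close>

lemma normalised_hl_integral:
  fixes a b :: complex
  assumes t: "norm t < 1" and s: "s\<^sup>2 = t" and lam: "is_partition lam" "length lam = 2 * k + length extra" "length lam > 0"
    and extra: "distinct extra" "set extra \<subseteq> {1, - 1}"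
    and a: "a = (if 1 \<in> set extra then t else 1)" and b: "b = (if - 1 \<in> set extra then - t else - 1)"
  shows "(\<Prod>e\<in>set extra. (1 - \<alpha> * e) * (1 - \<beta> * e)) / koornwinder_Z k a b s (- s) t *
      hl_integral k lam extra a b s (- s) \<alpha> \<beta> t =
    phi_poly (length lam) t / (v_lam lam t * (1 - t) ^ length lam) *
      (A_lam lam \<alpha> \<beta> t + \<Prod>(set extra) * B_lam lam \<alpha> \<beta> t)"
proof -
  let ?I = "{..<k}" and ?E = "set extra"
  let ?S = "\<lambda>x. hl_sum t lam (arg_val x) (arg_ix ?I ?E)" and ?Q = "\<lambda>x. \<Prod>i<k. pm_fac \<alpha> (x i) * pm_fac \<beta> (x i)"
  let ?X = "A_lam lam \<alpha> \<beta> t + \<Prod>?E * B_lam lam \<alpha> \<beta> t"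
  let ?J = "hl_integral k lam extra a b s (- s) \<alpha> \<beta> t" and ?Z = "koornwinder_Z k a b s (- s) t"
  let ?P = "\<Prod>e\<in>?E. (1 - \<alpha> * e) * (1 - \<beta> * e)"
  let ?c = "1 / (2 ^ k * fact k) :: complex"
  have len: "length lam = 2 * card ?I + card ?E"
    using lam(2) extra(1) by (simp add: distinct_card)
  have kd: "koornwinder_density k x a b s (- s) t = ?c * dens t ?I ?E x" if "generic ?I x" for x
    by (rule koornwinder_density_eq_dens[OF s extra(2) a b that])
  have "?Z = (LINT x|torus ?I. ?c * dens t ?I ?E x)"
    unfolding koornwinder_Z_def torus_measure_eq
  proof (rule integral_cong_AE[OF koornwinder_density_measurable])
    show "(\<lambda>x. ?c * dens t ?I ?E x) \<in> borel_measurable (torus ?I)"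
      by (intro borel_measurable_times borel_measurable_const dens_measurable) simp
    show "AE x in torus ?I. koornwinder_density k x a b s (- s) t = ?c * dens t ?I ?E x"
      using AE_generic[of ?I] by (auto elim!: eventually_mono simp: kd)
  qed
  then have Z: "?Z = ?c * (LINT x|torus ?I. dens t ?I ?E x)" by simp
  have D: "qfact t (length lam) * (LINT x|torus ?I. dens t ?I ?E x) = hl_const t ?E (card ?I)"
    using integral_dens[OF t _ extra(2), of ?I] lam(3) unfolding len by simp
  have argp: "arg_prod ?I ?E (- c) x = (\<Prod>i\<in>?I. pm_fac c (x i)) * (\<Prod>e\<in>?E. 1 - c * e)" for c x
    unfolding arg_prod_def by (simp add: prod_arg_ix pm_fac_def)
  let ?f = "\<lambda>x. arg_prod ?I ?E (- \<beta>) x * arg_prod ?I ?E (- \<alpha>) x"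
  have "?P * ?J =
    (LINT x|torus ?I. ?P * (hl_poly lam (pm_args k x @ extra) t * koornwinder_density k x a b s (- s) t *
        ?Q x))"
    unfolding hl_integral_def torus_measure_eq by simp
  also have "\<dots> = (LINT x|torus ?I. ?c / v_lam lam t * (?S x * ?f x * dens t ?I ?E x))"
    unfolding hl_poly_args[OF extra(1) lam(2)]
  proof (rule integral_cong_AE)
    have hs: "(\<lambda>x. ?S x) \<in> borel_measurable (torus ?I)"
      by (rule hl_sum_measurable) (auto intro: arg_val_measurable)
    show "(\<lambda>x. ?P * (1 / v_lam lam t * ?S x * koornwinder_density k x a b s (- s) t *
        ?Q x)) \<in> borel_measurable (torus ?I)"
      by (intro borel_measurable_times borel_measurable_prod borel_measurable_const hs
          koornwinder_density_measurable pm_fac_measurable torus_component)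
    show "(\<lambda>x. ?c / v_lam lam t * (?S x * ?f x * dens t ?I ?E x)) \<in> borel_measurable (torus ?I)"
      by (intro borel_measurable_times borel_measurable_const hs arg_prod_measurable dens_measurable) simp_all
    show "AE x in torus ?I. ?P * (1 / v_lam lam t * ?S x * koornwinder_density k x a b s (- s) t *
        ?Q x) =
       ?c / v_lam lam t * (?S x * ?f x * dens t ?I ?E x)"
      using AE_generic[of ?I, OF finite_lessThan]
    proof eventually_elim
      case (elim x)
      show ?case unfolding kd[OF elim] argp by (simp add: prod.distrib mult_ac)
    qed
  qed
  also have "\<dots> = ?c / v_lam lam t * hl_int t ?I ?E ?f lam"
    unfolding hl_int_def by simp
  also have "hl_int t ?I ?E ?f lam = hl_const t ?E (card ?I) * ?X"
    using lam(1) by (intro hl_int_arg_prods t extra len) (auto simp: is_partition_def)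
  finally have J: "?P * ?J =
    ?c / v_lam lam t * (hl_const t ?E (card ?I) * ?X)" .
  have phi: "phi_poly (length lam) t / (1 - t) ^ length lam = qfact t (length lam)"
    by (simp add: phi_poly_def qfact_def qnum_def prod_dividef)
  have c0: "?c \<noteq> 0" by simp
  have L0: "(LINT x|torus ?I. dens t ?I ?E x) \<noteq> 0" using D hl_const_nonzero[OF t] by force
  have "?P / ?Z * ?J =
     (?P * ?J) / ?Z" by simp
  also have "\<dots> = qfact t (length lam) / v_lam lam t * ?X"
  proof -
    have "(c / v * (Q * L * X)) / (c * L) = Q / v * X" if "c \<noteq> 0" "L \<noteq> 0" for c v Q L X :: complex
      using that by simp
    from this[OF c0 L0] show ?thesis unfolding J Z D[symmetric] .
  qed
  also have "\<dots> = phi_poly (length lam) t / (v_lam lam t * (1 - t) ^ length lam) *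
      ?X"
    unfolding phi[symmetric] by (simp add: mult.commute)
  finally show ?thesis .
qed

theorem theorem5p2:
  fixes t s \<alpha> \<beta> :: complex and n :: nat and lam :: "nat list"
  assumes "norm t < 1" and "s\<^sup>2 = t" and "is_partition lam"
  shows
    "(n \<ge> 1 \<and> length lam = 2 * n \<longrightarrow>
        1 / koornwinder_Z n 1 (-1) s (-s) t *
        hl_integral n lam [] 1 (-1) s (-s) \<alpha> \<beta> t
        = phi_poly (2 * n) t / (v_lam lam t * (1 - t) ^ (2 * n)) *
          (A_lam lam \<alpha> \<beta> t + B_lam lam \<alpha> \<beta> t)) \<and>
     (n \<ge> 1 \<and> length lam = 2 * n \<longrightarrow>
        (1 - \<alpha>\<^sup>2) * (1 - \<beta>\<^sup>2) / koornwinder_Z (n - 1) t (-t) s (-s) t *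
        hl_integral (n - 1) lam [1, -1] t (-t) s (-s) \<alpha> \<beta> t
        = phi_poly (2 * n) t / (v_lam lam t * (1 - t) ^ (2 * n)) *
          (A_lam lam \<alpha> \<beta> t - B_lam lam \<alpha> \<beta> t)) \<and>
     (length lam = 2 * n + 1 \<longrightarrow>
        (1 - \<alpha>) * (1 - \<beta>) / koornwinder_Z n t (-1) s (-s) t *
        hl_integral n lam [1] t (-1) s (-s) \<alpha> \<beta> t
        = phi_poly (2 * n + 1) t / (v_lam lam t * (1 - t) ^ (2 * n + 1)) *
          (A_lam lam \<alpha> \<beta> t + B_lam lam \<alpha> \<beta> t)) \<and>
     (length lam = 2 * n + 1 \<longrightarrow>
        (1 + \<alpha>) * (1 + \<beta>) / koornwinder_Z n 1 (-t) s (-s) t *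
        hl_integral n lam [-1] 1 (-t) s (-s) \<alpha> \<beta> t
        = phi_poly (2 * n + 1) t / (v_lam lam t * (1 - t) ^ (2 * n + 1)) *
          (A_lam lam \<alpha> \<beta> t - B_lam lam \<alpha> \<beta> t))"
proof (intro conjI impI)
  have neq: "(1::complex) \<noteq> - 1" by simp
  note main = normalised_hl_integral[OF assms]
  {
    assume len: "n \<ge> 1 \<and> length lam = 2 * n"
    show "1 / koornwinder_Z n 1 (-1) s (-s) t * hl_integral n lam [] 1 (-1) s (-s) \<alpha> \<beta> t
        = phi_poly (2 * n) t / (v_lam lam t * (1 - t) ^ (2 * n)) * (A_lam lam \<alpha> \<beta> t + B_lam lam \<alpha> \<beta> t)"
      using main[of n "[]" 1 "- 1" \<alpha> \<beta>] len by simp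
    have "(1 - \<alpha> * 1) * (1 - \<beta> * 1) * ((1 - \<alpha> * - 1) * (1 - \<beta> * - 1)) = (1 - \<alpha>\<^sup>2) * (1 - \<beta>\<^sup>2)"
      by (simp add: algebra_simps power2_eq_square)
    moreover obtain n' where "n = Suc n'" using len by (cases n) auto
    ultimately show "(1 - \<alpha>\<^sup>2) * (1 - \<beta>\<^sup>2) / koornwinder_Z (n - 1) t (-t) s (-s) t *
        hl_integral (n - 1) lam [1, -1] t (-t) s (-s) \<alpha> \<beta> t
        = phi_poly (2 * n) t / (v_lam lam t * (1 - t) ^ (2 * n)) * (A_lam lam \<alpha> \<beta> t - B_lam lam \<alpha> \<beta> t)"
      using main[of n' "[1, - 1]" t "- t" \<alpha> \<beta>] len neq by simp
  }
  assume len: "length lam = 2 * n + 1"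
  show "(1 - \<alpha>) * (1 - \<beta>) / koornwinder_Z n t (-1) s (-s) t * hl_integral n lam [1] t (-1) s (-s) \<alpha> \<beta> t
        = phi_poly (2 * n + 1) t / (v_lam lam t * (1 - t) ^ (2 * n + 1)) * (A_lam lam \<alpha> \<beta> t + B_lam lam \<alpha> \<beta> t)"
    using main[of n "[1]" t "- 1" \<alpha> \<beta>] len neq by simp
  show "(1 + \<alpha>) * (1 + \<beta>) / koornwinder_Z n 1 (-t) s (-s) t * hl_integral n lam [-1] 1 (-t) s (-s) \<alpha> \<beta> t
        = phi_poly (2 * n + 1) t / (v_lam lam t * (1 - t) ^ (2 * n + 1)) * (A_lam lam \<alpha> \<beta> t - B_lam lam \<alpha> \<beta> t)"
    using main[of n "[- 1]" 1 "- t" \<alpha> \<beta>] len neq by simp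
qed

end
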